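(* Let $0<\beta<\frac{\pi}{2}$, let $N$ be a non-negative integer and write $\theta=\arg\nu$. (a) For $|\theta|<\frac{\pi}{2}$, $$|R_N(\nu,\beta)|\le\frac{1}{\pi}\frac{(2N)!\,|a_N(-\sec\beta)|}{|\nu|^{2N+1}}\begin{cases}|\csc(2\theta)| & \text{if } \frac{\pi}{4}<|\theta|<\frac{\pi}{2},\\ 1 & \text{if } |\theta|\le\frac{\pi}{4}.\end{cases}$$ (b) If $\nu>0$, then $$R_N(\nu,\beta) = -\frac{1}{\pi}\frac{(2N)!\,a_N(-\sec\beta)}{\nu^{2N+1}}\Theta$$ for some number $0<\Theta<1$ depending on $\nu$, $\beta$ and $N$. (c) The bound $$|R_N(\nu,\beta)|\le\sqrt{\frac{e}{2}\left(N+\frac32\right)}\;\frac{1}{\pi}\frac{(2N)!\,|a_N(-\sec\beta)|}{|\nu|^{2N+1}}$$ holds for $\frac{\pi}{4}+\arctan\left(\left(\frac{4N+5}{2}\right)^{-\frac12}\right)<|\theta|\le\frac{\pi}{2}$ when $N\ge0$, and it holds for $\frac{\pi}{4}<|\theta|\le\frac{\pi}{2}$ when $N\ge1$.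
   Context: The Anger--Weber function is $\mathbf{A}_{-\nu}(z) = \frac{1}{\pi}\int_0^{+\infty} e^{\nu t - z\sinh t}\,dt$ for $|\arg z|<\frac{\pi}{2}$. The coefficients $a_n(-\sec\beta)$ and the remainder $R_N(\nu,\beta)$ are defined by $$a_n(-\sec\beta) = -\frac{1}{(2n)!}\left[\frac{d^{2n}}{dt^{2n}}\left(\frac{t}{\sec\beta\,\sinh t - t}\right)^{2n+1}\right]_{t=0},\qquad \mathbf{A}_{-\nu}(\nu\sec\beta) = -\frac{1}{\pi}\sum_{n=0}^{N-1}\frac{(2n)!\,a_n(-\sec\beta)}{\nu^{2n+1}} + R_N(\nu,\beta)$$ for $|\arg\nu|<\frac{\pi}{2}$, and $R_N(\nu,\beta)$ is extended to $|\arg\nu|\le\frac{\pi}{2}$, $\nu\ne0$, by analytic continuation in $\nu$. Empty sums are zero. *)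

theory Defs
  imports "HOL-Complex_Analysis.Complex_Analysis"
begin

definition sec :: "real \<Rightarrow> real" where
  "sec x = 1 / cos x"

definition csc :: "real \<Rightarrow> real" where
  "csc x = 1 / sin x"

text \<open>The Anger--Weber function of order \<open>\<mu>\<close> at \<open>z\<close>, meaningful for \<open>\<bar>Arg z\<bar> < pi/2\<close>.  The order enters
  with a minus sign, so that \<open>anger_weber (-\<nu>) z\<close> has the integrand \<open>exp (\<nu> t - z sinh t)\<close>.\<close>

definition anger_weber :: "complex \<Rightarrow> complex \<Rightarrow> complex" where
  "anger_weber \<mu> z =
     1 / of_real pi * integral {0..} (\<lambda>t::real. exp (- \<mu> * of_real t - z * of_real (sinh t)))"

text \<open>The function \<open>t / (sec \<beta> sinh t - t)\<close> has a removable singularity at \<open>0\<close>, where its limit is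
  \<open>1 / (sec \<beta> - 1)\<close>.  This value has to be supplied explicitly since \<open>0 / 0 = 0\<close>.\<close>

definition anger_base :: "real \<Rightarrow> real \<Rightarrow> real" where
  "anger_base \<beta> t = (if t = 0 then 1 / (sec \<beta> - 1) else t / (sec \<beta> * sinh t - t))"

text \<open>\<open>anger_coeff n \<beta>\<close> is \<open>a\<^sub>n(-sec \<beta>)\<close>.\<close>

definition anger_coeff :: "nat \<Rightarrow> real \<Rightarrow> real" where
  "anger_coeff n \<beta> =
     - (1 / fact (2 * n)) * (deriv ^^ (2 * n)) (\<lambda>t. anger_base \<beta> t ^ (2 * n + 1)) 0"

text \<open>\<open>R\<close> satisfies the defining equation of the remainder in the open right half-plane and is analytic
  in the closed right half-plane without the origin (\<open>analytic_on\<close> means holomorphic in a neighbourhood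
  of every point).  This fixes \<open>R\<close> on that set.  The conditions \<open>\<nu> \<noteq> 0\<close> are needed because \<open>Arg 0 = 0\<close>.\<close>

definition is_anger_remainder :: "nat \<Rightarrow> real \<Rightarrow> (complex \<Rightarrow> complex) \<Rightarrow> bool" where
  "is_anger_remainder N \<beta> R \<longleftrightarrow>
     R analytic_on {\<nu>. \<nu> \<noteq> 0 \<and> \<bar>Arg \<nu>\<bar> \<le> pi / 2} \<and>
     (\<forall>\<nu>. \<nu> \<noteq> 0 \<and> \<bar>Arg \<nu>\<bar> < pi / 2 \<longrightarrow>
        anger_weber (- \<nu>) (\<nu> * of_real (sec \<beta>)) =
          - (1 / of_real pi) *
            (\<Sum>n<N. fact (2 * n) * of_real (anger_coeff n \<beta>) / \<nu> ^ (2 * n + 1)) + R \<nu>)"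

definition anger_remainder :: "nat \<Rightarrow> complex \<Rightarrow> real \<Rightarrow> complex" where
  "anger_remainder N \<nu> \<beta> = (SOME R. is_anger_remainder N \<beta> R) \<nu>"

end

theory Submission
  imports
    Defs
    "HOL-Complex_Analysis.Complex_Analysis"
    "HOL-Probability.Distributions"
    "HOL-Real_Asymp.Real_Asymp"
begin

text \<open>
  Put \<open>f(z) = sec \<beta> sinh z - z\<close>.  Substituting \<open>u = f(t)\<close> turns \<open>\<pi> A(\<nu>)\<close> into the Laplace transform of
  \<open>dt/du\<close>.  On the curve \<open>cos y = cos \<beta> x / sinh x\<close> one has \<open>f(x + \<i> y) = \<i> h(x)\<close> with \<open>h > 0\<close>, and this
  curve and its mirror image bound a neighbourhood of the real axis on which \<open>f\<close> is injective.  Cauchy's theorem in it,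
  applied to \<open>2 f / (f\<^sup>2 - u\<^sup>2)\<close> and to \<open>1 / f\<^bsup>2n+1\<^esup>\<close>, gives, with all integrals over \<open>x > 0\<close>,
  \<open>dt/du = (2/\<pi>) \<integral> h / (h\<^sup>2 + u\<^sup>2) dx\<close> and \<open>- a\<^sub>n = (-1)\<^sup>n (2/\<pi>) \<integral> h\<^bsup>-2n-1\<^esup> dx\<close>.
  Expanding the kernel as a geometric sum yields \<open>R\<^sub>N(\<nu>) = (-1)\<^sup>N (2/\<pi>\<^sup>2) \<integral> T(\<nu> h) dx\<close>, where
  \<open>T(w) = \<integral> e\<^bsup>-wv\<^esup> v\<^bsup>2N\<^esup> / (1 + v\<^sup>2) dv\<close>.  All three claims thereby reduce to bounds of
  \<open>T(w)\<close> by multiples of \<open>(2N)! / \<bar>w\<bar>\<^bsup>2N+1\<^esup>\<close>, which follow from turning the ray of integration in \<open>T\<close>;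
  turned rays also provide the continuation past the imaginary axis.
\<close>

section \<open>Integrals over the half line\<close>

text \<open>The sharp factor \<open>\<bar>a\<^sub>N\<bar>\<close> comes from positivity: since
  \<open>h > 0\<close>, the integral of \<open>1 / h^(2N+1)\<close> equals
  \<open>pi/2 * \<bar>a\<^sub>N\<bar>\<close> exactly, so taking absolute values inside it costs
  nothing. Moreover all the points \<open>\<nu> * h(x)\<close> have the argument of
  \<open>\<nu>\<close>. One choice of ray therefore serves every \<open>x\<close>, and a bound for
  \<open>T\<close> integrates to the claimed bound with the same constant. Both functions integrated
  over the contour are odd in \<open>f\<close>, hence purely imaginary on the curve, where
  \<open>f = \<i> h\<close>. Comparing imaginary parts removes the slope of the curve, which leaves
  plain \<open>dx\<close>; of the slope only its existence has to be known. The remainder is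
  selected by a choice operator, so a function continuing it across the imaginary axis has to be
  constructed before anything can be said about it. The integral for \<open>T\<close> converges only
  for \<open>Re w > 0\<close>; a ray turned by an angle up to \<open>pi/2\<close> has a half-plane
  of convergence turned accordingly, and the pieces agree where they overlap. On the axis itself the
  bound in (c) is obtained as a limit from the right.\<close>

lemma parametric_integral_holomorphic:
  fixes F :: "complex \<Rightarrow> 'a \<Rightarrow> complex"
  assumes hol: "\<And>x. x \<in> space M \<Longrightarrow> (\<lambda>z. F z x) holomorphic_on S"
    and meas: "\<And>z. z \<in> S \<Longrightarrow> F z \<in> borel_measurable M"
    and dom: "\<And>z. z \<in> S \<Longrightarrow> \<exists>r>0. \<exists>g. cball z r \<subseteq> S \<and> integrable M g \<and>
                 (\<forall>w\<in>cball z r. \<forall>x\<in>space M. norm (F w x) \<le> g x)"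
  shows "(\<lambda>z. \<integral>x. F z x \<partial>M) holomorphic_on S"
proof -
  have "(\<lambda>z. \<integral>x. F z x \<partial>M) field_differentiable (at z)" if zin: "z \<in> S" for z
  proof -
    obtain r g where r: "r > 0" and sub: "cball z r \<subseteq> S" and g: "integrable M g"
      and bd: "\<And>w x. w \<in> cball z r \<Longrightarrow> x \<in> space M \<Longrightarrow> norm (F w x) \<le> g x"
      using dom[OF zin] by blast
    define D where "D x = deriv (\<lambda>z. F z x) z" for x
    have holb: "(\<lambda>z. F z x) holomorphic_on cball z r" if "x \<in> space M" for x
      using hol[OF that] sub by (rule holomorphic_on_subset)
    have sub2: "cball w (r/2) \<subseteq> cball z r" if "w \<in> ball z (r/2)" for w
    proof
      fix y assume "y \<in> cball w (r/2)"
      with that show "y \<in> cball z r" using dist_triangle[of z y w] by simp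
    qed
    \<comment> \<open>Cauchy's inequality on discs of radius \<open>r/2\<close> bounds the
      derivative by \<open>2 * g x / r\<close>, which then dominates all difference
      quotients.\<close>
    have lip: "norm (F w x - F z x) \<le> (2 * g x / r) * norm (w - z)"
      if w: "w \<in> ball z (r/2)" and x: "x \<in> space M" for w x
    proof (rule field_differentiable_bound[of "ball z (r/2)" "\<lambda>w. F w x" "deriv (\<lambda>w. F w x)"])
      fix v assume v: "v \<in> ball z (r/2)"
      then have "v \<in> ball z r" using r by (auto simp: dist_commute)
      then show "((\<lambda>w. F w x) has_field_derivative deriv (\<lambda>w. F w x) v) (at v within ball z (r/2))"
        by (intro DERIV_subset[OF holomorphic_derivI[OF holomorphic_on_subset[OF holb[OF x] ball_subset_cball]]]) auto
      have "norm ((deriv ^^ 1) (\<lambda>w. F w x) v) \<le> fact 1 * g x / (r/2) ^ 1"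
      proof (rule Cauchy_inequality)
        show "(\<lambda>w. F w x) holomorphic_on ball v (r/2)"
          using holb[OF x] sub2[OF v] ball_subset_cball by (meson holomorphic_on_subset subset_trans)
        show "continuous_on (cball v (r/2)) (\<lambda>w. F w x)"
          using holb[OF x] sub2[OF v] holomorphic_on_imp_continuous_on holomorphic_on_subset by blast
        show "norm (F y x) \<le> g x" if "norm (v - y) = r/2" for y
          using that sub2[OF v] bd[OF _ x, of y] by (auto simp: dist_norm)
      qed (use r in auto)
      then show "norm (deriv (\<lambda>w. F w x) v) \<le> 2 * g x / r" by (simp add: field_simps)
    qed (use w r in auto)
    have Dlim: "((\<lambda>w. (F w x - F z x) / (w - z)) \<longlongrightarrow> D x) (at z within ball z (r/2))" if x: "x \<in> space M" for x
    proof -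
      have "((\<lambda>w. F w x) has_field_derivative D x) (at z)"
        unfolding D_def using r
        by (intro holomorphic_derivI[OF holomorphic_on_subset[OF holb[OF x] ball_subset_cball]]) auto
      then show ?thesis
        by (auto simp: has_field_derivative_iff intro: tendsto_within_subset)
    qed
    have integ: "integrable M (F w)" if "w \<in> cball z r" for w
      using sub that by (intro Bochner_Integration.integrable_bound[OF g] meas AE_I2) (auto intro!: order_trans[OF bd abs_ge_self])
    have "((\<lambda>w. ((\<integral>x. F w x \<partial>M) - (\<integral>x. F z x \<partial>M)) / (w - z)) \<longlongrightarrow> (\<integral>x. D x \<partial>M)) (at z within ball z (r/2))"
      unfolding tendsto_at_iff_sequentially
    proof (intro allI impI)
      fix X :: "nat \<Rightarrow> complex" assume X: "\<forall>i. X i \<in> ball z (r/2) - {z}" "X \<longlonglongrightarrow> z"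
      have Xc: "X i \<in> cball z r" for i using X(1)[rule_format, of i] r by auto
      have lim: "(\<lambda>i. (F (X i) x - F z x) / (X i - z)) \<longlonglongrightarrow> D x" if "x \<in> space M" for x
        using Dlim[OF that] X unfolding tendsto_at_iff_sequentially o_def by blast
      have m: "(\<lambda>x. (F (X i) x - F z x) / (X i - z)) \<in> borel_measurable M" for i
        using meas[of "X i"] meas[OF zin] Xc[of i] sub by auto
      have "(\<lambda>i. \<integral>x. (F (X i) x - F z x) / (X i - z) \<partial>M) \<longlonglongrightarrow> (\<integral>x. D x \<partial>M)"
      proof (rule integral_dominated_convergence)
        \<comment> \<open>The derivative is measurable as a pointwise limit of measurable difference
          quotients.\<close>
        show "D \<in> borel_measurable M"
          by (rule borel_measurable_LIMSEQ_metric[OF m lim])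
        show "integrable M (\<lambda>x. 2 * g x / r)" using g by auto
        show "AE x in M. norm ((F (X i) x - F z x) / (X i - z)) \<le> 2 * g x / r" for i
          using lip[of "X i"] X(1) by (intro AE_I2) (simp add: norm_divide divide_le_eq)
      qed (use m lim in auto)
      moreover have "(\<integral>x. (F (X i) x - F z x) / (X i - z) \<partial>M) = ((\<integral>x. F (X i) x \<partial>M) - (\<integral>x. F z x \<partial>M)) / (X i - z)" for i
        using integ[OF Xc[of i]] integ[of z] r by (simp add: Bochner_Integration.integral_diff)
      ultimately show "((\<lambda>w. ((\<integral>x. F w x \<partial>M) - (\<integral>x. F z x \<partial>M)) / (w - z)) \<circ> X) \<longlonglongrightarrow> (\<integral>x. D x \<partial>M)"
        by (simp only: o_def)
    qed
    moreover have "at z within ball z (r/2) = at z" using r by (intro at_within_open) auto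
    ultimately show ?thesis
      unfolding field_differentiable_def has_field_derivative_iff by auto
  qed
  then show ?thesis
    by (auto simp: holomorphic_on_def intro: field_differentiable_at_within)
qed

text \<open>A measure space of its own, so that estimates valid for \<open>x \<ge> 0\<close> are
  estimates on the whole space and Fubini applies to its square without indicator functions.\<close>

definition half_line :: "real measure" where
  "half_line = restrict_space lborel {0..}"

lemma space_half_line [simp]: "space half_line = {0..}"
  by (simp add: half_line_def space_restrict_space)

lemma sets_half_line [measurable_cong]: "sets half_line = sets (restrict_space borel {0..})"
  by (simp add: half_line_def sets_restrict_space)

interpretation half_line: sigma_finite_measure half_line
  unfolding half_line_def by (intro sigma_finite_measure_restrict_space) (auto intro: sigma_finite_lborel)

lemma measurable_half_line [measurable (raw)]:
  "f \<in> borel_measurable borel \<Longrightarrow> f \<in> borel_measurable half_line"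
  unfolding half_line_def by (intro measurable_restrict_space1) simp

lemma measurable_half_line_continuous:
  fixes f :: "real \<Rightarrow> 'a::topological_space"
  assumes "continuous_on {0..} f"
  shows "f \<in> borel_measurable half_line"
  using borel_measurable_continuous_on_restrict[OF assms]
  by (simp cong: measurable_cong_sets add: sets_half_line)

lemma half_line_integrable_iff:
  fixes f :: "real \<Rightarrow> 'a::{banach, second_countable_topology}"
  shows "integrable half_line f \<longleftrightarrow> set_integrable lborel {0..} f"
  by (simp add: half_line_def integrable_restrict_space set_integrable_def)

lemma half_line_integral_eq:
  fixes f :: "real \<Rightarrow> 'a::{banach, second_countable_topology}"
  shows "(\<integral>x. f x \<partial>half_line) = (LINT x:{0..}|lborel. f x)"
  by (simp add: half_line_def integral_restrict_space set_lebesgue_integral_def)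

text \<open>Euler's integral for \<open>k!\<close>, rescaled by \<open>a\<close>. It is the usual
  majorant in what follows and the source of the factorials in the bounds.\<close>

lemma half_line_power_exp:
  fixes a :: real assumes "a > 0"
  shows "integrable half_line (\<lambda>x. x ^ k * exp (- (a * x)))"
    and "(\<integral>x. x ^ k * exp (- (a * x)) \<partial>half_line) = fact k / a ^ Suc k"
proof -
  have "(\<integral>\<^sup>+x. ennreal (x ^ k * exp (- x)) * indicator {0..} x \<partial>lborel) = ennreal (fact k)"
    using nn_intergal_power_times_exp_Ici[of k] by simp
  moreover have "ennreal (indicator {0..} x *\<^sub>R (x ^ k * exp (- x))) = ennreal (x ^ k * exp (- x)) * indicator {0..} x" for x :: real
    by (simp add: indicator_def)
  ultimately have "(\<integral>\<^sup>+x. ennreal (indicator {0..} x *\<^sub>R (x ^ k * exp (- x))) \<partial>lborel) = ennreal (fact k)"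
    by simp
  then have 1: "has_bochner_integral lborel (\<lambda>x. indicator {0..} x *\<^sub>R (x ^ k * exp (- x))) (fact k :: real)"
    by (rule has_bochner_integral_nn_integral[rotated 3]) (auto simp: indicator_def)
  have 2: "indicator {0..} (a * x) *\<^sub>R ((a * x) ^ k * exp (- (a * x))) = 
     a ^ k *\<^sub>R (indicator {0..} x *\<^sub>R (x ^ k * exp (- (a * x))))" for x
    using assms by (auto simp: indicator_def power_mult_distrib zero_le_mult_iff)
  have "has_bochner_integral lborel (\<lambda>x. indicator {0..} (a * x) *\<^sub>R ((a * x) ^ k * exp (- (a * x)))) (fact k / a)"
    using lborel_has_bochner_integral_real_affine_iff[of a "\<lambda>x. indicator {0..} x *\<^sub>R (x ^ k * exp (- x))" "fact k" 0] 1 assms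
    by (simp add: divide_inverse mult.commute)
  then have "has_bochner_integral lborel (\<lambda>x. (1 / a ^ k) *\<^sub>R a ^ k *\<^sub>R (indicator {0..} x *\<^sub>R (x ^ k * exp (- (a * x))))) ((1 / a ^ k) *\<^sub>R (fact k / a))"
    unfolding 2 by (intro has_bochner_integral_scaleR_right)
  then have 3: "has_bochner_integral lborel (\<lambda>x. indicator {0..} x *\<^sub>R (x ^ k * exp (- (a * x)))) (fact k / a ^ Suc k)"
    using assms by (simp add: field_simps)
  show "integrable half_line (\<lambda>x. x ^ k * exp (- (a * x)))"
    using 3 by (simp add: half_line_integrable_iff set_integrable_def has_bochner_integral_iff)
  show "(\<integral>x. x ^ k * exp (- (a * x)) \<partial>half_line) = fact k / a ^ Suc k"
    using 3 by (simp add: half_line_integral_eq set_lebesgue_integral_def has_bochner_integral_iff)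
qed

section \<open>The basic terminant\<close>

lemma half_line_integral_scale:
  fixes f :: "real \<Rightarrow> 'a::{banach, second_countable_topology}"
  assumes "r > 0"
  shows "(\<integral>x. f x \<partial>half_line) = r *\<^sub>R (\<integral>x. f (r * x) \<partial>half_line)"
proof -
  have "(\<integral>x. indicator {0..} x *\<^sub>R f x \<partial>lborel) = r *\<^sub>R (\<integral>x. indicator {0..} (r * x) *\<^sub>R f (r * x) \<partial>lborel)"
    using lborel_integral_real_affine[of r "\<lambda>x. indicator {0..} x *\<^sub>R f x" 0] assms by simp
  moreover have "indicator {0..} (r * x) = (indicator {0..} x :: real)" for x
    using assms by (auto simp: indicator_def zero_le_mult_iff)
  ultimately show ?thesis by (simp add: half_line_integral_eq set_lebesgue_integral_def)
qed

section \<open>Laplace integrals in the right half-plane and the identity theorem along a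
  ray\<close>

lemma half_line_Laplace_integrable:
  fixes g :: "real \<Rightarrow> complex"
  assumes "g \<in> borel_measurable half_line" "\<And>x. x \<ge> 0 \<Longrightarrow> norm (g x) \<le> x ^ k" "Re w > 0"
  shows "integrable half_line (\<lambda>x. exp (- (w * of_real x)) * g x)"
proof (rule Bochner_Integration.integrable_bound[OF half_line_power_exp(1)[OF assms(3), of k]])
  show "(\<lambda>x. exp (- (w * of_real x)) * g x) \<in> borel_measurable half_line"
    by (intro borel_measurable_times[OF measurable_half_line assms(1)] borel_measurable_continuous_onI continuous_intros)
  show "AE x in half_line. norm (exp (- (w * of_real x)) * g x) \<le> norm (x ^ k * exp (- (Re w * x)))"
    using assms(2) by (intro AE_I2) (simp add: norm_mult mult.commute[of "x ^ k" for x] mult_left_mono)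
qed

lemma half_line_Laplace_holomorphic:
  fixes g :: "real \<Rightarrow> complex"
  assumes g: "g \<in> borel_measurable half_line" and le: "\<And>x. x \<ge> 0 \<Longrightarrow> norm (g x) \<le> x ^ k"
  shows "(\<lambda>w. \<integral>x. exp (- (w * of_real x)) * g x \<partial>half_line) holomorphic_on {w. Re w > 0}"
proof (rule parametric_integral_holomorphic)
  show "(\<lambda>w. exp (- (w * of_real x)) * g x) holomorphic_on {w. Re w > 0}" for x
    by (intro holomorphic_intros)
  show "(\<lambda>x. exp (- (w * of_real x)) * g x) \<in> borel_measurable half_line" for w
    by (intro borel_measurable_times[OF measurable_half_line g] borel_measurable_continuous_onI continuous_intros)
  fix z :: complex assume "z \<in> {w. Re w > 0}"
  then have z: "Re z > 0" by simp
  have ge: "Re w \<ge> Re z / 2" if "w \<in> cball z (Re z / 2)" for w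
    using that abs_Re_le_cmod[of "z - w"] by (auto simp: dist_norm abs_le_iff)
  show "\<exists>r>0. \<exists>G. cball z r \<subseteq> {w. Re w > 0} \<and> integrable half_line G \<and>
     (\<forall>w\<in>cball z r. \<forall>x\<in>space half_line. norm (exp (- (w * of_real x)) * g x) \<le> G x)"
  proof (intro exI conjI ballI)
    show "Re z / 2 > 0" using z by simp
    show "cball z (Re z / 2) \<subseteq> {w. Re w > 0}" using ge z by force
    show "integrable half_line (\<lambda>x. x ^ k * exp (- (Re z / 2 * x)))"
      by (rule half_line_power_exp) (use z in simp)
    fix w x assume w: "w \<in> cball z (Re z / 2)" and x: "x \<in> space half_line"
    have "exp (- (Re w * x)) * norm (g x) \<le> exp (- (Re z / 2 * x)) * x ^ k"
      using x mult_right_mono[OF ge[OF w], of x] le[of x] by (intro mult_mono) auto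
    then show "norm (exp (- (w * of_real x)) * g x) \<le> x ^ k * exp (- (Re z / 2 * x))"
      by (simp add: norm_mult mult.commute)
  qed
qed

text \<open>Identity theorem: \<open>c\<close> is itself a limit point of the ray through
  \<open>c\<close>. It reduces equalities between integrals with a complex parameter to one ray,
  where a real substitution is enough.\<close>

lemma eq_on_sector:
  fixes f g :: "complex \<Rightarrow> complex"
  assumes "f holomorphic_on S" "g holomorphic_on S" "open S" "convex S"
    and "c \<in> S" "\<And>r. r > 0 \<Longrightarrow> f (of_real r * c) = g (of_real r * c)" "c \<noteq> 0" "w \<in> S"
    and ray: "\<And>r. r > 0 \<Longrightarrow> of_real r * c \<in> S"
  shows "f w = g w"
proof -
  have "f w - g w = 0"
  proof (rule analytic_continuation[where f = "\<lambda>w. f w - g w" and w = w and U = "(\<lambda>r. of_real r * c) ` {0<..}" and \<xi> = c and S = S])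
    show "c islimpt (\<lambda>r. of_real r * c) ` {0<..}"
      unfolding islimpt_sequential
    proof (intro exI conjI allI)
      let ?r = "\<lambda>n. 1 + inverse (real (Suc n))"
      have "(\<lambda>n. of_real (?r n) * c) \<longlonglongrightarrow> of_real 1 * c"
        by (intro tendsto_mult tendsto_of_real tendsto_const LIMSEQ_inverse_real_of_nat_add)
      then show "(\<lambda>n. of_real (?r n) * c) \<longlonglongrightarrow> c" by simp
      fix n
      have r: "?r n \<in> {0<..}" "?r n \<noteq> 1" by (auto simp: add_pos_pos)
      then have "of_real (?r n) * c \<noteq> c"
        using assms(7) by (metis mult_cancel_right1 of_real_eq_1_iff)
      with r(1) show "of_real (?r n) * c \<in> (\<lambda>r. of_real r * c) ` {0<..} - {c}" by blast
    qed
  qed (use assms in \<open>auto intro!: holomorphic_intros convex_connected\<close>)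
  then show ?thesis by simp
qed

text \<open>Both sides are holomorphic in the right half-plane and agree for real \<open>w\<close>,
  where this is Euler's integral.\<close>

lemma half_line_power_exp_complex:
  assumes "Re w > 0"
  shows "integrable half_line (\<lambda>x. exp (- (w * of_real x)) * of_real x ^ k)"
    and "(\<integral>x. exp (- (w * of_real x)) * of_real x ^ k \<partial>half_line) = fact k / w ^ Suc k"
proof -
  have m: "(\<lambda>x. complex_of_real x ^ k) \<in> borel_measurable half_line"
    by (intro measurable_half_line borel_measurable_continuous_onI continuous_intros)
  show "integrable half_line (\<lambda>x. exp (- (w * of_real x)) * of_real x ^ k)"
    using assms by (intro half_line_Laplace_integrable[where k = k] m) (auto simp: norm_power)
  show "(\<integral>x. exp (- (w * of_real x)) * of_real x ^ k \<partial>half_line) = fact k / w ^ Suc k"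
  proof (rule eq_on_sector[where S = "{w. Re w > 0}" and c = 1 and w = w
      and f = "\<lambda>w. \<integral>x. exp (- (w * of_real x)) * of_real x ^ k \<partial>half_line" and g = "\<lambda>w. fact k / w ^ Suc k"])
    show "(\<lambda>w. \<integral>x. exp (- (w * of_real x)) * of_real x ^ k \<partial>half_line) holomorphic_on {w. Re w > 0}"
      by (rule half_line_Laplace_holomorphic[OF m]) (auto simp: norm_power)
    show "(\<lambda>w. fact k / w ^ Suc k) holomorphic_on {w. Re w > 0}"
      by (auto intro!: holomorphic_intros)
    fix r :: real assume r: "r > 0"
    have "(\<integral>x. exp (- (of_real r * 1 * of_real x)) * complex_of_real x ^ k \<partial>half_line) = 
      (\<integral>x. of_real (x ^ k * exp (- (r * x))) \<partial>half_line)"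
      by (intro Bochner_Integration.integral_cong) (simp_all add: mult.commute flip: exp_of_real)
    also have "\<dots> = of_real (fact k / r ^ Suc k)"
      using half_line_power_exp(2)[OF r, of k] by (simp only: integral_complex_of_real)
    finally show "(\<integral>x. exp (- (of_real r * 1 * of_real x)) * complex_of_real x ^ k \<partial>half_line) = fact k / (of_real r * 1) ^ Suc k"
      by simp
  qed (use assms in \<open>auto simp: open_halfspace_Re_gt convex_halfspace_Re_gt\<close>)
qed

section \<open>The terminant on the positive axis and on turned rays\<close>

definition terminant :: "nat \<Rightarrow> complex \<Rightarrow> complex" where
  "terminant k w = (\<integral>x. exp (- (w * of_real x)) * (of_real x ^ k / (1 + of_real x ^ 2)) \<partial>half_line)"

text \<open>The integral of \<^term>\<open>terminant k w\<close> along the ray through \<open>c / w\<close> instead of the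
  positive axis.\<close>

definition rot_terminant :: "nat \<Rightarrow> complex \<Rightarrow> complex \<Rightarrow> complex" where
  "rot_terminant k c w =
     (c / w) ^ Suc k * (\<integral>y. exp (- (c * of_real y)) * (of_real y ^ k / (1 + (c * of_real y / w) ^ 2)) \<partial>half_line)"

lemma terminant_holomorphic: "terminant k holomorphic_on {w. Re w > 0}"
proof -
  have nz: "1 + (complex_of_real x)\<^sup>2 \<noteq> 0" for x
    by (smt (verit) of_real_1 of_real_add of_real_eq_0_iff of_real_power zero_le_power2)
  show ?thesis
    unfolding terminant_def [abs_def]
  proof (rule half_line_Laplace_holomorphic[where k = k])
    show "(\<lambda>x. complex_of_real x ^ k / (1 + of_real x ^ 2)) \<in> borel_measurable half_line"
      using nz by (intro measurable_half_line borel_measurable_continuous_onI continuous_intros) auto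
    fix x :: real assume x: "x \<ge> 0"
    have "norm (1 + (complex_of_real x)\<^sup>2) = 1 + x\<^sup>2"
      by (smt (verit) norm_of_real of_real_1 of_real_add of_real_power zero_le_power2)
    with x show "norm (complex_of_real x ^ k / (1 + (complex_of_real x)\<^sup>2)) \<le> x ^ k"
      by (simp add: norm_divide norm_power divide_le_eq mult_le_cancel_left1 add_nonneg_eq_0_iff add_pos_nonneg)
  qed
qed

text \<open>The points \<open>\<plusminus>\<i>\<close> have distance \<open>\<bar>Re p\<bar> / \<bar>p\<bar>\<close> from the line through \<open>0\<close> and \<open>p\<close>.\<close>

lemma norm_one_plus_square_ge:
  fixes p :: complex and y :: real
  assumes "p \<noteq> 0"
  shows "(Re p / norm p)\<^sup>2 \<le> norm (1 + (p * of_real y)\<^sup>2)"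
proof -
  have *: "\<bar>Re p\<bar> / norm p \<le> norm (p * of_real y + \<i> * of_real s)" if "s\<^sup>2 = 1" for s :: real
  proof (rule power2_le_imp_le)
    have n: "(norm p)\<^sup>2 = (Re p)\<^sup>2 + (Im p)\<^sup>2" by (rule cmod_power2)
    \<comment> \<open>This square is exactly the difference of the two sides of the next
      inequality.\<close>
    have "0 \<le> ((norm p)\<^sup>2 * y + Im p * s)\<^sup>2" by simp
    then have "(Re p)\<^sup>2 * s\<^sup>2 \<le> (norm p)\<^sup>2 * ((Re p * y)\<^sup>2 + (Im p * y + s)\<^sup>2)"
      unfolding n by (simp add: power2_eq_square algebra_simps)
    then show "(\<bar>Re p\<bar> / norm p)\<^sup>2 \<le> (norm (p * of_real y + \<i> * of_real s))\<^sup>2"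
      using assms that by (simp add: cmod_power2[of "p * _ + _"] power_divide pos_divide_le_eq mult.commute)
  qed simp
  have "(Re p / norm p)\<^sup>2 = (\<bar>Re p\<bar> / norm p) * (\<bar>Re p\<bar> / norm p)"
    by (simp add: power2_eq_square)
  also have "\<dots> \<le> norm (p * of_real y + \<i> * of_real 1) * norm (p * of_real y + \<i> * of_real (-1))"
    by (intro mult_mono *) auto
  also have "\<dots> = norm (1 + (p * of_real y)\<^sup>2)"
    unfolding norm_mult[symmetric] by (rule arg_cong[where f = norm]) (simp add: power2_eq_square algebra_simps)
  finally show ?thesis .
qed

lemma rot_terminant_integrand_measurable:
  assumes "Re (c / w) > 0"
  shows "(\<lambda>y. exp (- (c * of_real y)) * (of_real y ^ k / (1 + (c * of_real y / w) ^ 2))) \<in> borel_measurable half_line"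
proof -
  have "1 + (c * of_real y / w) ^ 2 \<noteq> 0" for y
    using norm_one_plus_square_ge[of "c / w" y] assms by (cases "w = 0") (force simp: zero_less_power2)+
  moreover have "w \<noteq> 0" using assms by auto
  ultimately show ?thesis
    by (intro measurable_half_line borel_measurable_continuous_onI continuous_intros) auto
qed

lemma rot_terminant_integrand_le:
  assumes "m > 0" "m \<le> norm (1 + (c * of_real y / w) ^ 2)" "y \<ge> 0"
  shows "norm (exp (- (c * of_real y)) * (of_real y ^ k / (1 + (c * of_real y / w) ^ 2))) \<le> y ^ k * exp (- (Re c * y)) / m"
proof -
  have "norm (exp (- (c * of_real y)) * (of_real y ^ k / (1 + (c * of_real y / w) ^ 2)))
      = y ^ k * exp (- (Re c * y)) / norm (1 + (c * of_real y / w) ^ 2)"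
    using assms(3) by (simp add: norm_mult norm_divide norm_power)
  also have "\<dots> \<le> y ^ k * exp (- (Re c * y)) / m"
    using assms by (intro divide_left_mono mult_pos_pos) auto
  finally show ?thesis .
qed

text \<open>Compared with \<open>k! / norm w ^ Suc k\<close>, the loss is the factor
  \<open>(norm c / Re c) ^ Suc k / m\<close>. Turning the ray makes \<open>Re c\<close> smaller but
  can move the ray away from the poles and so enlarge \<open>m\<close>; the bounds of the theorem
  come from balancing the two.\<close>

lemma norm_rot_terminant_le:
  assumes "Re c > 0" "m > 0" "\<And>y. y \<ge> 0 \<Longrightarrow> m \<le> norm (1 + (c * of_real y / w) ^ 2)" "Re (c / w) > 0"
  shows "norm (rot_terminant k c w) \<le> (norm c / norm w) ^ Suc k * (fact k / (m * Re c ^ Suc k))"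
proof -
  note I = half_line_power_exp[OF assms(1), of k]
  have "norm (\<integral>y. exp (- (c * of_real y)) * (of_real y ^ k / (1 + (c * of_real y / w) ^ 2)) \<partial>half_line)
     \<le> (\<integral>y. y ^ k * exp (- (Re c * y)) / m \<partial>half_line)"
  proof (rule Bochner_Integration.integral_norm_bound_integral)
    show "integrable half_line (\<lambda>y. y ^ k * exp (- (Re c * y)) / m)"
      using I by simp
    show "integrable half_line (\<lambda>y. exp (- (c * of_real y)) * (of_real y ^ k / (1 + (c * of_real y / w) ^ 2)))"
    proof (rule Bochner_Integration.integrable_bound[OF _ rot_terminant_integrand_measurable[OF assms(4)] AE_I2])
      show "integrable half_line (\<lambda>y. y ^ k * exp (- (Re c * y)) / m)"
        using I by simp
          show "norm (exp (- (c * of_real y)) * (of_real y ^ k / (1 + (c * of_real y / w) ^ 2)))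
           \<le> norm (y ^ k * exp (- (Re c * y)) / m)" if "y \<in> space half_line" for y
        unfolding real_norm_def
        by (rule order_trans[OF rot_terminant_integrand_le abs_ge_self]) (use assms that in auto)
    qed
  qed (use assms rot_terminant_integrand_le in auto)
  also have "\<dots> = fact k / (m * Re c ^ Suc k)" using I by simp
  finally show ?thesis
    unfolding rot_terminant_def norm_mult norm_power norm_divide by (intro mult_left_mono) auto
qed

lemma open_sector: "open {w. 0 < Re (c / w)}"
proof -
  have "continuous_on {w. w \<noteq> 0} (\<lambda>w. Re (c / w))" by (auto intro!: continuous_intros)
  moreover have "open {w::complex. w \<noteq> 0}" by (simp add: open_Collect_neq continuous_on_id continuous_on_const)
  ultimately have "open ((\<lambda>w. Re (c / w)) -` {0<..} \<inter> {w. w \<noteq> 0})"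
    by (meson continuous_on_open_vimage open_greaterThan)
  \<comment> \<open>Since \<open>c / 0 = 0\<close>, the origin is never in the sector.\<close>
  also have "(\<lambda>w. Re (c / w)) -` {0<..} \<inter> {w. w \<noteq> 0} = {w. 0 < Re (c / w)}" by auto
  finally show ?thesis .
qed

text \<open>Near a given point the denominators stay away from 0 uniformly: the squared distance of
  \<open>norm_one_plus_square_ge\<close> depends continuously on \<open>w\<close> and attains a
  positive minimum on a closed disc.\<close>

lemma rot_terminant_holomorphic:
  assumes c: "Re c > 0"
  shows "rot_terminant k c holomorphic_on {w. Re (c / w) > 0}"
proof -
  let ?S = "{w. Re (c / w) > 0}"
  have nz: "w \<noteq> 0" if "w \<in> ?S" for w using that by auto
  have nz1: "1 + (c * of_real y / w) ^ 2 \<noteq> 0" if "w \<in> ?S" for w y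
    using norm_one_plus_square_ge[of "c / w" y] that by (cases "c / w = 0") (auto simp: divide_le_0_iff)
  have "(\<lambda>w. \<integral>y. exp (- (c * of_real y)) * (of_real y ^ k / (1 + (c * of_real y / w) ^ 2)) \<partial>half_line) holomorphic_on ?S"
  proof (rule parametric_integral_holomorphic)
    show "(\<lambda>w. exp (- (c * of_real y)) * (of_real y ^ k / (1 + (c * of_real y / w) ^ 2))) holomorphic_on ?S" for y
      using nz nz1 by (intro holomorphic_intros) auto
    show "(\<lambda>y. exp (- (c * of_real y)) * (of_real y ^ k / (1 + (c * of_real y / w) ^ 2))) \<in> borel_measurable half_line"
      if "w \<in> ?S" for w
      using that by (intro rot_terminant_integrand_measurable) auto
    fix z assume z: "z \<in> ?S"
    obtain r where r: "r > 0" "cball z r \<subseteq> ?S"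
      using open_sector[of c, unfolded open_contains_cball, THEN bspec, OF z] by blast
    have "\<exists>x\<in>cball z r. \<forall>y\<in>cball z r. (Re (c / x) / norm (c / x))\<^sup>2 \<le> (Re (c / y) / norm (c / y))\<^sup>2"
    proof (rule continuous_attains_inf)
      have "c \<noteq> 0" "x \<noteq> 0" if "x \<in> cball z r" for x
        using nz[OF subsetD[OF r(2) that]] c by auto
      then show "continuous_on (cball z r) (\<lambda>x. (Re (c / x) / norm (c / x))\<^sup>2)"
        by (intro continuous_intros) (auto simp del: mem_cball)
      show "cball z r \<noteq> {}" "compact (cball z r)" using r(1) by simp_all
    qed
    then obtain x where x: "x \<in> cball z r" "\<And>y. y \<in> cball z r \<Longrightarrow> (Re (c / x) / norm (c / x))\<^sup>2 \<le> (Re (c / y) / norm (c / y))\<^sup>2"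
      by blast
    define m where "m = (Re (c / x) / norm (c / x))\<^sup>2"
    have "Re (c / x) > 0" using subsetD[OF r(2) x(1)] by simp
    then have m: "m > 0" unfolding m_def by (intro zero_less_power divide_pos_pos) auto
    show "\<exists>r>0. \<exists>g. cball z r \<subseteq> ?S \<and> integrable half_line g \<and>
       (\<forall>w\<in>cball z r. \<forall>y\<in>space half_line. norm (exp (- (c * of_real y)) * (of_real y ^ k / (1 + (c * of_real y / w) ^ 2))) \<le> g y)"
    proof (intro exI conjI ballI)
      show "integrable half_line (\<lambda>y. y ^ k * exp (- (Re c * y)) / m)"
        using half_line_power_exp[OF c] by simp
      fix w y assume w: "w \<in> cball z r" and y: "y \<in> space half_line"
      have "c / w \<noteq> 0" using subsetD[OF r(2) w] by auto
      from norm_one_plus_square_ge[OF this, of y] x(2)[OF w]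
      have "m \<le> norm (1 + (c * of_real y / w) ^ 2)" by (simp add: m_def)
      then show "norm (exp (- (c * of_real y)) * (of_real y ^ k / (1 + (c * of_real y / w) ^ 2))) \<le> y ^ k * exp (- (Re c * y)) / m"
        using y m by (intro rot_terminant_integrand_le) auto
    qed (rule r)+
  qed
  then show ?thesis
    unfolding rot_terminant_def [abs_def]
    by (intro holomorphic_on_mult holomorphic_on_power holomorphic_on_divide holomorphic_on_const holomorphic_on_ident nz)
qed

text \<open>On the ray through \<open>c\<close> the two sides differ by a real scaling of the variable; the rest is the
  identity theorem.\<close>

lemma rot_terminant_eq:
  assumes c: "norm c = 1" "Re c > 0" and w: "Re w > 0" "Re (c / w) > 0"
  shows "rot_terminant k c w = terminant k w"
proof -
  \<comment> \<open>Written this way the sector is a half-plane, so its intersection with the right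
    half-plane is convex, as the identity theorem requires.\<close>
  have eq: "Re (c / w) > 0 \<longleftrightarrow> Re (w * cnj c) > 0" for w
  proof (cases "w = 0")
    case False
    have "Re (c / w) = Re (w * cnj c) / (norm w)\<^sup>2" by (simp add: Re_divide cmod_power2 mult.commute)
    then show ?thesis using False by (simp add: zero_less_divide_iff)
  qed auto
  have "open {w. Re (w * cnj c) > 0}"
    by (intro open_Collect_less continuous_intros)
  moreover have "convex {w. Re (w * cnj c) > 0}"
    using convex_halfspace_gt[of 0 c] by (simp add: inner_complex_def mult.commute)
  ultimately have S: "open ({w. Re w > 0} \<inter> {w. Re (c / w) > 0})" "convex ({w. Re w > 0} \<inter> {w. Re (c / w) > 0})"
    unfolding eq by (auto intro!: open_Int convex_Int simp: open_halfspace_Re_gt convex_halfspace_Re_gt)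
  show ?thesis
  proof (rule eq_on_sector[OF _ _ S, where f = "rot_terminant k c" and g = "terminant k" and c = c and w = w])
    show "rot_terminant k c holomorphic_on {w. Re w > 0} \<inter> {w. Re (c / w) > 0}"
      by (rule holomorphic_on_subset[OF rot_terminant_holomorphic[OF c(2)]]) auto
    show "terminant k holomorphic_on {w. Re w > 0} \<inter> {w. Re (c / w) > 0}"
      by (rule holomorphic_on_subset[OF terminant_holomorphic]) auto
    fix r :: real assume r: "r > 0"
    have c0: "c \<noteq> 0" using c by auto
    have "rot_terminant k c (of_real r * c) = 
       (1 / r) ^ Suc k * (\<integral>y. exp (- (c * of_real y)) * (of_real y ^ k / (1 + (of_real y / of_real r) ^ 2)) \<partial>half_line)"
      using c0 by (simp add: rot_terminant_def)
    also have "\<dots> = (1 / r) ^ Suc k * (r * (\<integral>x. exp (- (c * of_real (r * x))) * (of_real (r * x) ^ k / (1 + (of_real (r * x) / of_real r) ^ 2)) \<partial>half_line))"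
      by (subst half_line_integral_scale[OF r]) (simp add: scaleR_conv_of_real)
    also have "\<dots> = (\<integral>x. ((1 / r) ^ Suc k * r) * (exp (- (c * of_real (r * x))) * (of_real (r * x) ^ k / (1 + (of_real (r * x) / of_real r) ^ 2))) \<partial>half_line)"
      by (simp only: integral_mult_right_zero mult.assoc of_real_mult)
    also have "\<dots> = terminant k (of_real r * c)"
      unfolding terminant_def using r
      by (intro Bochner_Integration.integral_cong) (auto simp: power_mult_distrib field_simps)
    finally show "rot_terminant k c (of_real r * c) = terminant k (of_real r * c)" .
  qed (use assms in auto)
qed

section \<open>Contours around a curve given as a graph\<close>

text \<open>Compactness of the segment gives the room. The neighbourhood is a box because convexity
  then provides a primitive on it.\<close>

lemma thin_box_subset:
  assumes S: "open S" and ab: "a \<le> b" and seg: "\<And>y. a \<le> y \<Longrightarrow> y \<le> b \<Longrightarrow> Complex x0 y \<in> S"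
  obtains e where "e > 0" "box (Complex (x0 - e) (a - e)) (Complex (x0 + e) (b + e)) \<subseteq> S"
proof -
  have "compact (cbox (Complex x0 a) (Complex x0 b))" by (rule compact_cbox)
  moreover have "cbox (Complex x0 a) (Complex x0 b) \<subseteq> S"
  proof
    fix z assume "z \<in> cbox (Complex x0 a) (Complex x0 b)"
    then have "Re z = x0" "a \<le> Im z" "Im z \<le> b" by (auto simp: in_cbox_complex_iff)
    then show "z \<in> S" using seg[of "Im z"] by (metis complex.collapse)
  qed
  ultimately obtain d where d: "d > 0" "(\<Union>z\<in>cbox (Complex x0 a) (Complex x0 b). ball z d) \<subseteq> S"
    using S compact_subset_open_imp_ball_epsilon_subset by blast
  have "box (Complex (x0 - d/2) (a - d/2)) (Complex (x0 + d/2) (b + d/2)) \<subseteq> S"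
  proof
    fix z assume z: "z \<in> box (Complex (x0 - d/2) (a - d/2)) (Complex (x0 + d/2) (b + d/2))"
    \<comment> \<open>The imaginary part of the point of the segment nearest to
      \<open>z\<close>.\<close>
    define y where "y = max a (min b (Im z))"
    have y: "a \<le> y" "y \<le> b" "\<bar>y - Im z\<bar> < d/2"
      using ab z d(1) by (auto simp: y_def in_box_complex_iff max_def min_def)
    have "dist (Complex x0 y) z \<le> \<bar>x0 - Re z\<bar> + \<bar>y - Im z\<bar>"
      using cmod_le[of "Complex x0 y - z"] by (simp add: dist_norm)
    also have "\<dots> < d" using y z by (auto simp: in_box_complex_iff abs_if)
    finally have "z \<in> ball (Complex x0 y) d" by simp
    moreover have "Complex x0 y \<in> cbox (Complex x0 a) (Complex x0 b)"
      using y by (auto simp: in_cbox_complex_iff)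
    ultimately show "z \<in> S" using d(2) by blast
  qed
  then show ?thesis using that[of "d/2"] d(1) by simp
qed

lemma integral_vertical_primitive:
  assumes "a \<le> b" "\<And>y. a \<le> y \<Longrightarrow> y \<le> b \<Longrightarrow> (H has_field_derivative G (Complex x y)) (at (Complex x y))"
  shows "\<i> * integral {a..b} (\<lambda>y. G (Complex x y)) = H (Complex x b) - H (Complex x a)"
proof -
  have "((\<lambda>y. \<i> * G (Complex x y)) has_integral (H (Complex x b) - H (Complex x a))) {a..b}"
  proof (rule fundamental_theorem_of_calculus[OF assms(1)])
    fix y assume y: "y \<in> {a..b}"
    have "((\<lambda>y. Complex x y) has_vector_derivative \<i>) (at y within {a..b})"
      unfolding Complex_eq by (auto intro!: derivative_eq_intros simp: scaleR_conv_of_real)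
    from field_vector_diff_chain_within[OF this has_field_derivative_at_within[OF assms(2)]] y
    show "((\<lambda>y. H (Complex x y)) has_vector_derivative \<i> * G (Complex x y)) (at y within {a..b})"
      by (auto simp: o_def)
  qed
  then have "integral {a..b} (\<lambda>y. \<i> * G (Complex x y)) = H (Complex x b) - H (Complex x a)"
    by (rule integral_unique)
  then show ?thesis by simp
qed

text \<open>A primitive of \<open>G\<close> on a thin box around each vertical segment of the region replaces a primitive
  on the whole region.\<close>

lemma Cauchy_under_graph:
  fixes G :: "complex \<Rightarrow> complex" and Y Y' :: "real \<Rightarrow> real"
  assumes G: "G holomorphic_on S" and S: "open S" and X: "0 \<le> X"
    and contY: "continuous_on {0..X} Y"
    and derY: "\<And>x. 0 < x \<Longrightarrow> x < X \<Longrightarrow> (Y has_real_derivative Y' x) (at x)"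
    and eta: "\<And>x. 0 \<le> x \<Longrightarrow> x \<le> X \<Longrightarrow> \<eta> \<le> Y x"
    and region: "\<And>x y. 0 \<le> x \<Longrightarrow> x \<le> X \<Longrightarrow> \<eta> \<le> y \<Longrightarrow> y \<le> Y x \<Longrightarrow> Complex x y \<in> S"
  defines "P \<equiv> \<lambda>x. \<i> * integral {\<eta>..Y x} (\<lambda>y. G (Complex x y))"
  shows "((\<lambda>x. G (Complex x (Y x)) * (1 + \<i> * of_real (Y' x)) - G (Complex x \<eta>)) has_integral (P X - P 0)) {0..X}"
proof -
  have loc: "\<exists>e>0. \<exists>H. (\<forall>x\<in>{0..X}. \<bar>x - x0\<bar> < e \<longrightarrow> P x = H (Complex x (Y x)) - H (Complex x \<eta>) \<and>
       (H has_field_derivative G (Complex x (Y x))) (at (Complex x (Y x))) \<and>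
       (H has_field_derivative G (Complex x \<eta>)) (at (Complex x \<eta>)))"
    if x0: "x0 \<in> {0..X}" for x0
  proof -
    obtain e where e: "e > 0" "box (Complex (x0 - e) (\<eta> - e)) (Complex (x0 + e) (Y x0 + e)) \<subseteq> S"
      using thin_box_subset[OF S, of \<eta> "Y x0" x0] eta region x0 by (metis atLeastAtMost_iff)
    let ?B = "box (Complex (x0 - e) (\<eta> - e)) (Complex (x0 + e) (Y x0 + e))"
    obtain H where H: "\<And>z. z \<in> ?B \<Longrightarrow> (H has_field_derivative G z) (at z within ?B)"
      using holomorphic_convex_primitive'[OF convex_box(2) open_box holomorphic_on_subset[OF G e(2)]] by metis
    have H: "(H has_field_derivative G z) (at z)" if "z \<in> ?B" for z
      using H[OF that] at_within_open[OF that open_box] by simp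
    obtain d where d: "d > 0" "\<And>x. x \<in> {0..X} \<Longrightarrow> dist x x0 < d \<Longrightarrow> dist (Y x) (Y x0) < e"
      using contY x0 e(1) unfolding continuous_on_iff by metis
    show ?thesis
    proof (intro exI[of _ "min e d"] conjI exI[of _ H] ballI impI)
      show "min e d > 0" using e d by simp
      fix x assume x: "x \<in> {0..X}" "\<bar>x - x0\<bar> < min e d"
      have Yx: "\<bar>Y x - Y x0\<bar> < e" using d(2)[of x] x by (simp add: dist_real_def)
      have inB: "Complex x y \<in> ?B" if "\<eta> \<le> y" "y \<le> Y x" for y
        using that x Yx e(1) by (auto simp: in_box_complex_iff)
      have \<eta>: "\<eta> \<le> Y x" using eta x by simp
      show "P x = H (Complex x (Y x)) - H (Complex x \<eta>)"
        unfolding P_def by (rule integral_vertical_primitive[OF \<eta> H[OF inB]])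
      show "(H has_field_derivative G (Complex x (Y x))) (at (Complex x (Y x)))"
        "(H has_field_derivative G (Complex x \<eta>)) (at (Complex x \<eta>))"
        using inB \<eta> by (auto intro!: H)
    qed
  qed
  show ?thesis
  \<comment> \<open>At the two ends only continuity is available, since \<open>Y\<close> is
    differentiable only at interior points.\<close>
  proof (rule fundamental_theorem_of_calculus_interior[OF X])
    show "continuous_on {0..X} P"
      unfolding continuous_on_eq_continuous_within
    proof
      fix x0 assume x0: "x0 \<in> {0..X}"
      obtain e H where e: "e > 0" and H: "\<And>x. x \<in> {0..X} \<Longrightarrow> \<bar>x - x0\<bar> < e \<Longrightarrow> P x = H (Complex x (Y x)) - H (Complex x \<eta>)"
        "\<And>x. x \<in> {0..X} \<Longrightarrow> \<bar>x - x0\<bar> < e \<Longrightarrow> (H has_field_derivative G (Complex x (Y x))) (at (Complex x (Y x)))"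
        "\<And>x. x \<in> {0..X} \<Longrightarrow> \<bar>x - x0\<bar> < e \<Longrightarrow> (H has_field_derivative G (Complex x \<eta>)) (at (Complex x \<eta>))"
        using loc[OF x0] by metis
      have cY: "continuous (at x0 within {0..X}) Y" using contY x0 by (simp add: continuous_on_eq_continuous_within)
      have "continuous (at x0 within {0..X}) (\<lambda>x. H (Complex x (Y x)))"
      proof (rule continuous_within_compose3[where g = H])
        show "isCont H (Complex x0 (Y x0))" using H(2)[OF x0] e by (auto intro: DERIV_isCont)
        show "continuous (at x0 within {0..X}) (\<lambda>x. Complex x (Y x))"
          unfolding Complex_eq using cY by (intro continuous_intros)
      qed
      moreover have "continuous (at x0 within {0..X}) (\<lambda>x. H (Complex x \<eta>))"
      proof (rule continuous_within_compose3[where g = H])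
        show "isCont H (Complex x0 \<eta>)" using H(3)[OF x0] e by (auto intro: DERIV_isCont)
        show "continuous (at x0 within {0..X}) (\<lambda>x. Complex x \<eta>)"
          unfolding Complex_eq by (intro continuous_intros)
      qed
      ultimately have "continuous (at x0 within {0..X}) (\<lambda>x. H (Complex x (Y x)) - H (Complex x \<eta>))"
        by (rule continuous_diff)
      then show "continuous (at x0 within {0..X}) P"
        by (rule continuous_transform_within[OF _ e x0]) (use H(1) in \<open>auto simp: dist_real_def\<close>)
    qed
    fix x0 assume x0: "x0 \<in> {0<..<X}"
    then have x0': "x0 \<in> {0..X}" by auto
    obtain e H where e: "e > 0" and H: "\<And>x. x \<in> {0..X} \<Longrightarrow> \<bar>x - x0\<bar> < e \<Longrightarrow> P x = H (Complex x (Y x)) - H (Complex x \<eta>)"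
        "\<And>x. x \<in> {0..X} \<Longrightarrow> \<bar>x - x0\<bar> < e \<Longrightarrow> (H has_field_derivative G (Complex x (Y x))) (at (Complex x (Y x)))"
        "\<And>x. x \<in> {0..X} \<Longrightarrow> \<bar>x - x0\<bar> < e \<Longrightarrow> (H has_field_derivative G (Complex x \<eta>)) (at (Complex x \<eta>))"
      using loc[OF x0'] by metis
    have "((\<lambda>x. Complex x (Y x)) has_vector_derivative 1 + \<i> * of_real (Y' x0)) (at x0)"
      unfolding Complex_eq using derY[of x0] x0
      by (auto intro!: derivative_eq_intros has_vector_derivative_of_real simp: has_real_derivative_iff_has_vector_derivative scaleR_conv_of_real)
    from field_vector_diff_chain_at[OF this H(2)[OF x0']] e
    have 1: "((\<lambda>x. H (Complex x (Y x))) has_vector_derivative (1 + \<i> * of_real (Y' x0)) * G (Complex x0 (Y x0))) (at x0)"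
      by (auto simp: o_def)
    have "((\<lambda>x. Complex x \<eta>) has_vector_derivative 1) (at x0)"
      unfolding Complex_eq by (auto intro!: derivative_eq_intros simp: scaleR_conv_of_real)
    from field_vector_diff_chain_at[OF this H(3)[OF x0']] e
    have 2: "((\<lambda>x. H (Complex x \<eta>)) has_vector_derivative 1 * G (Complex x0 \<eta>)) (at x0)"
      by (auto simp: o_def)
    have "((\<lambda>x. H (Complex x (Y x)) - H (Complex x \<eta>)) has_vector_derivative
        (1 + \<i> * of_real (Y' x0)) * G (Complex x0 (Y x0)) - 1 * G (Complex x0 \<eta>)) (at x0)"
      by (intro derivative_intros 1 2)
    then have "(P has_vector_derivative (1 + \<i> * of_real (Y' x0)) * G (Complex x0 (Y x0)) - 1 * G (Complex x0 \<eta>)) (at x0)"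
    proof (rule has_vector_derivative_transform_within_open[where S = "{0<..<X} \<inter> ball x0 e"])
      fix y assume "y \<in> {0<..<X} \<inter> ball x0 e"
      then have "y \<in> {0..X}" "\<bar>y - x0\<bar> < e" by (auto simp: dist_real_def)
      then show "H (Complex y (Y y)) - H (Complex y \<eta>) = P y" using H(1) by simp
    qed (use x0 e in auto)
    then show "(P has_vector_derivative G (Complex x0 (Y x0)) * (1 + \<i> * of_real (Y' x0)) - G (Complex x0 \<eta>)) (at x0)"
      by (simp add: mult.commute)
  qed
qed

section \<open>Rectangles and symmetric integrands\<close>

lemma contour_integral_linepath_same_Im:
  assumes "a < b"
  shows "contour_integral (linepath (Complex a c) (Complex b c)) f = integral {a..b} (\<lambda>x. f (Complex x c))"
proof -
  have "contour_integral (linepath (Complex a c) (Complex b c)) f =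
      contour_integral (linepath (of_real a) (of_real b)) (\<lambda>z. f (z + \<i> * of_real c))"
    by (simp add: contour_integral_integral linepath_def Complex_eq scaleR_conv_of_real algebra_simps)
  also have "\<dots> = integral {a..b} (\<lambda>x. f (Complex x c))"
    using assms by (subst contour_integral_linepath_Reals_eq) (auto simp: Complex_eq)
  finally show ?thesis .
qed

lemma contour_integral_rectpath_eq:
  assumes X: "a < b" and eta: "c < d"
    and cont: "continuous_on (path_image (rectpath (Complex a c) (Complex b d))) G"
  shows "contour_integral (rectpath (Complex a c) (Complex b d)) G =
     integral {a..b} (\<lambda>x. G (Complex x c)) + \<i> * integral {c..d} (\<lambda>y. G (Complex b y))
     - integral {a..b} (\<lambda>x. G (Complex x d)) - \<i> * integral {c..d} (\<lambda>y. G (Complex a y))"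
proof -
  have cont': "continuous_on (closed_segment (Complex a c) (Complex b c)) G"
    "continuous_on (closed_segment (Complex b c) (Complex b d)) G"
    "continuous_on (closed_segment (Complex b d) (Complex a d)) G"
    "continuous_on (closed_segment (Complex a d) (Complex a c)) G"
    by (rule continuous_on_subset[OF cont]; force simp: rectpath_def Let_def path_image_join)+
  note int = contour_integrable_continuous_linepath[OF cont'(1)] contour_integrable_continuous_linepath[OF cont'(2)]
    contour_integrable_continuous_linepath[OF cont'(3)] contour_integrable_continuous_linepath[OF cont'(4)]
  have "contour_integral (rectpath (Complex a c) (Complex b d)) G =
    contour_integral (linepath (Complex a c) (Complex b c)) G + contour_integral (linepath (Complex b c) (Complex b d)) G
    + contour_integral (linepath (Complex b d) (Complex a d)) G + contour_integral (linepath (Complex a d) (Complex a c)) G"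
    unfolding rectpath_def Let_def using int by (simp add: contour_integrable_joinI)
  also have "contour_integral (linepath (Complex b d) (Complex a d)) G = - contour_integral (linepath (Complex a d) (Complex b d)) G"
    by (rule contour_integral_reverse_linepath[OF cont'(3)])
  also have "contour_integral (linepath (Complex a d) (Complex a c)) G = - contour_integral (linepath (Complex a c) (Complex a d)) G"
    by (rule contour_integral_reverse_linepath[OF cont'(4)])
  finally show ?thesis
    using X eta by (simp add: contour_integral_linepath_same_Im contour_integral_linepath_same_Re)
qed

lemma has_integral_symmetric_interval:
  fixes f :: "real \<Rightarrow> 'a::euclidean_space"
  assumes "0 \<le> c" "continuous_on {-c..c} f" "((\<lambda>x. f x + f (- x)) has_integral I) {0..c}"
  shows "integral {-c..c} f = I"
proof -
  have i: "f integrable_on {-c..c}" by (intro integrable_continuous_interval assms)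
  have "integral {-c..c} f = integral {-c..0} f + integral {0..c} f"
    using assms(1) by (intro Henstock_Kurzweil_Integration.integral_combine[symmetric] i) auto
  also have "integral {-c..0} f = integral {0..c} (\<lambda>x. f (- x))"
    using Henstock_Kurzweil_Integration.integral_reflect_real[where a = 0 and b = c and f = "\<lambda>x. f (- x)"] by simp
  also have "\<dots> + integral {0..c} f = integral {0..c} (\<lambda>x. f (- x) + f x)"
  proof (rule integral_add[symmetric])
    show "f integrable_on {0..c}"
      using assms(1) by (intro integrable_on_subinterval[OF i]) auto
    have "f integrable_on {-c..-0}"
      using assms(1) by (intro integrable_on_subinterval[OF i]) auto
    then show "(\<lambda>x. f (- x)) integrable_on {0..c}"
      using Henstock_Kurzweil_Integration.integrable_reflect_real[where a = 0 and b = c and f = "\<lambda>x. f (- x)"] by simp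
  qed
  also have "\<dots> = I" using assms(3) by (simp add: integral_unique add.commute)
  finally show ?thesis .
qed

text \<open>For odd \<open>G\<close> that commutes with conjugation, the four sides of the rectangle reduce to the part of the
  boundary in the first quadrant.\<close>

lemma odd_symmetric_contour:
  fixes G :: "complex \<Rightarrow> complex" and Y Y' g :: "real \<Rightarrow> real"
  assumes odd: "\<And>z. G (- z) = - G z" and cnj: "\<And>z. G (cnj z) = cnj (G z)"
    and strip: "G holomorphic_on {z. \<bar>Im z\<bar> < b} - pts" and pts: "finite pts"
    and ptsX: "\<And>p. p \<in> pts \<Longrightarrow> Im p = 0 \<and> \<bar>Re p\<bar> < X"
    and res: "(\<Sum>p\<in>pts. residue G p) = of_real \<rho>"
    and G: "G holomorphic_on S" and S: "open S" and X: "0 < X"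
    and contY: "continuous_on {0..X} Y"
    and derY: "\<And>x. 0 < x \<Longrightarrow> x < X \<Longrightarrow> (Y has_real_derivative Y' x) (at x)"
    and b: "0 < b" "\<And>x. 0 \<le> x \<Longrightarrow> x \<le> X \<Longrightarrow> b \<le> Y x"
    and region: "\<And>x y. 0 \<le> x \<Longrightarrow> x \<le> X \<Longrightarrow> 0 < y \<Longrightarrow> y \<le> Y x \<Longrightarrow> Complex x y \<in> S"
    and curve: "\<And>x. 0 < x \<Longrightarrow> x \<le> X \<Longrightarrow> G (Complex x (Y x)) = - \<i> * of_real (g x)"
  shows "(g has_integral (pi / 2 * \<rho> - Re (integral {0..Y X} (\<lambda>y. G (Complex X y))))) {0..X}"
proof -
  \<comment> \<open>A height strictly between 0 and \<open>b\<close>: the rectangle stays in the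
    strip where only the points of \<open>pts\<close> are singular, and its upper side stays below
    the graph of \<open>Y\<close>.\<close>
  define \<eta> where "\<eta> = b / 2"
  have \<eta>: "0 < \<eta>" "\<eta> < b" using b by (auto simp: \<eta>_def)
  let ?R = "rectpath (Complex (-X) (-\<eta>)) (Complex X \<eta>)"
  have img: "path_image ?R \<subseteq> {z. \<bar>Im z\<bar> < b} - pts"
  proof
    fix z assume "z \<in> path_image ?R"
    with X \<eta> show "z \<in> {z. \<bar>Im z\<bar> < b} - pts"
      using ptsX[of z] by (auto simp: path_image_rectpath)
  qed
  have contG: "continuous_on ({z. \<bar>Im z\<bar> < b} - pts) G"
    using strip by (rule holomorphic_on_imp_continuous_on)
  have op: "open {z. \<bar>Im z\<bar> < b}" by (intro open_Collect_less continuous_intros)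
  have strip_eq: "{z. \<bar>Im z\<bar> < b} = {z. Im z < b} \<inter> {z. Im z > - b}" by (auto simp: abs_less_iff)
  have conv: "convex {z. \<bar>Im z\<bar> < b}" unfolding strip_eq
    by (intro convex_Int convex_halfspace_Im_lt convex_halfspace_Im_gt)
  have "contour_integral ?R G = 2 * pi * \<i> * (\<Sum>p\<in>pts. winding_number ?R p * residue G p)"
  proof (rule Residue_theorem[OF op convex_connected[OF conv] pts strip _ _ img])
    show "\<forall>z. z \<notin> {z. \<bar>Im z\<bar> < b} \<longrightarrow> winding_number ?R z = 0"
      using X \<eta> by (auto intro!: winding_number_rectpath_outside simp: in_cbox_complex_iff)
  qed auto
  also have "(\<Sum>p\<in>pts. winding_number ?R p * residue G p) = (\<Sum>p\<in>pts. residue G p)"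
  proof (rule sum.cong)
    fix p assume "p \<in> pts"
    then have "p \<in> box (Complex (-X) (-\<eta>)) (Complex X \<eta>)"
      using ptsX[of p] \<eta> by (auto simp: in_box_complex_iff abs_less_iff)
    then show "winding_number ?R p * residue G p = residue G p"
      by (simp add: winding_number_rectpath)
  qed simp
  finally have 1: "contour_integral ?R G = 2 * pi * \<i> * of_real \<rho>" by (simp add: res)

  have cC: "continuous_on A (\<lambda>x. Complex x c)" "continuous_on A (\<lambda>y. Complex c y)" for A c
    unfolding Complex_eq by (intro continuous_intros)+
  have inst: "Complex x \<eta> \<in> {z. \<bar>Im z\<bar> < b} - pts" for x using \<eta> ptsX[of "Complex x \<eta>"] by auto
  have insX: "Complex X y \<in> {z. \<bar>Im z\<bar> < b} - pts" if "\<bar>y\<bar> < b" for y using that X ptsX[of "Complex X y"] by auto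
  have ctop: "continuous_on A (\<lambda>x. G (Complex x \<eta>))" for A
    by (rule continuous_on_compose2[OF contG cC(1)]) (use inst in blast)
  have cright: "continuous_on A (\<lambda>y. G (Complex X y))" if "\<And>y. y \<in> A \<Longrightarrow> \<bar>y\<bar> < b" for A
    by (rule continuous_on_compose2[OF contG cC(2)]) (use that insX in blast)
  define T where "T = integral {0..X} (\<lambda>x. G (Complex x \<eta>))"
  define V where "V = integral {0..\<eta>} (\<lambda>y. G (Complex X y))"
  have minus: "G (Complex (-x) (-y)) = - G (Complex x y)" for x y
    using odd[of "Complex x y"] by (simp add: complex_eq_iff uminus_complex.code)
  have conj: "G (Complex x (-y)) = cnj (G (Complex x y))" for x y
    using cnj[of "Complex x y"] by (simp add: complex_cnj)
  \<comment> \<open>Oddness and conjugation together say that reflection in the imaginary axis turns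
    \<open>G\<close> into \<open>- cnj G\<close>. So real parts cancel on the horizontal sides, and
    conjugation cancels imaginary parts on the vertical ones.\<close>
  have top: "integral {-X..X} (\<lambda>x. G (Complex x \<eta>)) = 2 * \<i> * of_real (Im T)"
    and bot: "integral {-X..X} (\<lambda>x. G (Complex x (-\<eta>))) = - (2 * \<i> * of_real (Im T))"
    and right: "integral {-\<eta>..\<eta>} (\<lambda>y. G (Complex X y)) = 2 * of_real (Re V)"
    and left: "integral {-\<eta>..\<eta>} (\<lambda>y. G (Complex (-X) y)) = - (2 * of_real (Re V))"
  proof -
    have T: "((\<lambda>x. G (Complex x \<eta>)) has_integral T) {0..X}"
      unfolding T_def by (intro integrable_integral integrable_continuous_interval ctop)
    have T': "((\<lambda>x. 2 * \<i> * of_real (Im (G (Complex x \<eta>)))) has_integral 2 * \<i> * of_real (Im T)) {0..X}"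
      by (intro has_integral_mult_right has_integral_of_real has_integral_Im T)
    have V: "((\<lambda>y. G (Complex X y)) has_integral V) {0..\<eta>}"
      unfolding V_def using \<eta> by (intro integrable_integral integrable_continuous_interval cright) auto
    have V': "((\<lambda>y. 2 * complex_of_real (Re (G (Complex X y)))) has_integral 2 * of_real (Re V)) {0..\<eta>}"
      by (intro has_integral_mult_right has_integral_of_real has_integral_Re V)
    show t: "integral {-X..X} (\<lambda>x. G (Complex x \<eta>)) = 2 * \<i> * of_real (Im T)"
    proof (rule has_integral_symmetric_interval[OF _ ctop])
      have "G (Complex x \<eta>) + G (Complex (- x) \<eta>) = 2 * \<i> * of_real (Im (G (Complex x \<eta>)))" for x
        using minus[of x "-\<eta>"] conj[of x \<eta>] by (simp add: complex_eq_iff)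
      with T' show "((\<lambda>x. G (Complex x \<eta>) + G (Complex (- x) \<eta>)) has_integral 2 * \<i> * of_real (Im T)) {0..X}"
        by simp
    qed (use X in simp)
    have "integral {-X..X} (\<lambda>x. G (Complex x (-\<eta>))) = integral {-X..X} (\<lambda>x. cnj (G (Complex x \<eta>)))"
      by (simp add: conj)
    also have "\<dots> = cnj (2 * \<i> * of_real (Im T))"
      by (subst integral_cnj[symmetric]) (simp add: t)
    finally show "integral {-X..X} (\<lambda>x. G (Complex x (-\<eta>))) = - (2 * \<i> * of_real (Im T))" by simp
    show r: "integral {-\<eta>..\<eta>} (\<lambda>y. G (Complex X y)) = 2 * of_real (Re V)"
    proof (rule has_integral_symmetric_interval[OF _ cright])
      have "G (Complex X y) + G (Complex X (- y)) = 2 * of_real (Re (G (Complex X y)))" for y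
        using conj[of X y] by (simp add: complex_eq_iff)
      with V' show "((\<lambda>y. G (Complex X y) + G (Complex X (- y))) has_integral 2 * of_real (Re V)) {0..\<eta>}"
        by simp
    qed (use \<eta> in auto)
    have "G (Complex (- X) y) = - cnj (G (Complex X y))" for y
      using minus[of X "- y"] conj[of X y] by simp
    then have "integral {-\<eta>..\<eta>} (\<lambda>y. G (Complex (-X) y)) = - integral {-\<eta>..\<eta>} (\<lambda>y. cnj (G (Complex X y)))"
      by simp
    also have "\<dots> = - (2 * of_real (Re V))"
      by (subst integral_cnj[symmetric]) (simp add: r)
    finally show "integral {-\<eta>..\<eta>} (\<lambda>y. G (Complex (-X) y)) = - (2 * of_real (Re V))" .
  qed
  have "contour_integral ?R G = - 4 * \<i> * of_real (Im T) + 4 * \<i> * of_real (Re V)"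
    using X \<eta> continuous_on_subset[OF contG img]
    by (subst contour_integral_rectpath_eq) (simp_all add: top bot right left)
  with 1 have 2: "Re V - Im T = pi / 2 * \<rho>"
    by (auto simp: complex_eq_iff field_simps)

  define P where "P x = integral {\<eta>..Y x} (\<lambda>y. G (Complex x y))" for x
  have \<eta>Y: "\<eta> \<le> Y x" if "0 \<le> x" "x \<le> X" for x using b(2)[OF that] \<eta> by simp
  have "((\<lambda>x. G (Complex x (Y x)) * (1 + \<i> * of_real (Y' x)) - G (Complex x \<eta>)) has_integral (\<i> * P X - \<i> * P 0)) {0..X}"
    unfolding P_def using \<eta> X by (intro Cauchy_under_graph[OF G S _ contY derY \<eta>Y region]) auto
  moreover have "((\<lambda>x. G (Complex x \<eta>)) has_integral T) {0..X}"
    unfolding T_def by (intro integrable_integral integrable_continuous_interval ctop)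
  ultimately have "((\<lambda>x. (G (Complex x (Y x)) * (1 + \<i> * of_real (Y' x)) - G (Complex x \<eta>)) + G (Complex x \<eta>))
      has_integral (\<i> * P X - \<i> * P 0 + T)) {0..X}"
    by (rule has_integral_add)
  \<comment> \<open>On the curve \<open>G = - \<i> g\<close>, so the slope contributes
    \<open>g * Y'\<close> to the real part only. Taking imaginary parts leaves
    \<open>- g\<close>.\<close>
  from has_integral_Im[OF this]
  have "((\<lambda>x. Im (G (Complex x (Y x)) * (1 + \<i> * of_real (Y' x)))) has_integral (Re (P X) - Re (P 0) + Im T)) {0..X}"
    by simp
  then have "((\<lambda>x. - g x) has_integral (Re (P X) - Re (P 0) + Im T)) {0..X}"
    by (rule has_integral_spike[of "{0}", rotated 2]) (auto simp: curve)
  from has_integral_neg[OF this]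
  have 3: "(g has_integral (Re (P 0) - Re (P X) - Im T)) {0..X}" by simp

  have cS: "continuous_on {\<eta>..Y x} (\<lambda>y. G (Complex x y))" if "0 \<le> x" "x \<le> X" for x
    by (rule continuous_on_compose2[OF holomorphic_on_imp_continuous_on[OF G] cC(2)]) (use that region \<eta> in auto)
  \<comment> \<open>The imaginary axis is fixed by the reflection that turns \<open>G\<close> into
    \<open>- cnj G\<close>; hence the vertical segment at \<open>x = 0\<close> contributes
    nothing.\<close>
  have "Re (G (Complex 0 y)) = 0" for y
    using minus[of 0 y] conj[of 0 y] by (simp add: complex_eq_iff)
  then have "integral {\<eta>..Y 0} (\<lambda>y. Re (G (Complex 0 y))) = 0" by simp
  moreover have "Re (P 0) = integral {\<eta>..Y 0} (\<lambda>y. Re (G (Complex 0 y)))"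
    unfolding P_def using X
    by (intro integral_unique[symmetric] has_integral_Re integrable_integral integrable_continuous_interval cS) auto
  ultimately have P0: "Re (P 0) = 0" by simp
  have "integral {0..Y X} (\<lambda>y. G (Complex X y)) = V + P X"
    unfolding V_def P_def using \<eta> X \<eta>Y[of X]
    by (intro integral_unique has_integral_combine[of 0 \<eta> "Y X"] integrable_integral integrable_continuous_interval cS cright) auto
  then have "Re (P 0) - Re (P X) - Im T = pi / 2 * \<rho> - Re (integral {0..Y X} (\<lambda>y. G (Complex X y)))"
    using 2 P0 by simp
  with 3 show ?thesis by simp
qed

section \<open>The level curve\<close>

lemma sin_gt_mult_cos:
  assumes "0 < y" "y < pi / 2"
  shows "y * cos y < sin (y::real)"
proof -
  have "(\<lambda>y. sin y - y * cos y) 0 < (\<lambda>y. sin y - y * cos y) y"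
  proof (rule DERIV_pos_imp_increasing_open[OF assms(1)])
    fix x assume "0 < x" "x < y"
    then have "0 < x * sin x" using assms by (intro mult_pos_pos sin_gt_zero) auto
    moreover have "((\<lambda>y. sin y - y * cos y) has_real_derivative x * sin x) (at x)"
      by (auto intro!: derivative_eq_intros)
    ultimately show "\<exists>D. ((\<lambda>y. sin y - y * cos y) has_real_derivative D) (at x) \<and> 0 < D" by blast
  qed (intro continuous_intros)
  then show ?thesis by simp
qed

lemma sinh_gt: "x < sinh x" if "0 < x" for x :: real
proof -
  have "(\<lambda>x. sinh x - x) 0 < (\<lambda>x. sinh x - x) x"
  proof (rule DERIV_pos_imp_increasing_open[OF that])
    fix y :: real assume "0 < y" "y < x"
    moreover have "((\<lambda>x. sinh x - x) has_real_derivative cosh y - 1) (at y)"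
      by (auto intro!: derivative_eq_intros)
    ultimately show "\<exists>D. ((\<lambda>x. sinh x - x) has_real_derivative D) (at y) \<and> 0 < D"
      using cosh_real_nonneg_less_iff[of 0 y] by force
  qed (intro continuous_intros)
  then show ?thesis by simp
qed

lemma sinh_le_mult_cosh: "sinh x \<le> x * cosh x" if "0 \<le> x" for x :: real
proof -
  have "(\<lambda>x. x * cosh x - sinh x) 0 \<le> (\<lambda>x. x * cosh x - sinh x) x"
  proof (rule DERIV_nonneg_imp_nondecreasing[OF that])
    fix y :: real assume "0 \<le> y" "y \<le> x"
    moreover have "((\<lambda>x. x * cosh x - sinh x) has_real_derivative y * sinh y) (at y)"
      by (auto intro!: derivative_eq_intros)
    ultimately show "\<exists>D. ((\<lambda>x. x * cosh x - sinh x) has_real_derivative D) (at y) \<and> 0 \<le> D"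
      by force
  qed
  then show ?thesis by simp
qed

lemma sinh_complex_of_real: "sinh (complex_of_real x) = of_real (sinh x)"
  and cosh_complex_of_real: "cosh (complex_of_real x) = of_real (cosh x)"
  by (simp_all add: sinh_field_def cosh_field_def flip: exp_of_real)

lemma tan_minus_id_mono:
  assumes "0 \<le> x" "x \<le> y" "y < pi / 2"
  shows "tan x - x \<le> tan y - (y::real)"
proof (rule DERIV_nonneg_imp_nondecreasing[OF assms(2), of "\<lambda>y. tan y - y"])
  fix z assume z: "x \<le> z" "z \<le> y"
  then have c: "0 < cos z" using assms by (intro cos_gt_zero_pi) auto
  then have "((\<lambda>y. tan y - y) has_real_derivative inverse ((cos z)\<^sup>2) - 1) (at z)"
    by (auto intro!: derivative_eq_intros)
  moreover have "1 \<le> inverse ((cos z)\<^sup>2)" using c by (simp add: one_le_inverse power_le_one)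
  ultimately show "\<exists>D. ((\<lambda>y. tan y - y) has_real_derivative D) (at z) \<and> 0 \<le> D" by force
qed

locale anger_curve =
  fixes \<beta> :: real
  assumes beta: "0 < \<beta>" "\<beta> < pi / 2"
begin

text \<open>The \<open>f\<close> of the overview, with \<open>real_phase\<close> as its restriction
  to the real axis: the integrand of
  \<open>anger_weber (- \<nu>) (\<nu> * of_real (sec \<beta>))\<close> is
  \<open>exp (- \<nu> * real_phase t)\<close>.\<close>

definition phase :: "complex \<Rightarrow> complex" where
  "phase z = of_real (sec \<beta>) * sinh z - z"

definition real_phase :: "real \<Rightarrow> real" where
  "real_phase t = sec \<beta> * sinh t - t"

definition ratio :: "real \<Rightarrow> real" where
  "ratio x = (if x = 0 then 1 else x / sinh x)"

text \<open>The level curve \<open>Re phase = 0\<close>, written as a graph over the real part; \<open>phase = \<i> height\<close> on it.\<close>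

definition curve :: "real \<Rightarrow> real" where
  "curve x = arccos (cos \<beta> * ratio x)"

definition height :: "real \<Rightarrow> real" where
  "height x = sec \<beta> * cosh x * sin (curve x) - curve x"

lemma cos_beta: "0 < cos \<beta>" "cos \<beta> < 1"
proof -
  show "0 < cos \<beta>" using beta by (intro cos_gt_zero_pi) auto
  show "cos \<beta> < 1" using cos_monotone_0_pi[of 0 \<beta>] beta by simp
qed

lemma sec_gt_1: "1 < sec \<beta>" using cos_beta by (simp add: sec_def)

lemma sec_cos: "sec \<beta> * cos \<beta> = 1" using cos_beta by (simp add: sec_def)

lemma ratio_bounds: "0 < ratio x" "ratio x \<le> 1"
proof -
  show "0 < ratio x" by (auto simp: ratio_def zero_less_divide_iff not_less)
  show "ratio x \<le> 1"
    using sinh_gt[of x] sinh_gt[of "-x"]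
    by (cases "x > 0"; cases "x = 0") (auto simp: ratio_def divide_le_eq)
qed

lemma continuous_ratio: "continuous_on A ratio"
proof -
  have "isCont ratio x" for x
  proof (cases "x = 0")
    case True
    have "((\<lambda>x::real. sinh x / x) \<longlongrightarrow> 1) (at 0)"
    proof -
      have "(sinh has_real_derivative cosh 0) (at 0)" by (auto intro!: derivative_eq_intros)
      then show ?thesis by (simp add: has_field_derivative_iff)
    qed
    then have "((\<lambda>x::real. inverse (sinh x / x)) \<longlongrightarrow> inverse 1) (at 0)" by (rule tendsto_inverse) simp
    then have "((\<lambda>x::real. inverse (sinh x / x)) \<longlongrightarrow> 1) (at 0)" by simp
    then have "(ratio \<longlongrightarrow> 1) (at 0)"
      by (rule filterlim_cong[THEN iffD1, rotated -1])
        (auto simp: ratio_def eventually_at intro!: exI[of _ 1])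
    then show ?thesis using True by (simp add: isCont_def ratio_def)
  next
    case False
    have "continuous_on (- {0}) ratio"
      by (rule continuous_on_eq[of _ "\<lambda>x. x / sinh x"]) (auto simp: ratio_def intro!: continuous_intros)
    then show ?thesis using False by (simp add: continuous_on_eq_continuous_at open_Compl)
  qed
  then show ?thesis by (simp add: continuous_at_imp_continuous_on)
qed

lemma cos_ratio_bounds: "0 < cos \<beta> * ratio x" "cos \<beta> * ratio x \<le> cos \<beta>" "cos \<beta> * ratio x < 1"
proof -
  show "0 < cos \<beta> * ratio x" using cos_beta ratio_bounds by simp
  show *: "cos \<beta> * ratio x \<le> cos \<beta>" using cos_beta ratio_bounds by (simp add: mult_left_le)
  show "cos \<beta> * ratio x < 1" using * cos_beta by linarith
qed

lemma cos_curve: "cos (curve x) = cos \<beta> * ratio x"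
  unfolding curve_def by (rule cos_arccos) (use cos_ratio_bounds[of x] in linarith)+

lemma curve_bounds: "\<beta> \<le> curve x" "curve x < pi / 2" "0 < curve x"
proof -
  have 1: "curve x \<le> pi" "0 \<le> curve x"
    unfolding curve_def using cos_ratio_bounds[of x] by (auto intro: arccos_ubound arccos_lbound)
  show 2: "\<beta> \<le> curve x"
    using cos_mono_le_eq[of "curve x" \<beta>] 1 beta cos_curve[of x] cos_ratio_bounds[of x] by simp
  show "0 < curve x" using 2 beta by simp
  show "curve x < pi / 2"
    using cos_mono_less_eq[of "pi/2" "curve x"] 1 cos_curve[of x] cos_ratio_bounds(1)[of x] by simp
qed

lemma continuous_curve: "continuous_on A curve"
proof -
  have "-1 \<le> cos \<beta> * ratio x \<and> cos \<beta> * ratio x \<le> 1" for x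
    using cos_ratio_bounds[of x] by linarith
  then show ?thesis
    unfolding curve_def [abs_def] by (intro continuous_on_arccos continuous_intros continuous_ratio) blast
qed

text \<open>Existence suffices, because the slope disappears when imaginary parts of the contour
  integral are taken.\<close>

lemma curve_derivative: "\<exists>D. (curve has_real_derivative D) (at x)" if "0 < x"
proof -
  have "((\<lambda>x. x / sinh x) has_real_derivative (sinh x - x * cosh x) / (sinh x * sinh x)) (at x)"
    using that by (auto intro!: derivative_eq_intros)
  then have "(ratio has_real_derivative (sinh x - x * cosh x) / (sinh x * sinh x)) (at x)"
    by (rule has_field_derivative_transform_within_open[of _ _ _ "{0<..}"]) (use that in \<open>auto simp: ratio_def\<close>)
  then have "((\<lambda>x. cos \<beta> * ratio x) has_real_derivative cos \<beta> * ((sinh x - x * cosh x) / (sinh x * sinh x))) (at x)"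
    by (rule DERIV_cmult)
  from DERIV_chain2[OF DERIV_arccos this] show ?thesis
    unfolding curve_def [abs_def] using cos_ratio_bounds[of x] by fastforce
qed

lemma Re_phase: "Re (phase (Complex x y)) = sec \<beta> * sinh x * cos y - x"
  and Im_phase: "Im (phase (Complex x y)) = sec \<beta> * cosh x * sin y - y"
proof -
  have "sinh (Complex x y) = sinh (of_real x + \<i> * of_real y)" by (simp add: Complex_eq)
  also have "\<dots> = of_real (sinh x) * of_real (cos y) + \<i> * (of_real (cosh x) * of_real (sin y))"
  proof -
    have "sinh (\<i> * of_real y) = \<i> * of_real (sin y)" "cosh (\<i> * of_real y) = of_real (cos y)"
      by (simp_all add: sinh_field_def cosh_field_def complex_eq_iff Re_exp Im_exp)
    then show ?thesis by (simp add: sinh_add sinh_complex_of_real cosh_complex_of_real mult_ac)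
  qed
  finally show "Re (phase (Complex x y)) = sec \<beta> * sinh x * cos y - x"
     "Im (phase (Complex x y)) = sec \<beta> * cosh x * sin y - y"
    by (simp_all add: phase_def)
qed

lemma phase_of_real: "phase (of_real t) = of_real (real_phase t)"
  by (simp add: phase_def real_phase_def sinh_complex_of_real)

lemma phase_minus: "phase (- z) = - phase z" by (simp add: phase_def)

lemma phase_cnj: "phase (cnj z) = cnj (phase z)"
  by (simp add: phase_def sinh_field_def exp_cnj)

lemma phase_holomorphic [holomorphic_intros]: "phase holomorphic_on A"
  unfolding phase_def [abs_def] sinh_field_def by (intro holomorphic_intros) auto

lemma phase_derivative: "(phase has_field_derivative (of_real (sec \<beta>) * cosh z - 1)) (at z)"
  unfolding phase_def [abs_def] by (auto intro!: derivative_eq_intros)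

lemma ratio_cosh_ge_1: "1 \<le> ratio x * cosh x" if "0 \<le> x"
  using sinh_le_mult_cosh[OF that] that by (auto simp: ratio_def le_divide_eq)

text \<open>Below the curve \<open>sec \<beta> * cos y\<close> is at least
  \<open>x / sinh x\<close>, and \<open>x * cosh x / sinh x \<ge> 1\<close>; together these give
  \<open>sec \<beta> * cosh x * sin y \<ge> tan y\<close>. The resulting positive imaginary part
  keeps zeros and real values of \<open>phase\<close> out of the region under the curve.\<close>

lemma Im_phase_ge:
  assumes "0 \<le> x" "0 < y" "y \<le> curve x"
  shows "tan y - y \<le> Im (phase (Complex x y))"
proof -
  have y: "y < pi / 2" using assms curve_bounds[of x] by simp
  then have c: "0 < cos y" "0 < sin y" using assms cos_gt_zero_pi[of y] sin_gt_zero[of y] by auto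
  have "cos \<beta> * ratio x \<le> cos y"
    using cos_monotone_0_pi_le[of y "curve x"] assms curve_bounds[of x] cos_curve[of x] by simp
  then have "sec \<beta> * (cos \<beta> * ratio x) \<le> sec \<beta> * cos y" using sec_gt_1 by simp
  then have "ratio x \<le> sec \<beta> * cos y" using sec_cos by (simp add: mult.assoc[symmetric])
  then have "1 \<le> sec \<beta> * cos y * cosh x"
    using ratio_cosh_ge_1[OF assms(1)] mult_right_mono[of "ratio x" "sec \<beta> * cos y" "cosh x"]
    by (meson cosh_real_nonneg order_trans)
  then have "tan y * 1 \<le> tan y * (sec \<beta> * cos y * cosh x)"
    using c by (intro mult_left_mono) (auto simp: tan_def)
  also have "\<dots> = sec \<beta> * cosh x * sin y" using c by (simp add: tan_def)
  finally show ?thesis by (simp add: Im_phase)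
qed

lemma tan_gt_self: "y < tan y" if "0 < y" "y < pi / 2" for y :: real
  using sin_gt_mult_cos[OF that] cos_gt_zero_pi[of y] that by (simp add: tan_def less_divide_eq)

lemma Im_phase_pos: "0 < Im (phase (Complex x y))" if "0 \<le> x" "0 < y" "y \<le> curve x"
  using Im_phase_ge[OF that] tan_gt_self[of y] that curve_bounds[of x] by simp

lemma phase_curve: "phase (Complex x (curve x)) = \<i> * of_real (height x)"
proof -
  have "Re (phase (Complex x (curve x))) = 0"
    using sec_cos by (simp add: Re_phase cos_curve ratio_def mult.assoc mult.left_commute[of "sec \<beta>"] mult.commute[of "cos \<beta>"])
  then show ?thesis by (simp add: complex_eq_iff Im_phase height_def)
qed

lemma height_ge: "tan \<beta> - \<beta> \<le> height x" if "0 \<le> x"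
proof -
  have "tan \<beta> - \<beta> \<le> tan (curve x) - curve x"
    using curve_bounds[of x] beta by (intro tan_minus_id_mono) auto
  also have "\<dots> \<le> height x"
    using Im_phase_ge[of x "curve x"] that curve_bounds[of x] by (simp add: phase_curve)
  finally show ?thesis .
qed

lemma height_pos: "0 < height x" if "0 \<le> x"
  using height_ge[OF that] tan_gt_self[OF beta] by simp

lemma continuous_height: "continuous_on A height"
  unfolding height_def [abs_def] by (intro continuous_intros continuous_curve)

text \<open>Exponential growth makes all powers of \<open>1 / height\<close> integrable, the first
  included. It comes from \<open>cosh\<close>; the bounded subtracted term \<open>curve x\<close> is
  absorbed by the uniform lower bound \<open>height_ge\<close>.\<close>

lemma height_exp_bound: "\<exists>d>0. \<forall>x\<ge>0. d * exp x \<le> height x"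
proof -
  define c where "c = tan \<beta> - \<beta>"
  have c: "c > 0" using tan_gt_self[OF beta] by (simp add: c_def)
  have t: "tan \<beta> > 0" using tan_gt_zero beta by simp
  \<comment> \<open>From \<open>tan \<beta> * cosh x \<le> height x + pi / 2\<close> and
    \<open>c \<le> height x\<close>, the right-hand side is at most
    \<open>(1 + pi / 2 / c) * height x\<close>; the factor 2 is lost in
    \<open>exp x / 2 \<le> cosh x\<close>.\<close>
  define d where "d = tan \<beta> / 2 / (1 + pi / 2 / c)"
  have pos: "1 + pi / 2 / c > 0" using c by (simp add: add_pos_pos)
  have d: "d > 0" unfolding d_def using t pos by (intro divide_pos_pos) auto
  have "d * exp x \<le> height x" if x: "0 \<le> x" for x
  proof -
    have "sin \<beta> \<le> sin (curve x)" using curve_bounds[of x] beta by (intro sin_monotone_2pi_le) auto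
    then have "sec \<beta> * cosh x * sin \<beta> \<le> sec \<beta> * cosh x * sin (curve x)"
      using sec_gt_1 by (intro mult_left_mono) auto
    then have 1: "tan \<beta> * cosh x \<le> height x + pi / 2"
      using curve_bounds[of x] by (simp add: height_def tan_def sec_def mult.commute)
    have "exp x / 2 \<le> cosh x" by (simp add: cosh_field_def)
    then have "tan \<beta> * (exp x / 2) \<le> tan \<beta> * cosh x" using t by (intro mult_left_mono) auto
    also note 1
    also have "height x + pi / 2 = height x + (pi / 2 / c) * c" using c by simp
    also have "\<dots> \<le> height x + (pi / 2 / c) * height x"
      using height_ge[OF x] c by (intro add_left_mono mult_left_mono) (auto simp: c_def)
    also have "\<dots> = (1 + pi / 2 / c) * height x" by (simp add: algebra_simps)
    finally have "tan \<beta> / 2 * exp x \<le> height x * (1 + pi / 2 / c)" by (simp only: mult_ac times_divide_eq_left times_divide_eq_right)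
    then show ?thesis unfolding d_def times_divide_eq_left by (simp only: pos_divide_le_eq[OF pos])
  qed
  with d show ?thesis by blast
qed

section \<open>Real values and growth of the phase\<close>

lemma real_phase_strict_mono: "real_phase x < real_phase y" if "x < y"
proof -
  have "\<exists>D. (real_phase has_real_derivative D) (at z) \<and> 0 < D" for z
  proof (intro exI conjI)
    show "(real_phase has_real_derivative (sec \<beta> * cosh z - 1)) (at z)"
      unfolding real_phase_def [abs_def] by (auto intro!: derivative_eq_intros)
    show "0 < sec \<beta> * cosh z - 1"
      using sec_gt_1 cosh_real_ge_1[of z] mult_strict_mono'[of 1 "sec \<beta>" 1 "cosh z"] 
      by (smt (verit) mult_le_cancel_left1)
  qed
  then show ?thesis using DERIV_pos_imp_increasing[OF that] by blast
qed

lemma real_phase_0 [simp]: "real_phase 0 = 0" by (simp add: real_phase_def)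

lemma real_phase_eq_iff: "real_phase x = real_phase y \<longleftrightarrow> x = y"
  using real_phase_strict_mono[of x y] real_phase_strict_mono[of y x] by (cases x y rule: linorder_cases) auto

text \<open>The strip lies below the curve because \<open>\<beta> \<le> curve x\<close>. Up to sign,
  the imaginary part of \<open>phase\<close> depends only on \<open>\<bar>Re z\<bar>\<close> and
  \<open>\<bar>Im z\<bar>\<close>, which reduces the claim to the first quadrant.\<close>

lemma Im_phase_eq_0_iff:
  assumes "\<bar>Im z\<bar> < \<beta>"
  shows "Im (phase z) = 0 \<longleftrightarrow> Im z = 0"
proof
  assume "Im z = 0"
  then show "Im (phase z) = 0" using Im_phase[of "Re z" "Im z"] unfolding complex.collapse by simp
next
  assume 0: "Im (phase z) = 0"
  have *: "Im (phase (Complex x y)) \<noteq> 0" if "0 \<le> x" "0 < y" "y < \<beta>" for x y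
    using Im_phase_pos[of x y] that curve_bounds[of x] by simp
  show "Im z = 0"
  proof (rule ccontr)
    assume "Im z \<noteq> 0"
    then have "Im (phase (Complex \<bar>Re z\<bar> \<bar>Im z\<bar>)) \<noteq> 0" using assms by (intro *) auto
    moreover have "Im (phase (Complex \<bar>Re z\<bar> \<bar>Im z\<bar>)) = Im (phase z) \<or> Im (phase (Complex \<bar>Re z\<bar> \<bar>Im z\<bar>)) = - Im (phase z)"
      using Im_phase[of "Re z" "Im z"] by (auto simp: Im_phase abs_if)
    ultimately show False using 0 by auto
  qed
qed

text \<open>This is the form in which injectivity enters: it locates all poles of the contour
  integrands in the strip and makes them real.\<close>

lemma phase_eq_of_real_iff:
  assumes "\<bar>Im z\<bar> < \<beta>"
  shows "phase z = of_real (real_phase t) \<longleftrightarrow> z = of_real t"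
proof
  assume eq: "phase z = of_real (real_phase t)"
  then have "Im z = 0" using Im_phase_eq_0_iff[OF assms] by simp
  then have z: "z = of_real (Re z)" by (simp add: complex_eq_iff)
  with eq have "real_phase (Re z) = real_phase t" by (metis of_real_eq_iff phase_of_real)
  then show "z = of_real t" using z real_phase_eq_iff by metis
qed (simp add: phase_of_real)

text \<open>Rests on \<open>\<bar>sinh (x + \<i> y)\<bar>^2 = sinh^2 x + sin^2 y\<close>. The bound
  is uniform in \<open>y\<close>, so that the vertical side of the contour vanishes as it moves to
  infinity.\<close>

lemma norm_phase_ge:
  assumes "0 \<le> x" "0 \<le> y" "y \<le> pi / 2"
  shows "sec \<beta> * sinh x - x - pi / 2 \<le> norm (phase (Complex x y))"
proof -
  have s: "(norm (sinh (Complex x y)))\<^sup>2 = (sinh x)\<^sup>2 + (sin y)\<^sup>2"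
  proof -
    have "Re (sinh (Complex x y)) = sinh x * cos y" "Im (sinh (Complex x y)) = cosh x * sin y"
      using Re_phase[of x y] Im_phase[of x y] sec_gt_1 by (auto simp: phase_def)
    then have "(norm (sinh (Complex x y)))\<^sup>2 = (sinh x)\<^sup>2 * (cos y)\<^sup>2 + (cosh x)\<^sup>2 * (sin y)\<^sup>2"
      by (simp add: cmod_power2 power_mult_distrib)
    also have "\<dots> = (sinh x)\<^sup>2 + (sin y)\<^sup>2"
      by (simp add: cosh_square_eq cos_squared_eq algebra_simps)
    finally show ?thesis .
  qed
  have "sinh x \<le> norm (sinh (Complex x y))"
    by (rule power2_le_imp_le) (auto simp: s)
  then have "sec \<beta> * sinh x \<le> norm (of_real (sec \<beta>) * sinh (Complex x y))"
    using sec_gt_1 by (simp add: norm_mult)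
  also have "\<dots> \<le> norm (phase (Complex x y)) + norm (Complex x y)"
    unfolding phase_def by (metis diff_add_cancel norm_triangle_ineq)
  also have "norm (Complex x y) \<le> x + pi / 2"
    using cmod_le[of "Complex x y"] assms by simp
  finally show ?thesis by simp
qed

lemma filterlim_phase_bound: "filterlim (\<lambda>x. sec \<beta> * sinh x - x - pi / 2) at_top at_top"
proof -
  have "filterlim (\<lambda>x::real. (sec \<beta> - 1) * x - pi / 2) at_top at_top"
    using sec_gt_1 by real_asymp
  then show ?thesis
  proof (rule filterlim_at_top_mono)
    show "\<forall>\<^sub>F x in at_top. (sec \<beta> - 1) * x - pi / 2 \<le> sec \<beta> * sinh x - x - pi / 2"
      using eventually_gt_at_top[of 0]
    proof eventually_elim
      case (elim x)
      then have "sec \<beta> * x \<le> sec \<beta> * sinh x" using sinh_gt[of x] sec_gt_1 by simp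
      then show ?case by (simp add: algebra_simps)
    qed
  qed
qed

end

section \<open>Kernel and moments\<close>

lemma derivative_of_real_restriction:
  fixes F :: "complex \<Rightarrow> complex"
  assumes "(F has_field_derivative D) (at (of_real x))" "\<And>x. F (of_real x) = of_real (\<phi> x)"
  shows "(\<phi> has_real_derivative Re D) (at x)" "D = of_real (Re D)"
proof -
  have "((\<lambda>x. F (of_real x)) has_vector_derivative D) (at x)"
    using has_vector_derivative_real_field[OF assms(1)] .
  then have d: "((\<lambda>x. complex_of_real (\<phi> x)) has_vector_derivative D) (at x)"
    by (simp add: assms(2))
  show "(\<phi> has_real_derivative Re D) (at x)"
    using bounded_linear.has_vector_derivative[OF bounded_linear_Re d]
    by (simp add: has_real_derivative_iff_has_vector_derivative)
  have "((\<lambda>x. 0 :: real) has_vector_derivative Im D) (at x)"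
    using bounded_linear.has_vector_derivative[OF bounded_linear_Im d] by simp
  then have "Im D = 0"
    using vector_derivative_unique_at[OF _ has_vector_derivative_const] by blast
  then show "D = of_real (Re D)" by (simp add: complex_eq_iff)
qed

text \<open>The coefficients are defined by real derivatives, whereas residues produce complex ones;
  this identifies the two.\<close>

lemma higher_deriv_of_real:
  fixes F :: "complex \<Rightarrow> complex"
  assumes "F holomorphic_on S" "open S" "\<And>x::real. of_real x \<in> S" "\<And>x. F (of_real x) = of_real (\<phi> x)"
  shows "(deriv ^^ k) F (of_real x) = of_real ((deriv ^^ k) \<phi> x)"
proof (induction k arbitrary: x)
  case 0
  then show ?case by (simp add: assms)
next
  case (Suc k)
  have "(deriv ^^ k) F holomorphic_on S" using assms by (intro holomorphic_higher_deriv)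
  then have D: "((deriv ^^ k) F has_field_derivative deriv ((deriv ^^ k) F) (of_real x)) (at (of_real x))"
    using assms by (intro holomorphic_derivI)
  from DERIV_imp_deriv[OF derivative_of_real_restriction(1)[OF D Suc]] derivative_of_real_restriction(2)[OF D Suc]
  show ?case by simp
qed

context anger_curve
begin

text \<open>The contour of \<open>odd_symmetric_contour\<close> with its vertical side moved to
  infinity. That side has length below \<open>pi / 2\<close>, and \<open>G\<close> tends to 0 on it
  because \<open>norm_phase_ge\<close> makes \<open>phase\<close> large there.\<close>

lemma contour_limit:
  fixes G :: "complex \<Rightarrow> complex" and g :: "real \<Rightarrow> real"
  assumes odd: "\<And>z. G (- z) = - G z" and cnj: "\<And>z. G (cnj z) = cnj (G z)"
    and strip: "G holomorphic_on {z. \<bar>Im z\<bar> < \<beta>} - pts" and pts: "finite pts" "\<And>p. p \<in> pts \<Longrightarrow> Im p = 0"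
    and res: "(\<Sum>p\<in>pts. residue G p) = of_real \<rho>"
    and G: "G holomorphic_on {z. Im (phase z) > 0}"
    and curve: "\<And>x. 0 < x \<Longrightarrow> G (Complex x (curve x)) = - \<i> * of_real (g x)"
    and small: "\<And>e. e > 0 \<Longrightarrow> \<exists>B. \<forall>z. B \<le> norm (phase z) \<longrightarrow> norm (G z) \<le> e"
    and g: "integrable half_line g"
  shows "(\<integral>x. g x \<partial>half_line) = pi / 2 * \<rho>"
proof -
  obtain D where D: "\<And>x. 0 < x \<Longrightarrow> (curve has_real_derivative D x) (at x)"
    using curve_derivative by metis
  define V where "V X = Re (integral {0..curve X} (\<lambda>y. G (Complex X y)))" for X
  have S: "open {z. Im (phase z) > 0}"
    by (intro open_Collect_less continuous_intros holomorphic_on_imp_continuous_on phase_holomorphic)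
  have ev: "\<forall>\<^sub>F X in at_top. X > 0 \<and> (\<forall>p\<in>pts. \<bar>Re p\<bar> < X)"
    using pts(1) by (auto intro!: eventually_conj eventually_gt_at_top simp: eventually_ball_finite_distrib)
  have int: "(g has_integral (pi / 2 * \<rho> - V X)) {0..X}" if "X > 0 \<and> (\<forall>p\<in>pts. \<bar>Re p\<bar> < X)" for X
    unfolding V_def
  proof (rule odd_symmetric_contour[OF odd cnj strip pts(1) _ res G S _ continuous_curve D beta(1)])
    show "\<And>x. \<lbrakk>0 \<le> x; x \<le> X\<rbrakk> \<Longrightarrow> \<beta> \<le> curve x" using curve_bounds by simp
    show "\<And>x y. \<lbrakk>0 \<le> x; x \<le> X; 0 < y; y \<le> curve x\<rbrakk> \<Longrightarrow> Complex x y \<in> {z. 0 < Im (phase z)}"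
      using Im_phase_pos by simp
  qed (use that pts curve in auto)
  have "(V \<longlongrightarrow> 0) at_top"
  proof (rule tendstoI)
    fix e :: real assume e: "e > 0"
    then obtain B where B: "\<And>z. B \<le> norm (phase z) \<Longrightarrow> norm (G z) \<le> e / 2"
      using small[of "e / 2"] by auto
    have "\<forall>\<^sub>F X in at_top. B \<le> sec \<beta> * sinh X - X - pi / 2"
      using filterlim_phase_bound unfolding filterlim_at_top by blast
    with ev show "\<forall>\<^sub>F X in at_top. dist (V X) 0 < e"
      using filterlim_phase_bound[unfolded filterlim_at_top, rule_format, of "1"]
    proof eventually_elim
      case (elim X)
      have b: "norm (G (Complex X y)) \<le> e / 2" if "y \<in> {0..curve X}" for y
        using that elim curve_bounds[of X] by (intro B order_trans[OF _ norm_phase_ge]) auto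
      have "norm (integral {0..curve X} (\<lambda>y. G (Complex X y))) \<le> e / 2 * (pi / 2)"
      proof (cases "(\<lambda>y. G (Complex X y)) integrable_on {0..curve X}")
        case True
        then have "norm (integral {0..curve X} (\<lambda>y. G (Complex X y))) \<le> e / 2 * measure lborel {0..curve X}"
          by (intro has_integral_bound_real[OF _ finite.emptyI integrable_integral]) (use e b in auto)
        also have "\<dots> \<le> e / 2 * (pi / 2)"
          using e curve_bounds[of X] by (intro mult_left_mono) auto
        finally show ?thesis .
      next
        \<comment> \<open>An integral that does not exist has the value 0, so the bound holds in
          this case as well.\<close>
        case False
        then show ?thesis using e by (simp add: not_integrable_integral)
      qed
      also have "\<dots> < e" using e pi_less_4 by simp
      finally show "dist (V X) 0 < e"
        using abs_Re_le_cmod[of "integral {0..curve X} (\<lambda>y. G (Complex X y))"] by (simp add: V_def)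
    qed
  qed
  then have "((\<lambda>X. pi / 2 * \<rho> - V X) \<longlongrightarrow> pi / 2 * \<rho> - 0) at_top" by (intro tendsto_intros)
  then have L: "((\<lambda>X. pi / 2 * \<rho> - V X) \<longlongrightarrow> pi / 2 * \<rho>) at_top" by (simp only: diff_zero)
  have "\<forall>\<^sub>F X in at_top. pi / 2 * \<rho> - V X = (\<integral>x. indicator {..X} x *\<^sub>R (indicator {0..} x *\<^sub>R g x) \<partial>lborel)"
    using ev
  proof eventually_elim
    case (elim X)
    have "set_integrable lborel {0..X} g"
      by (rule set_integrable_subset[of _ "{0..}"]) (use g in \<open>auto simp: half_line_integrable_iff\<close>)
    then have "(LINT x:{0..X}|lborel. g x) = integral {0..X} g"
      by (rule set_borel_integral_eq_integral(2))
    also have "\<dots> = pi / 2 * \<rho> - V X" using int[OF elim] by (rule integral_unique)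
    also have "(LINT x:{0..X}|lborel. g x) = (\<integral>x. indicator {..X} x *\<^sub>R (indicator {0..} x *\<^sub>R g x) \<partial>lborel)"
      unfolding set_lebesgue_integral_def by (intro Bochner_Integration.integral_cong) (auto simp: indicator_def)
    finally show ?case by simp
  qed
  then have "((\<lambda>X. \<integral>x. indicator {..X} x *\<^sub>R (indicator {0..} x *\<^sub>R g x) \<partial>lborel) \<longlongrightarrow> pi / 2 * \<rho>) at_top"
    by (rule Lim_transform_eventually[OF L])
  moreover have "((\<lambda>X. \<integral>x. indicator {..X} x *\<^sub>R (indicator {0..} x *\<^sub>R g x) \<partial>lborel) \<longlongrightarrow> (\<integral>x. indicator {0..} x *\<^sub>R g x \<partial>lborel)) at_top"
    using g by (intro tendsto_integral_at_top) (auto simp: half_line_integrable_iff set_integrable_def)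
  ultimately show ?thesis
    unfolding half_line_integral_eq set_lebesgue_integral_def
    by (intro tendsto_unique[OF trivial_limit_at_top_linorder])
qed

text \<open>One factor \<open>exp x\<close> of \<open>(d * exp x) ^ Suc n\<close> is enough for
  integrability; the others are at least 1.\<close>

lemma inverse_height_integrable: "integrable half_line (\<lambda>x. 1 / height x ^ Suc n)"
proof -
  obtain d where d: "d > 0" "\<And>x. 0 \<le> x \<Longrightarrow> d * exp x \<le> height x" using height_exp_bound by blast
  have "integrable half_line (\<lambda>x. (1 / d) ^ Suc n * (x ^ 0 * exp (- (1 * x))))"
    by (intro integrable_mult_right half_line_power_exp(1)) simp
  then show ?thesis
  proof (rule Bochner_Integration.integrable_bound)
    show "(\<lambda>x. 1 / height x ^ Suc n) \<in> borel_measurable half_line"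
      using height_pos by (intro measurable_half_line_continuous continuous_intros continuous_height) force
    show "AE x in half_line. norm (1 / height x ^ Suc n) \<le> norm ((1 / d) ^ Suc n * (x ^ 0 * exp (- (1 * x))))"
    proof (rule AE_I2)
      fix x assume "x \<in> space half_line"
      then have x: "0 \<le> x" by simp
      have "d ^ Suc n * exp x \<le> d ^ Suc n * exp x ^ Suc n"
        using d x by (intro mult_left_mono) (auto simp: one_le_power)
      also have "\<dots> = (d * exp x) ^ Suc n" by (simp add: power_mult_distrib)
      also have "\<dots> \<le> height x ^ Suc n" using d x by (intro power_mono) auto
      finally have "1 / height x ^ Suc n \<le> 1 / (d ^ Suc n * exp x)"
        using d by (intro divide_left_mono mult_pos_pos zero_less_power height_pos x) auto
      then show "norm (1 / height x ^ Suc n) \<le> norm ((1 / d) ^ Suc n * (x ^ 0 * exp (- (1 * x))))"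
        using d height_pos[OF x] by (simp add: exp_minus field_simps power_divide)
    qed
  qed
qed

lemma height_measurable [measurable]: "height \<in> borel_measurable half_line"
  by (rule measurable_half_line_continuous[OF continuous_height])

lemma kernel_integrable: "integrable half_line (\<lambda>x. height x / (height x ^ 2 + u ^ 2))"
proof (rule Bochner_Integration.integrable_bound[OF inverse_height_integrable[of 0]])
  show "AE x in half_line. norm (height x / (height x ^ 2 + u ^ 2)) \<le> norm (1 / height x ^ Suc 0)"
  proof (rule AE_I2)
    fix x assume "x \<in> space half_line"
    then have h: "0 < height x" using height_pos by simp
    then have "height x / (height x ^ 2 + u ^ 2) \<le> height x / height x ^ 2"
      by (intro divide_left_mono mult_pos_pos add_pos_nonneg) auto
    then show "norm (height x / (height x ^ 2 + u ^ 2)) \<le> norm (1 / height x ^ Suc 0)"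
      using h by (simp add: power2_eq_square)
  qed
qed measurable

text \<open>The integrand \<open>G\<close> is \<open>1 / (phase - u) + 1 / (phase + u)\<close>; the
  second summand makes it odd. Its poles are at \<open>t\<close> and \<open>- t\<close>, and both
  residues are the reciprocal of the derivative \<open>sec \<beta> * cosh t - 1\<close>, which is
  even in \<open>t\<close>.\<close>

lemma kernel_integral:
  assumes t: "0 < t"
  shows "(\<integral>x. height x / (height x ^ 2 + real_phase t ^ 2) \<partial>half_line) = pi / 2 / (sec \<beta> * cosh t - 1)"
proof -
  define u where "u = real_phase t"
  have u: "u > 0" using real_phase_strict_mono[OF t] by (simp add: u_def)
  define D where "D = sec \<beta> * cosh t - 1"
  have D: "D > 0"
    using sec_gt_1 cosh_real_ge_1[of t] mult_mono[of 1 "sec \<beta>" 1 "cosh t"] cosh_real_nonneg_less_iff[of 0 t] t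
    by (simp add: D_def) (smt (verit) mult_le_cancel_left1)
  define G where "G z = 2 * phase z / (phase z ^ 2 - of_real u ^ 2)" for z
  have mt: "real_phase (- t) = - u" by (simp add: real_phase_def u_def)
  have zero: "phase z ^ 2 - of_real u ^ 2 = 0 \<longleftrightarrow> z \<in> {of_real t, of_real (- t)}" if "\<bar>Im z\<bar> < \<beta>" for z
    using phase_eq_of_real_iff[OF that, of t] phase_eq_of_real_iff[OF that, of "- t"] mt
    by (auto simp: power2_eq_iff u_def)
  have zero': "phase z ^ 2 - of_real u ^ 2 \<noteq> 0" if "0 < Im (phase z)" for z
    using that by (auto simp: power2_eq_iff)
  have res: "residue G (of_real s) = of_real (1 / D)" if s: "s = t \<or> s = - t" for s
  proof -
    have ph: "phase (of_real s) = of_real (real_phase s)" by (rule phase_of_real)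
    have ps: "real_phase s ^ 2 = u ^ 2" "real_phase s \<noteq> 0" using s mt u by (auto simp: u_def)
    have cs: "cosh s = cosh t" using s by auto
    have "residue (\<lambda>z. (2 * phase z) / (phase z ^ 2 - of_real u ^ 2)) (of_real s) = 2 * phase (of_real s) / (2 * phase (of_real s) * of_real D)"
    proof (rule residue_simple_pole_deriv[where s = UNIV])
      show "((\<lambda>z. phase z ^ 2 - of_real u ^ 2) has_field_derivative 2 * phase (of_real s) * of_real D) (at (of_real s))"
        by (auto intro!: derivative_eq_intros phase_derivative simp: D_def cosh_complex_of_real cs)
      show "(phase (of_real s))\<^sup>2 - (complex_of_real u)\<^sup>2 = 0"
        using ps by (simp add: ph flip: of_real_power)
    qed (use ps D in \<open>auto intro!: holomorphic_intros simp: ph\<close>)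
    also have "\<dots> = of_real (1 / D)" using ps D by (simp add: ph)
    finally show ?thesis by (simp add: G_def [abs_def])
  qed
  have "(\<integral>x. 2 * (height x / (height x ^ 2 + u ^ 2)) \<partial>half_line) = pi / 2 * (2 / D)"
  proof (rule contour_limit[where G = G and pts = "{of_real t, of_real (- t)}"])
    show "G holomorphic_on {z. \<bar>Im z\<bar> < \<beta>} - {of_real t, of_real (- t)}"
      unfolding G_def [abs_def] using zero by (intro holomorphic_intros) auto
    show "G holomorphic_on {z. 0 < Im (phase z)}"
      unfolding G_def [abs_def] using zero' by (intro holomorphic_intros) auto
    show "(\<Sum>p\<in>{of_real t, of_real (- t)}. residue G p) = of_real (2 / D)"
      using t res[of t] res[of "-t"] by (simp del: of_real_minus add: of_real_eq_iff[of t "-t"])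
    show "G (Complex x (curve x)) = - \<i> * of_real (2 * (height x / (height x ^ 2 + u ^ 2)))" if "0 < x" for x
    proof -
      have eq: "(\<i> * complex_of_real (height x))\<^sup>2 - (of_real u)\<^sup>2 = - of_real (height x ^ 2 + u ^ 2)"
        by (simp add: power_mult_distrib)
      show ?thesis
        unfolding G_def phase_curve eq of_real_mult of_real_divide by (simp del: of_real_add)
    qed
    show "\<exists>B. \<forall>z. B \<le> norm (phase z) \<longrightarrow> norm (G z) \<le> e" if e: "e > 0" for e
    proof (intro exI allI impI)
      \<comment> \<open>With \<open>norm (phase z) \<ge> 2 * u\<close> the denominator is at least
        half of \<open>norm (phase z) ^ 2\<close>, so \<open>G\<close> is at most
        \<open>4 / norm (phase z)\<close>; the summand \<open>4 / e\<close> brings this below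
        \<open>e\<close>.\<close>
      fix z assume z: "2 * u + 4 / e \<le> norm (phase z)"
      let ?p = "norm (phase z)"
      have p: "2 * u \<le> ?p" "4 / e \<le> ?p" "0 < ?p" 
      proof -
        have "0 < 4 / e" using e by simp
        with z u show "2 * u \<le> ?p" "4 / e \<le> ?p" "0 < ?p" by linarith+
      qed
      have "(2 * u)\<^sup>2 \<le> ?p\<^sup>2" using p u by (intro power_mono) auto
      moreover have "(2 * u)\<^sup>2 = 4 * u\<^sup>2" by simp
      ultimately have "?p\<^sup>2 / 2 \<le> ?p\<^sup>2 - u\<^sup>2" using zero_le_power2[of u] by linarith
      also have "\<dots> \<le> norm (phase z ^ 2 - of_real u ^ 2)"
        using norm_triangle_ineq2[of "phase z ^ 2" "of_real u ^ 2"] by (simp add: norm_power)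
      finally have "norm (G z) \<le> 2 * ?p / (?p\<^sup>2 / 2)"
        unfolding G_def norm_divide using p by (intro frac_le) (auto simp: norm_mult)
      also have "\<dots> = 4 / ?p" using p by (simp add: power2_eq_square)
      also have "\<dots> \<le> e" using p e by (simp add: field_simps)
      finally show "norm (G z) \<le> e" .
    qed
    show "integrable half_line (\<lambda>x. 2 * (height x / (height x ^ 2 + u ^ 2)))"
      by (intro integrable_mult_right kernel_integrable)
  qed (auto simp: G_def phase_minus phase_cnj)
  then have "2 * (\<integral>x. height x / (height x ^ 2 + u ^ 2) \<partial>half_line) = 2 * (pi / 2 / D)"
    unfolding integral_mult_right_zero by simp
  then show ?thesis unfolding u_def D_def by linarith
qed

section \<open>The coefficients as moments of the inverse height\<close>

definition base :: "complex \<Rightarrow> complex" where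
  "base z = (if z = 0 then of_real (1 / (sec \<beta> - 1)) else z / phase z)"

lemma base_of_real: "base (of_real t) = of_real (anger_base \<beta> t)"
  using phase_of_real[of t] by (simp add: base_def anger_base_def real_phase_def)

lemma phase_eq_0_iff: "\<bar>Im z\<bar> < \<beta> \<Longrightarrow> phase z = 0 \<longleftrightarrow> z = 0"
  using phase_eq_of_real_iff[of z 0] by simp

text \<open>Riemann's theorem on removable singularities; the value at 0 is the reciprocal of the
  derivative \<open>sec \<beta> - 1\<close> of \<open>phase\<close> there.\<close>

lemma base_holomorphic: "base holomorphic_on {z. \<bar>Im z\<bar> < \<beta>}"
proof (rule no_isolated_singularity'[where K = "{0}"])
  show "open {z. \<bar>Im z\<bar> < \<beta>}" by (intro open_Collect_less continuous_intros)
  have "(\<lambda>z. z / phase z) holomorphic_on {z. \<bar>Im z\<bar> < \<beta>} - {0}"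
    using phase_eq_0_iff by (intro holomorphic_intros) auto
  then show "base holomorphic_on {z. \<bar>Im z\<bar> < \<beta>} - {0}"
    by (rule holomorphic_transform) (auto simp: base_def)
  have "((\<lambda>z. phase z / z) \<longlongrightarrow> of_real (sec \<beta> - 1)) (at 0)"
    using phase_derivative[of 0] by (simp add: has_field_derivative_iff phase_def)
  then have "((\<lambda>z. inverse (phase z / z)) \<longlongrightarrow> inverse (of_real (sec \<beta> - 1))) (at 0)"
    by (rule tendsto_inverse) (use sec_gt_1 in auto)
  then have "((\<lambda>z. inverse (phase z / z)) \<longlongrightarrow> base 0) (at 0)"
    by (simp add: base_def inverse_eq_divide)
  then have "(base \<longlongrightarrow> base 0) (at 0)"
    by (rule filterlim_cong[THEN iffD1, rotated -1])
      (auto simp: base_def eventually_at intro!: exI[of _ 1])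
  then show "(base \<longlongrightarrow> base z) (at z within {z. \<bar>Im z\<bar> < \<beta>})" if "z \<in> {0}" for z
    using that by (auto intro: tendsto_within_subset)
qed auto

text \<open>Dividing by \<open>phase\<close> to the power \<open>2n + 1\<close> amounts to dividing
  \<open>base ^ (2n + 1)\<close> by the same power of \<open>z\<close>. The residue is thus its
  Taylor coefficient of order \<open>2n\<close>, which is the definition of the coefficient up to
  sign.\<close>

lemma residue_phase_power: "residue (\<lambda>z. 1 / phase z ^ (2 * n + 1)) 0 = of_real (- anger_coeff n \<beta>)"
proof -
  have op: "open {z. \<bar>Im z\<bar> < \<beta>}" by (intro open_Collect_less continuous_intros)
  have hol: "(\<lambda>z. base z ^ (2 * n + 1)) holomorphic_on {z. \<bar>Im z\<bar> < \<beta>}"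
    by (intro holomorphic_intros base_holomorphic)
  have "residue (\<lambda>z. 1 / phase z ^ (2 * n + 1)) 0 = residue (\<lambda>z. base z ^ (2 * n + 1) / z ^ Suc (2 * n)) 0"
    by (rule residue_cong)
      (auto simp: base_def eventually_at power_divide intro!: exI[of _ 1])
  also have "\<dots> = (deriv ^^ (2 * n)) (\<lambda>z. base z ^ (2 * n + 1)) (of_real 0) / fact (2 * n)"
    using residue_holomorphic_over_power'[OF op _ hol, of "2 * n"] beta by simp
  also have "(deriv ^^ (2 * n)) (\<lambda>z. base z ^ (2 * n + 1)) (of_real 0) = of_real ((deriv ^^ (2 * n)) (\<lambda>t. anger_base \<beta> t ^ (2 * n + 1)) 0)"
    using beta by (intro higher_deriv_of_real[OF hol op]) (auto simp: base_of_real)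
  finally show ?thesis by (simp add: anger_coeff_def)
qed

text \<open>The alternating sign stems from
  \<open>(\<i> h)^(2n+1) = (-1)^n * \<i> * h^(2n+1)\<close> on the curve.\<close>

lemma moment_integral:
  "(\<integral>x. 1 / height x ^ (2 * n + 1) \<partial>half_line) = (-1) ^ n * (pi / 2) * (- anger_coeff n \<beta>)"
proof -
  have "(\<integral>x. (-1) ^ n * (1 / height x ^ (2 * n + 1)) \<partial>half_line) = pi / 2 * (- anger_coeff n \<beta>)"
  proof (rule contour_limit[where G = "\<lambda>z. 1 / phase z ^ (2 * n + 1)" and pts = "{0}"])
    show "(\<lambda>z. 1 / phase z ^ (2 * n + 1)) holomorphic_on {z. \<bar>Im z\<bar> < \<beta>} - {0}"
      using phase_eq_0_iff by (intro holomorphic_intros) auto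
    show "(\<lambda>z. 1 / phase z ^ (2 * n + 1)) holomorphic_on {z. 0 < Im (phase z)}"
      by (intro holomorphic_intros) auto
    show "(\<Sum>p\<in>{0}. residue (\<lambda>z. 1 / phase z ^ (2 * n + 1)) p) = of_real (- anger_coeff n \<beta>)"
      using residue_phase_power by simp
    show "1 / phase (Complex x (curve x)) ^ (2 * n + 1) = - \<i> * of_real ((-1) ^ n * (1 / height x ^ (2 * n + 1)))"
      if "0 < x" for x
    proof -
      have "\<i> ^ (2 * n + 1) = (-1) ^ n * \<i>" by (simp add: power_mult)
      moreover have "((-1) ^ n :: complex) * (-1) ^ n = 1" by (simp flip: power_mult_distrib)
      ultimately show ?thesis
        using height_pos[of x] that by (simp add: phase_curve power_mult_distrib field_simps)
    qed
    show "\<exists>B. \<forall>z. B \<le> norm (phase z) \<longrightarrow> norm (1 / phase z ^ (2 * n + 1)) \<le> e" if e: "e > 0" for e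
    proof (intro exI allI impI)
      \<comment> \<open>The summand 1 makes powers of the norm increasing in the exponent, so that
        the first power already bounds the rest.\<close>
      fix z assume z: "1 + 1 / e \<le> norm (phase z)"
      have "1 / e \<le> norm (phase z) ^ 1" "1 \<le> norm (phase z)" using z e by (auto intro: order_trans[rotated])
      moreover have "norm (phase z) ^ 1 \<le> norm (phase z) ^ (2 * n + 1)"
        using calculation by (intro power_increasing) auto
      ultimately have "1 / e \<le> norm (phase z) ^ (2 * n + 1)" by linarith
      then have "1 / norm (phase z) ^ (2 * n + 1) \<le> 1 / (1 / e)"
        using e by (intro frac_le) auto
      then have "1 / norm (phase z) ^ (2 * n + 1) \<le> e" by (simp only: divide_divide_eq_right mult_1 div_by_1)
      then show "norm (1 / phase z ^ (2 * n + 1)) \<le> e" by (simp only: norm_divide norm_power norm_one)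
    qed
    show "integrable half_line (\<lambda>x. (-1) ^ n * (1 / height x ^ (2 * n + 1)))"
      using inverse_height_integrable[of "2 * n"] by (intro integrable_mult_right) simp
  qed (auto simp: phase_minus phase_cnj)
  then have "(-1) ^ n * (\<integral>x. 1 / height x ^ (2 * n + 1) \<partial>half_line) = pi / 2 * (- anger_coeff n \<beta>)"
    by (simp only: integral_mult_right_zero)
  then have "(-1) ^ n * ((-1) ^ n * (\<integral>x. 1 / height x ^ (2 * n + 1) \<partial>half_line)) = (-1) ^ n * (pi / 2 * (- anger_coeff n \<beta>))"
    by simp
  moreover have "((-1) ^ n :: real) * (-1) ^ n = 1" by (simp flip: power_mult_distrib)
  ultimately show ?thesis by (simp add: mult.assoc[symmetric])
qed

end

section \<open>The expansion with remainder\<close>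

text \<open>Strictness is what yields \<open>0 < \<Theta> < 1\<close>. Positivity is asked only for
  \<open>x > 0\<close> because the integrands contain \<open>x ^ k\<close> and may vanish at
  0.\<close>

lemma half_line_integral_pos:
  fixes f :: "real \<Rightarrow> real"
  assumes f: "integrable half_line f" and pos: "\<And>x. 0 < x \<Longrightarrow> 0 < f x"
  shows "0 < (\<integral>x. f x \<partial>half_line)"
proof -
  have pos_AE: "AE x in half_line. 0 < f x"
  proof -
    have "AE x in lborel. x \<noteq> (0::real)" by (rule AE_lborel_singleton)
    then have "AE x in lborel. x \<in> {0..} \<longrightarrow> 0 < f x" using pos by (auto elim!: eventually_mono)
    then show ?thesis unfolding half_line_def by (subst AE_restrict_space_iff) auto
  qed
  then have nn: "AE x in half_line. 0 \<le> f x" by (auto elim: eventually_mono)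
  have "(\<integral>x. f x \<partial>half_line) \<noteq> 0"
  proof
    assume "(\<integral>x. f x \<partial>half_line) = 0"
    then have "AE x in half_line. f x = 0" using integral_nonneg_eq_0_iff_AE[OF f nn] by simp
    with pos_AE have "AE x in half_line. False" by eventually_elim simp
    then have "emeasure half_line (space half_line) = 0" by (simp add: eventually_False ae_filter_eq_bot_iff)
    moreover have "emeasure half_line (space half_line) \<noteq> 0"
    proof -
      have "emeasure lborel {0..1::real} \<le> emeasure lborel {0::real..}" by (intro emeasure_mono) auto
      then show ?thesis by (auto simp: half_line_def emeasure_restrict_space space_restrict_space)
    qed
    ultimately show False by simp
  qed
  moreover have "0 \<le> (\<integral>x. f x \<partial>half_line)" by (rule integral_nonneg_AE[OF nn])
  ultimately show ?thesis by simp
qed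

interpretation half_line_pair: pair_sigma_finite half_line half_line ..

lemma half_line_integrable_product:
  fixes f g :: "real \<Rightarrow> real"
  assumes "integrable half_line f" "integrable half_line g"
  shows "integrable (half_line \<Otimes>\<^sub>M half_line) (\<lambda>(u, x). f u * g x)"
proof (rule half_line_pair.Fubini_integrable)
  have [measurable]: "f \<in> borel_measurable half_line" "g \<in> borel_measurable half_line" using assms by auto
  show "(\<lambda>(u, x). f u * g x) \<in> borel_measurable (half_line \<Otimes>\<^sub>M half_line)" by measurable
qed (use assms in \<open>auto simp: abs_mult\<close>)

text \<open>Substituting \<open>u = h * v\<close> moves the dependence on \<open>h\<close> into the
  argument of the terminant.\<close>

lemma terminant_scaled:
  assumes h: "h > 0" and w: "Re w > 0"
  shows "(\<integral>u. exp (- (w * of_real u)) * of_real (u ^ (2 * N) / h ^ (2 * N) * (h / (h ^ 2 + u ^ 2))) \<partial>half_line)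
     = terminant (2 * N) (w * of_real h)"
proof -
  have "(\<integral>u. exp (- (w * of_real u)) * of_real (u ^ (2 * N) / h ^ (2 * N) * (h / (h ^ 2 + u ^ 2))) \<partial>half_line)
     = h *\<^sub>R (\<integral>u. exp (- (w * of_real (h * u))) * of_real ((h * u) ^ (2 * N) / h ^ (2 * N) * (h / (h ^ 2 + (h * u) ^ 2))) \<partial>half_line)"
    by (rule half_line_integral_scale[OF h])
  also have "\<dots> = (\<integral>u. h *\<^sub>R (exp (- (w * of_real (h * u))) * of_real ((h * u) ^ (2 * N) / h ^ (2 * N) * (h / (h ^ 2 + (h * u) ^ 2)))) \<partial>half_line)"
    by simp
  also have "\<dots> = terminant (2 * N) (w * of_real h)"
    unfolding terminant_def
  proof (rule Bochner_Integration.integral_cong[OF refl])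
    fix u :: real
    have "h * ((h * u) ^ (2 * N) / h ^ (2 * N) * (h / (h ^ 2 + (h * u) ^ 2))) = u ^ (2 * N) / (1 + u ^ 2)"
    proof -
      have "h ^ 2 + (h * u) ^ 2 = h ^ 2 * (1 + u ^ 2)" by (simp add: power_mult_distrib algebra_simps)
      moreover have "1 + u ^ 2 \<noteq> 0" using zero_le_power2[of u] by linarith
      ultimately show ?thesis using h by (simp add: power_mult_distrib power2_eq_square)
    qed
    then have "complex_of_real (h * ((h * u) ^ (2 * N) / h ^ (2 * N) * (h / (h ^ 2 + (h * u) ^ 2)))) = of_real u ^ (2 * N) / (1 + of_real u ^ 2)"
      by simp
    note eq = this
    have s: "h *\<^sub>R (E * of_real X) = E * complex_of_real (h * X)" for E X
      by (simp add: scaleR_conv_of_real)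
    show "h *\<^sub>R (exp (- (w * of_real (h * u))) * of_real ((h * u) ^ (2 * N) / h ^ (2 * N) * (h / (h ^ 2 + (h * u) ^ 2))))
        = exp (- (w * of_real h * of_real u)) * (of_real u ^ (2 * N) / (1 + of_real u ^ 2))"
      unfolding s eq by (simp only: of_real_mult mult.assoc)
  qed
  finally show ?thesis .
qed

lemma geometric_kernel:
  fixes h u :: real
  assumes "h > 0"
  shows "h / (h ^ 2 + u ^ 2) = (\<Sum>n<N. (-1) ^ n * u ^ (2 * n) * (1 / h ^ (2 * n + 1)))
     + (-1) ^ N * (u ^ (2 * N) / h ^ (2 * N) * (h / (h ^ 2 + u ^ 2)))"
proof (induction N)
  case (Suc N)
  have pos: "h\<^sup>2 + u\<^sup>2 \<noteq> 0" using assms by (smt (verit) zero_le_power2 zero_less_power)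
  \<comment> \<open>One step of the geometric expansion; the same quotient reappears with the factor
    \<open>- u^2 / h^2\<close>.\<close>
  have "h / (h ^ 2 + u ^ 2) = 1 / h - (u ^ 2 / h ^ 2) * (h / (h ^ 2 + u ^ 2))"
    using assms pos by (simp add: divide_simps) (simp add: algebra_simps power2_eq_square)
  then have "u ^ (2 * N) / h ^ (2 * N) * (h / (h ^ 2 + u ^ 2)) =
      u ^ (2 * N) / h ^ (2 * N) * (1 / h - (u ^ 2 / h ^ 2) * (h / (h ^ 2 + u ^ 2)))"
    by (rule arg_cong[where f = "\<lambda>z. u ^ (2 * N) / h ^ (2 * N) * z"])
  also have "\<dots> = u ^ (2 * N) * (1 / h ^ (2 * N + 1)) - u ^ (2 * Suc N) / h ^ (2 * Suc N) * (h / (h ^ 2 + u ^ 2))"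
    by (simp add: right_diff_distrib power2_eq_square mult_ac)
  finally have "u ^ (2 * N) / h ^ (2 * N) * (h / (h ^ 2 + u ^ 2)) =
     u ^ (2 * N) * (1 / h ^ (2 * N + 1)) - u ^ (2 * Suc N) / h ^ (2 * Suc N) * (h / (h ^ 2 + u ^ 2))" .
  then have "(-1) ^ N * (u ^ (2 * N) / h ^ (2 * N) * (h / (h ^ 2 + u ^ 2))) =
     (-1) ^ N * (u ^ (2 * N) * (1 / h ^ (2 * N + 1)) - u ^ (2 * Suc N) / h ^ (2 * Suc N) * (h / (h ^ 2 + u ^ 2)))"
    by (rule arg_cong[where f = "\<lambda>z. (-1) ^ N * z"])
  also have "\<dots> = (-1) ^ N * u ^ (2 * N) * (1 / h ^ (2 * N + 1)) + (-1) ^ Suc N * (u ^ (2 * Suc N) / h ^ (2 * Suc N) * (h / (h ^ 2 + u ^ 2)))"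
    by (simp only: right_diff_distrib power_Suc mult_minus1 mult_minus_left mult.assoc)
  finally have E: "(-1) ^ N * (u ^ (2 * N) / h ^ (2 * N) * (h / (h ^ 2 + u ^ 2))) =
    (-1) ^ N * u ^ (2 * N) * (1 / h ^ (2 * N + 1)) + (-1) ^ Suc N * (u ^ (2 * Suc N) / h ^ (2 * Suc N) * (h / (h ^ 2 + u ^ 2)))" .
  show ?case
    using trans[OF Suc arg_cong[OF E, where f = "\<lambda>z. (\<Sum>n<N. (-1) ^ n * u ^ (2 * n) * (1 / h ^ (2 * n + 1))) + z"]]
    unfolding sum.lessThan_Suc add.assoc .
qed simp

context anger_curve
begin

text \<open>The tail of the geometric expansion after \<open>N\<close> terms, without its sign
  \<open>(-1) ^ N\<close>; for \<open>N = 0\<close> it is the full kernel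
  \<open>h / (h^2 + u^2)\<close>.\<close>

definition kernel :: "nat \<Rightarrow> real \<Rightarrow> real \<Rightarrow> real" where
  "kernel N u x = u ^ (2 * N) / height x ^ (2 * N) * (height x / (height x ^ 2 + u ^ 2))"

lemma kernel_le: "0 \<le> kernel N u x" "kernel N u x \<le> u ^ (2 * N) * (1 / height x ^ (2 * N + 1))" if "0 \<le> x" "0 \<le> u"
proof -
  have h: "0 < height x" using height_pos that by simp
  show "0 \<le> kernel N u x" using h that by (simp add: kernel_def)
  have "height x / (height x ^ 2 + u ^ 2) \<le> height x / height x ^ 2"
    using h by (intro divide_left_mono mult_pos_pos add_pos_nonneg) auto
  then have "kernel N u x \<le> u ^ (2 * N) / height x ^ (2 * N) * (height x / height x ^ 2)"
    unfolding kernel_def using h that by (intro mult_left_mono) auto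
  also have "\<dots> = u ^ (2 * N) * (1 / height x ^ (2 * N + 1))"
    using h by (simp add: power2_eq_square)
  finally show "kernel N u x \<le> u ^ (2 * N) * (1 / height x ^ (2 * N + 1))" .
qed

lemma kernel_measurable [measurable]: "(\<lambda>(u, x). kernel N u x) \<in> borel_measurable (half_line \<Otimes>\<^sub>M half_line)"
proof -
  have [measurable]: "(\<lambda>u. u) \<in> borel_measurable half_line" by (rule measurable_half_line) simp
  show ?thesis unfolding kernel_def by measurable
qed

lemma kernel_measurable2 [measurable]: "kernel N u \<in> borel_measurable half_line"
  unfolding kernel_def [abs_def] by measurable

lemma kernel_integrable': "integrable half_line (kernel N u)" if "0 \<le> u"
proof (rule Bochner_Integration.integrable_bound)
  show "integrable half_line (\<lambda>x. u ^ (2 * N) * (1 / height x ^ (2 * N + 1)))"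
    using inverse_height_integrable[of "2 * N"] by (intro integrable_mult_right) simp
  show "AE x in half_line. norm (kernel N u x) \<le> norm (u ^ (2 * N) * (1 / height x ^ (2 * N + 1)))"
  proof (rule AE_I2)
    fix x assume "x \<in> space half_line"
    then show "norm (kernel N u x) \<le> norm (u ^ (2 * N) * (1 / height x ^ (2 * N + 1)))"
      using kernel_le[of x u N] that unfolding real_norm_def space_half_line atLeast_iff by linarith
  qed
qed measurable

text \<open>By \<open>kernel_le\<close> the integrand is dominated by a product of a function of
  \<open>u\<close> and a function of \<open>x\<close>, both integrable. This justifies Fubini's
  theorem.\<close>

lemma Laplace_kernel_integrable:
  assumes "Re \<nu> > 0"
  shows "integrable (half_line \<Otimes>\<^sub>M half_line) (\<lambda>(u, x). exp (- (\<nu> * of_real u)) * of_real (kernel N u x))"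
proof (rule Bochner_Integration.integrable_bound)
  show "integrable (half_line \<Otimes>\<^sub>M half_line) (\<lambda>(u, x). (u ^ (2 * N) * exp (- (Re \<nu> * u))) * (1 / height x ^ (2 * N + 1)))"
    using inverse_height_integrable[of "2 * N"] by (intro half_line_integrable_product half_line_power_exp(1) assms) simp
  have [measurable]: "(\<lambda>u. exp (- (\<nu> * complex_of_real u))) \<in> borel_measurable half_line"
    by (intro measurable_half_line borel_measurable_continuous_onI continuous_intros)
  show "(\<lambda>(u, x). exp (- (\<nu> * of_real u)) * complex_of_real (kernel N u x)) \<in> borel_measurable (half_line \<Otimes>\<^sub>M half_line)"
    by measurable
  show "AE p in half_line \<Otimes>\<^sub>M half_line. norm (case p of (u, x) \<Rightarrow> exp (- (\<nu> * of_real u)) * complex_of_real (kernel N u x))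
     \<le> norm (case p of (u, x) \<Rightarrow> (u ^ (2 * N) * exp (- (Re \<nu> * u))) * (1 / height x ^ (2 * N + 1)))"
  proof (rule AE_I2, clarify)
    fix u x assume "(u, x) \<in> space (half_line \<Otimes>\<^sub>M half_line)"
    then have ux: "0 \<le> u" "0 \<le> x" by (auto simp: space_pair_measure)
    have "norm (exp (- (\<nu> * of_real u)) * complex_of_real (kernel N u x)) = exp (- (Re \<nu> * u)) * kernel N u x"
      using kernel_le(1)[OF ux(2,1)] by (simp add: norm_mult)
    also have "\<dots> \<le> exp (- (Re \<nu> * u)) * (u ^ (2 * N) * (1 / height x ^ (2 * N + 1)))"
      using kernel_le(2)[OF ux(2,1)] by (intro mult_left_mono) auto
    also have "\<dots> = (u ^ (2 * N) * exp (- (Re \<nu> * u))) * (1 / height x ^ (2 * N + 1))" by simp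
    also have "\<dots> \<le> norm \<dots>" unfolding real_norm_def by (rule abs_ge_self)
    finally show "norm (exp (- (\<nu> * of_real u)) * complex_of_real (kernel N u x)) \<le> norm ((u ^ (2 * N) * exp (- (Re \<nu> * u))) * (1 / height x ^ (2 * N + 1)))" .
  qed
qed

lemma Laplace_kernel:
  assumes "Re \<nu> > 0"
  shows "integrable half_line (\<lambda>u. exp (- (\<nu> * of_real u)) * of_real (\<integral>x. kernel N u x \<partial>half_line))"
    and "(\<integral>u. exp (- (\<nu> * of_real u)) * of_real (\<integral>x. kernel N u x \<partial>half_line) \<partial>half_line)
       = (\<integral>x. terminant (2 * N) (\<nu> * of_real (height x)) \<partial>half_line)"
proof -
  have eq: "(\<integral>x. exp (- (\<nu> * of_real u)) * complex_of_real (kernel N u x) \<partial>half_line)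
      = exp (- (\<nu> * of_real u)) * of_real (\<integral>x. kernel N u x \<partial>half_line)" for u
    by (simp only: integral_mult_right_zero integral_complex_of_real)
  show "integrable half_line (\<lambda>u. exp (- (\<nu> * of_real u)) * of_real (\<integral>x. kernel N u x \<partial>half_line))"
    using half_line_pair.integrable_fst'[OF Laplace_kernel_integrable[OF assms, of N]] by (simp add: eq)
  have "(\<integral>u. exp (- (\<nu> * of_real u)) * of_real (\<integral>x. kernel N u x \<partial>half_line) \<partial>half_line)
     = (\<integral>x. (\<integral>u. exp (- (\<nu> * of_real u)) * of_real (kernel N u x) \<partial>half_line) \<partial>half_line)"
    unfolding eq[symmetric] by (rule half_line_pair.Fubini_integral[OF Laplace_kernel_integrable[OF assms], symmetric])
  also have "\<dots> = (\<integral>x. terminant (2 * N) (\<nu> * of_real (height x)) \<partial>half_line)"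
    using terminant_scaled[OF height_pos assms] unfolding kernel_def
    by (intro Bochner_Integration.integral_cong) auto
  finally show "(\<integral>u. exp (- (\<nu> * of_real u)) * of_real (\<integral>x. kernel N u x \<partial>half_line) \<partial>half_line)
       = (\<integral>x. terminant (2 * N) (\<nu> * of_real (height x)) \<partial>half_line)" .
qed

text \<open>Integrating the geometric sum over \<open>x\<close> turns the powers of
  \<open>1 / height\<close> into moments, whose signs cancel those of the series.\<close>

lemma kernel_0_expansion:
  assumes "0 \<le> u"
  shows "(\<integral>x. kernel 0 u x \<partial>half_line) = (\<Sum>n<N. (pi / 2) * (- anger_coeff n \<beta>) * u ^ (2 * n)) + (-1) ^ N * (\<integral>x. kernel N u x \<partial>half_line)"
proof -
  have int: "integrable half_line (\<lambda>x. 1 / height x ^ (2 * n + 1))" for n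
    using inverse_height_integrable[of "2 * n"] by simp
  have "(\<integral>x. kernel 0 u x \<partial>half_line) = (\<integral>x. (\<Sum>n<N. (-1) ^ n * u ^ (2 * n) * (1 / height x ^ (2 * n + 1))) + (-1) ^ N * kernel N u x \<partial>half_line)"
  proof (rule Bochner_Integration.integral_cong[OF refl])
    fix x assume "x \<in> space half_line"
    then have h: "0 < height x" using height_pos by simp
    have "kernel 0 u x = height x / (height x ^ 2 + u ^ 2)" by (simp add: kernel_def)
    then show "kernel 0 u x = (\<Sum>n<N. (-1) ^ n * u ^ (2 * n) * (1 / height x ^ (2 * n + 1))) + (-1) ^ N * kernel N u x"
      using geometric_kernel[OF h, of u N] unfolding kernel_def by (rule trans)
  qed
  also have "\<dots> = (\<integral>x. (\<Sum>n<N. (-1) ^ n * u ^ (2 * n) * (1 / height x ^ (2 * n + 1))) \<partial>half_line) + (\<integral>x. (-1) ^ N * kernel N u x \<partial>half_line)"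
    by (intro Bochner_Integration.integral_add Bochner_Integration.integrable_sum integrable_mult_right int kernel_integrable' assms)
  also have "(\<integral>x. (\<Sum>n<N. (-1) ^ n * u ^ (2 * n) * (1 / height x ^ (2 * n + 1))) \<partial>half_line) = (\<Sum>n<N. \<integral>x. (-1) ^ n * u ^ (2 * n) * (1 / height x ^ (2 * n + 1)) \<partial>half_line)"
    by (intro Bochner_Integration.integral_sum integrable_mult_right int)
  also have "\<dots> = (\<Sum>n<N. (pi / 2) * (- anger_coeff n \<beta>) * u ^ (2 * n))"
  proof (rule sum.cong[OF refl])
    fix n
    have "((-1) ^ n :: real) * (-1) ^ n = 1" by (simp flip: power_mult_distrib)
    then have "(-1) ^ n * u ^ (2 * n) * ((-1) ^ n * (pi / 2) * (- anger_coeff n \<beta>)) = (pi / 2) * (- anger_coeff n \<beta>) * u ^ (2 * n)"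
    proof -
      assume sq: "((-1) ^ n :: real) * (-1) ^ n = 1"
      have "s * p * (s * q * r) = (s * s) * (q * r * p)" for s p q r :: real by (simp only: mult_ac)
      then show ?thesis unfolding sq by (simp only: sq mult_1)
    qed
    then show "(\<integral>x. (-1) ^ n * u ^ (2 * n) * (1 / height x ^ (2 * n + 1)) \<partial>half_line) = (pi / 2) * (- anger_coeff n \<beta>) * u ^ (2 * n)"
      unfolding integral_mult_right_zero moment_integral .
  qed
  finally show ?thesis by (simp only: integral_mult_right_zero)
qed

section \<open>The Anger-Weber function as a Laplace transform\<close>

lemma real_phase_image: "real_phase ` {0<..} = {0<..}"
proof (intro equalityI subsetI)
  fix u assume "u \<in> real_phase ` {0<..}"
  then show "u \<in> {0<..}" using real_phase_strict_mono[of 0] by auto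
next
  fix u :: real assume "u \<in> {0<..}"
  then have u: "0 < u" by simp
  \<comment> \<open>By \<open>sinh t > t\<close>, \<open>real_phase t\<close> is at least
    \<open>(sec \<beta> - 1) * t = u\<close>, so the intermediate value theorem applies on
    \<open>{0..t}\<close>.\<close>
  define t where "t = u / (sec \<beta> - 1)"
  have t: "0 < t" using u sec_gt_1 by (simp add: t_def)
  have "sec \<beta> * t \<le> sec \<beta> * sinh t" using sinh_gt[OF t] sec_gt_1 by simp
  moreover have "(sec \<beta> - 1) * t = u" using sec_gt_1 by (simp add: t_def)
  ultimately have "u \<le> real_phase t" by (simp add: real_phase_def algebra_simps)
  moreover have "continuous_on {0..t} real_phase" unfolding real_phase_def [abs_def] by (intro continuous_intros)
  ultimately obtain s where s: "0 \<le> s" "s \<le> t" "real_phase s = u"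
    using IVT'[of real_phase 0 u t] u t by auto
  then have "s \<noteq> 0" using u by auto
  with s show "u \<in> real_phase ` {0<..}" by (intro image_eqI[of _ _ s]) auto
qed

text \<open>Substitution \<open>u = real_phase t\<close>. By \<open>kernel_integral\<close> the
  auxiliary \<open>K\<close> is \<open>dt/du\<close>, that is, the reciprocal of the derivative of
  \<open>real_phase\<close>. The open half line is used because \<open>kernel_integral\<close> is
  available only for \<open>t > 0\<close>; the point 0 is negligible.\<close>

lemma anger_weber_Laplace:
  assumes "Re \<nu> > 0"
  shows "anger_weber (- \<nu>) (\<nu> * of_real (sec \<beta>)) =
    1 / of_real pi * (2 / of_real pi * (\<integral>u. exp (- (\<nu> * of_real u)) * of_real (\<integral>x. kernel 0 u x \<partial>half_line) \<partial>half_line))"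
proof -
  define K where "K u = 2 / pi * (\<integral>x. kernel 0 u x \<partial>half_line)" for u
  define k where "k u = exp (- (\<nu> * of_real u)) * complex_of_real (K u)" for u
  have K: "(sec \<beta> * cosh t - 1) * K (real_phase t) = 1" if t: "0 < t" for t
  proof -
    have "sec \<beta> * cosh t - 1 \<noteq> 0"
      using sec_gt_1 cosh_real_ge_1[of t] by (smt (verit) mult_le_cancel_left1)
    then show ?thesis using kernel_integral[OF t] by (simp add: K_def kernel_def)
  qed
  have "integrable half_line k"
    unfolding k_def K_def of_real_mult mult.left_commute[of "exp _"]
    by (intro integrable_mult_right Laplace_kernel assms)
  then have kint: "set_integrable lborel {0..} k" by (simp add: half_line_integrable_iff)
  have kabs: "k absolutely_integrable_on {0<..}"
  proof -
    have "k absolutely_integrable_on {0..}"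
      using kint unfolding set_integrable_def
      by (metis integrable_completion borel_measurable_integrable)
    then show ?thesis by (rule set_integrable_subset) auto
  qed
  have spike: "integral {0..} g = integral {0<..} g" for g :: "real \<Rightarrow> complex"
    by (rule integral_spike_set; rule negligible_subset[of "{0}"]) auto
  have "integral {0<..} (\<lambda>t. \<bar>sec \<beta> * cosh t - 1\<bar> *\<^sub>R k (real_phase t)) = integral {0<..} k"
  proof -
    have "(\<lambda>t. \<bar>sec \<beta> * cosh t - 1\<bar> *\<^sub>R k (real_phase t)) absolutely_integrable_on {0<..} \<and>
       integral {0<..} (\<lambda>t. \<bar>sec \<beta> * cosh t - 1\<bar> *\<^sub>R k (real_phase t)) = integral {0<..} k \<longleftrightarrow>
       k absolutely_integrable_on real_phase ` {0<..} \<and> integral (real_phase ` {0<..}) k = integral {0<..} k"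
    \<comment> \<open>The substitution rule is an equivalence and is read from the side of
      \<open>u\<close>, where Fubini's theorem has already supplied integrability.\<close>
    proof (rule has_absolute_integral_change_of_variables_real)
      show "(real_phase has_field_derivative sec \<beta> * cosh t - 1) (at t within {0<..})" for t
        unfolding real_phase_def [abs_def] by (auto intro!: derivative_eq_intros)
      show "inj_on real_phase {0<..}" using real_phase_eq_iff by (auto simp: inj_on_def)
    qed auto
    then show ?thesis using kabs by (simp add: real_phase_image)
  qed
  moreover have "integral {0<..} (\<lambda>t. \<bar>sec \<beta> * cosh t - 1\<bar> *\<^sub>R k (real_phase t)) = integral {0<..} (\<lambda>t. exp (- (\<nu> * of_real (real_phase t))))"
  proof (rule integral_cong)
    fix t :: real assume "t \<in> {0<..}"
    then have t: "0 < t" by simp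
    have "0 \<le> sec \<beta> * cosh t - 1"
      using sec_gt_1 cosh_real_ge_1[of t] by (smt (verit) mult_le_cancel_left1)
    then have "\<bar>sec \<beta> * cosh t - 1\<bar> *\<^sub>R k (real_phase t) = exp (- (\<nu> * of_real (real_phase t))) * of_real ((sec \<beta> * cosh t - 1) * K (real_phase t))"
      by (simp add: k_def scaleR_conv_of_real)
    then show "\<bar>sec \<beta> * cosh t - 1\<bar> *\<^sub>R k (real_phase t) = exp (- (\<nu> * of_real (real_phase t)))"
      by (simp only: K[OF t]) simp
  qed
  moreover have "integral {0<..} k = (\<integral>u. k u \<partial>half_line)"
    using set_borel_integral_eq_integral(2)[OF kint] by (simp add: half_line_integral_eq spike)
  moreover have "anger_weber (- \<nu>) (\<nu> * of_real (sec \<beta>)) = 1 / of_real pi * integral {0<..} (\<lambda>t. exp (- (\<nu> * of_real (real_phase t))))"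
    by (simp add: anger_weber_def spike real_phase_def algebra_simps)
  ultimately show ?thesis
    by (simp add: k_def K_def mult.left_commute[of "exp _"])
qed

text \<open>Each power of \<open>u\<close> in the expansion of the kernel has the Laplace transform
  \<open>(2n)! / \<nu>^(2n+1)\<close>, and the tail has the integrated terminant. The constant
  \<open>2 / pi^2\<close> combines the prefactor \<open>1 / pi\<close> with the
  \<open>2 / pi\<close> from \<open>dt/du\<close>.\<close>

lemma anger_weber_expansion:
  assumes "Re \<nu> > 0"
  shows "anger_weber (- \<nu>) (\<nu> * of_real (sec \<beta>)) =
    - (1 / of_real pi) * (\<Sum>n<N. fact (2 * n) * of_real (anger_coeff n \<beta>) / \<nu> ^ (2 * n + 1))
    + of_real (2 / pi\<^sup>2 * (-1) ^ N) * (\<integral>x. terminant (2 * N) (\<nu> * of_real (height x)) \<partial>half_line)"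
proof -
  let ?T = "\<integral>x. terminant (2 * N) (\<nu> * of_real (height x)) \<partial>half_line"
  let ?e = "\<lambda>u. exp (- (\<nu> * complex_of_real u))"
  have "(\<integral>u. ?e u * of_real (\<integral>x. kernel 0 u x \<partial>half_line) \<partial>half_line) =
     (\<integral>u. (\<Sum>n<N. of_real ((pi / 2) * (- anger_coeff n \<beta>)) * (?e u * of_real u ^ (2 * n))) + (-1) ^ N * (?e u * of_real (\<integral>x. kernel N u x \<partial>half_line)) \<partial>half_line)"
  proof (rule Bochner_Integration.integral_cong[OF refl])
    fix u :: real assume "u \<in> space half_line"
    then have u: "0 \<le> u" by simp
    show "?e u * of_real (\<integral>x. kernel 0 u x \<partial>half_line) =
      (\<Sum>n<N. of_real ((pi / 2) * (- anger_coeff n \<beta>)) * (?e u * of_real u ^ (2 * n))) + (-1) ^ N * (?e u * of_real (\<integral>x. kernel N u x \<partial>half_line))"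
      unfolding kernel_0_expansion[OF u, of N]
      by (simp only: of_real_add of_real_sum of_real_mult of_real_power of_real_minus of_real_1 distrib_left sum_distrib_left mult.left_commute[of "exp _"])
  qed
  also have "\<dots> = (\<integral>u. (\<Sum>n<N. of_real ((pi / 2) * (- anger_coeff n \<beta>)) * (?e u * of_real u ^ (2 * n))) \<partial>half_line)
     + (\<integral>u. (-1) ^ N * (?e u * of_real (\<integral>x. kernel N u x \<partial>half_line)) \<partial>half_line)"
    by (intro Bochner_Integration.integral_add Bochner_Integration.integrable_sum integrable_mult_right half_line_power_exp_complex(1) Laplace_kernel(1) assms)
  also have "(\<integral>u. (\<Sum>n<N. of_real ((pi / 2) * (- anger_coeff n \<beta>)) * (?e u * of_real u ^ (2 * n))) \<partial>half_line)
      = (\<Sum>n<N. \<integral>u. of_real ((pi / 2) * (- anger_coeff n \<beta>)) * (?e u * of_real u ^ (2 * n)) \<partial>half_line)"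
    by (intro Bochner_Integration.integral_sum integrable_mult_right half_line_power_exp_complex(1) assms)
  also have "\<dots> = (\<Sum>n<N. of_real ((pi / 2) * (- anger_coeff n \<beta>)) * (fact (2 * n) / \<nu> ^ (2 * n + 1)))"
    by (simp only: integral_mult_right_zero half_line_power_exp_complex(2)[OF assms] Suc_eq_plus1)
  also have "(\<integral>u. (-1) ^ N * (?e u * of_real (\<integral>x. kernel N u x \<partial>half_line)) \<partial>half_line) = (-1) ^ N * ?T"
    by (simp only: integral_mult_right_zero Laplace_kernel(2)[OF assms])
  finally have "anger_weber (- \<nu>) (\<nu> * of_real (sec \<beta>)) = 1 / of_real pi * (2 / of_real pi *
     ((\<Sum>n<N. of_real ((pi / 2) * (- anger_coeff n \<beta>)) * (fact (2 * n) / \<nu> ^ (2 * n + 1))) + (-1) ^ N * ?T))"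
    by (simp only: anger_weber_Laplace[OF assms])
  also have "\<dots> = 1 / of_real pi * (2 / of_real pi * (\<Sum>n<N. of_real ((pi / 2) * (- anger_coeff n \<beta>)) * (fact (2 * n) / \<nu> ^ (2 * n + 1))))
      + of_real (2 / pi\<^sup>2 * (-1) ^ N) * ?T"
    by (simp add: distrib_left power2_eq_square)
  also have "2 / of_real pi * (\<Sum>n<N. of_real ((pi / 2) * (- anger_coeff n \<beta>)) * (fact (2 * n) / \<nu> ^ (2 * n + 1)))
      = (\<Sum>n<N. - (fact (2 * n) * of_real (anger_coeff n \<beta>) / \<nu> ^ (2 * n + 1)))"
    unfolding sum_distrib_left by (rule sum.cong) auto
  finally show ?thesis by (simp add: sum_negf)
qed

end

section \<open>Continuation and bounds\<close>

text \<open>The squared norm equals \<open>(\<rho> + cos \<psi>)^2 + sin^2 \<psi>\<close>, so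
  \<open>\<bar>sin \<psi>\<bar>\<close> is the distance of \<open>-1\<close> from the line through
  the ray. If the ray points to the right, the real part is already at least 1.\<close>

lemma norm_one_plus_cis_ge:
  assumes "0 \<le> \<rho>"
  shows "\<bar>sin \<psi>\<bar> \<le> norm (1 + of_real \<rho> * cis \<psi>)"
    and "0 \<le> cos \<psi> \<Longrightarrow> 1 \<le> norm (1 + of_real \<rho> * cis \<psi>)"
proof -
  have n: "(norm (1 + of_real \<rho> * cis \<psi>))\<^sup>2 = (1 + \<rho> * cos \<psi>)\<^sup>2 + (\<rho> * sin \<psi>)\<^sup>2"
    by (simp add: cmod_power2)
  have "(norm (1 + of_real \<rho> * cis \<psi>))\<^sup>2 = (\<rho> + cos \<psi>)\<^sup>2 + (sin \<psi>)\<^sup>2"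
  proof -
    have "(\<rho> * sin \<psi>)\<^sup>2 = \<rho>\<^sup>2 * (1 - (cos \<psi>)\<^sup>2)" by (simp add: power_mult_distrib sin_squared_eq)
    then show ?thesis unfolding n sin_squared_eq[of \<psi>] by (simp add: power2_eq_square algebra_simps)
  qed
  then have "\<bar>sin \<psi>\<bar>\<^sup>2 \<le> (norm (1 + of_real \<rho> * cis \<psi>))\<^sup>2" by simp
  then show "\<bar>sin \<psi>\<bar> \<le> norm (1 + of_real \<rho> * cis \<psi>)" by (rule power2_le_imp_le) simp
  assume "0 \<le> cos \<psi>"
  then have "1\<^sup>2 \<le> (1 + \<rho> * cos \<psi>)\<^sup>2" using assms by (intro power_mono) auto
  then have "1\<^sup>2 \<le> (norm (1 + of_real \<rho> * cis \<psi>))\<^sup>2" using zero_le_power2[of "\<rho> * sin \<psi>"] unfolding n by linarith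
  then show "1 \<le> norm (1 + of_real \<rho> * cis \<psi>)" by (rule power2_le_imp_le) simp
qed

lemma cis_divide_polar:
  assumes "\<nu> \<noteq> 0"
  shows "cis \<phi> * of_real y / \<nu> = of_real (y / norm \<nu>) * cis (\<phi> - Arg \<nu>)"
proof -
  have "\<nu> = of_real (norm \<nu>) * cis (Arg \<nu>)"
    using assms by (metis cis_Arg complex_sgn_def mult.commute nonzero_divide_eq_eq of_real_eq_0_iff norm_eq_zero sgn_eq scaleR_conv_of_real divide_inverse)
  then have "cis \<phi> * of_real y / \<nu> = cis \<phi> * of_real y / (of_real (norm \<nu>) * cis (Arg \<nu>))" by simp
  also have "\<dots> = of_real (y / norm \<nu>) * (cis \<phi> / cis (Arg \<nu>))" by simp
  finally show ?thesis by (simp add: cis_divide)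
qed

lemma one_plus_square_polar:
  assumes "\<nu> \<noteq> 0"
  shows "1 + (cis \<phi> * of_real y / \<nu>)\<^sup>2 = 1 + of_real ((y / norm \<nu>)\<^sup>2) * cis (2 * (\<phi> - Arg \<nu>))"
  unfolding cis_divide_polar[OF assms] power_mult_distrib by (simp only: Complex.DeMoivre of_real_power of_nat_numeral)

text \<open>The angle minimises \<open>1 / (sin (2 \<phi>) cos\<^sup>p \<phi>)\<close> for \<open>p = 2 N + 1\<close>.\<close>

lemma optimal_angle_bound:
  fixes N :: nat
  defines "\<phi> \<equiv> arctan (1 / sqrt (2 * real N + 2))"
  shows "0 < \<phi>" "\<phi> < pi / 4" "1 / (sin (2 * \<phi>) * cos \<phi> ^ (2 * N + 1)) \<le> sqrt (exp 1 / 2 * (real N + 3 / 2))"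
proof -
  define M where "M = 2 * real N + 2"
  have M: "M \<ge> 2" by (simp add: M_def)
  define x where "x = 1 / sqrt M"
  have phi: "\<phi> = arctan x" by (simp add: \<phi>_def x_def M_def)
  have x2: "x\<^sup>2 = 1 / M" using M by (simp add: x_def power_divide)
  have x: "0 < x" "x < 1" using M by (auto simp: x_def)
  show "0 < \<phi>" using x by (simp add: phi)
  show "\<phi> < pi / 4" using x arctan_less_iff[of x 1] by (simp add: phi arctan_one)
  have c2: "(cos \<phi>)\<^sup>2 = M / (M + 1)"
  proof -
    have "(cos \<phi>)\<^sup>2 = 1 / (1 + x\<^sup>2)" by (simp add: phi cos_arctan power_divide)
    also have "1 + x\<^sup>2 = (M + 1) / M" unfolding x2 using M by (simp add: field_simps)
    finally show ?thesis by simp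
  qed
  have s2: "(sin \<phi>)\<^sup>2 = 1 / (M + 1)"
    unfolding sin_squared_eq c2 using M by (simp add: field_simps)
  have pos: "0 < cos \<phi>" "0 < sin \<phi>"
    using x by (auto simp: phi cos_arctan sin_arctan add_pos_nonneg)
  define Q where "Q = sin (2 * \<phi>) * cos \<phi> ^ (2 * N + 1)"
  have Q: "Q = 2 * sin \<phi> * ((cos \<phi>)\<^sup>2) ^ (N + 1)"
    by (simp add: Q_def sin_double flip: power_mult) (simp add: power_add mult_ac power2_eq_square)
  have Qpos: "0 < Q" using pos by (simp add: Q)
  have Q2: "Q\<^sup>2 = 4 / (M + 1) * (M / (M + 1)) ^ (2 * N + 2)"
  proof -
    have "(N + 1) * 2 = 2 * N + 2" by simp
    then have pw: "(p ^ (N + 1))\<^sup>2 = p ^ (2 * N + 2)" for p :: real by (simp only: power_mult[symmetric])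
    show ?thesis unfolding Q power_mult_distrib s2 c2 pw by simp
  qed
  \<comment> \<open>The exponent equals \<open>M\<close>, so this is
    \<open>(1 + 1/M)^M \<le> e\<close>; it is the origin of \<open>e\<close> in (c). The factor
    \<open>(M + 1) / 4\<close> is \<open>(N + 3/2) / 2\<close>.\<close>
  have "((M + 1) / M) ^ (2 * N + 2) \<le> exp (1 / M) ^ (2 * N + 2)"
    using M exp_ge_add_one_self[of "1 / M"] by (intro power_mono) (auto simp: field_simps)
  also have "\<dots> = exp (real (2 * N + 2) * (1 / M))" by (simp only: exp_of_nat_mult)
  also have "\<dots> = exp 1" using M by (simp add: M_def)
  finally have e: "((M + 1) / M) ^ (2 * N + 2) \<le> exp 1" .
  have "(1 / Q)\<^sup>2 = (M + 1) / 4 * ((M + 1) / M) ^ (2 * N + 2)"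
    unfolding power_divide Q2 using M by (simp add: power_divide)
  also have "\<dots> \<le> (M + 1) / 4 * exp 1" using e M by (intro mult_left_mono) auto
  also have "\<dots> = exp 1 / 2 * (real N + 3 / 2)" by (simp add: M_def field_simps)
  finally show "1 / (sin (2 * \<phi>) * cos \<phi> ^ (2 * N + 1)) \<le> sqrt (exp 1 / 2 * (real N + 3 / 2))"
    unfolding Q_def[symmetric] by (rule real_le_rsqrt)
qed

text \<open>For real \<open>w\<close> the integrand is positive, and
  \<open>1 / (1 + x^2) < 1\<close> off 0 compares it strictly with Euler's integral. This is the
  source of \<open>\<Theta>\<close>.\<close>

lemma terminant_of_real:
  assumes w: "w > 0"
  obtains \<tau> where "terminant k (of_real w) = of_real \<tau>" "0 < \<tau>" "\<tau> < fact k / w ^ Suc k"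
proof -
  define f where "f x = exp (- (w * x)) * (x ^ k / (1 + x\<^sup>2))" for x :: real
  have meas: "f \<in> borel_measurable half_line"
  proof -
    have "1 + x\<^sup>2 \<noteq> 0" for x :: real using zero_le_power2[of x] by linarith
    then show ?thesis unfolding f_def [abs_def]
      by (intro measurable_half_line_continuous continuous_intros) auto
  qed
  have pe: "integrable half_line (\<lambda>x. x ^ k * exp (- (w * x)))" by (rule half_line_power_exp(1)[OF w])
  have f_less: "f x < x ^ k * exp (- (w * x))" "0 < f x" if "0 < x" for x
  proof -
    have "x ^ k / (1 + x\<^sup>2) < x ^ k / 1" using that by (intro divide_strict_left_mono) (auto simp: add_pos_pos)
    then have "exp (- (w * x)) * (x ^ k / (1 + x\<^sup>2)) < exp (- (w * x)) * (x ^ k / 1)"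
      by (intro mult_strict_left_mono) auto
    then show "f x < x ^ k * exp (- (w * x))" by (simp add: f_def mult.commute)
    show "0 < f x" using that by (simp add: f_def add_pos_pos)
  qed
  have int: "integrable half_line f"
  proof (rule Bochner_Integration.integrable_bound[OF pe meas AE_I2])
    fix x assume "x \<in> space half_line"
    then consider "x = 0" | "0 < x" by force
    then show "norm (f x) \<le> norm (x ^ k * exp (- (w * x)))"
    proof cases
      case 1 then show ?thesis by (simp add: f_def)
    next
      case 2 then show ?thesis using f_less[OF 2] unfolding real_norm_def by linarith
    qed
  qed
  show ?thesis
  proof (rule that[of "\<integral>x. f x \<partial>half_line"])
    have "(\<integral>x. complex_of_real (f x) \<partial>half_line) = terminant k (of_real w)"
      unfolding terminant_def f_def by (intro Bochner_Integration.integral_cong) (auto simp flip: exp_of_real)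
    then show "terminant k (of_real w) = of_real (\<integral>x. f x \<partial>half_line)"
      by (simp only: integral_complex_of_real)
    show "0 < (\<integral>x. f x \<partial>half_line)" by (rule half_line_integral_pos[OF int f_less(2)])
    have "0 < (\<integral>x. x ^ k * exp (- (w * x)) - f x \<partial>half_line)"
      using f_less(1) by (intro half_line_integral_pos Bochner_Integration.integrable_diff pe int) simp
    then show "(\<integral>x. f x \<partial>half_line) < fact k / w ^ Suc k"
      unfolding Bochner_Integration.integral_diff[OF pe int] half_line_power_exp(2)[OF w] by simp
  qed
qed

section \<open>The remainder on turned rays, its continuation and its bounds\<close>

context anger_curve
begin

text \<open>The remainder formula with every terminant taken along a turned ray. The direction
  \<open>c\<close> is kept as a parameter because it serves both to continue the remainder and to
  optimise its bounds.\<close>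

definition rot_remainder :: "nat \<Rightarrow> complex \<Rightarrow> complex \<Rightarrow> complex" where
  "rot_remainder N c \<nu> = of_real (2 / pi\<^sup>2 * (-1) ^ N) *
     (\<integral>x. rot_terminant (2 * N) c (\<nu> * of_real (height x)) \<partial>half_line)"

lemma Re_divide_height: "0 < Re (c / (\<nu> * of_real (height x)))" if "0 < Re (c / \<nu>)" "0 \<le> x"
proof -
  have "Re (c / (\<nu> * of_real (height x))) = Re (c / \<nu>) / height x"
    by (metis Re_divide_of_real divide_divide_eq_left)
  then show ?thesis using that height_pos by simp
qed

text \<open>Replacing \<open>\<nu>\<close> by \<open>\<nu> * height x\<close> only rescales
  \<open>y\<close>, so a lower bound \<open>m\<close> found for \<open>\<nu>\<close> serves every
  \<open>x\<close>, and \<open>x\<close> enters through a power of \<open>1 / height x\<close>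
  alone.\<close>

lemma norm_rot_terminant_height_le:
  assumes "Re c > 0" "m > 0" "\<And>y. y \<ge> 0 \<Longrightarrow> m \<le> norm (1 + (c * of_real y / \<nu>)\<^sup>2)" "Re (c / \<nu>) > 0" "0 \<le> x"
  shows "norm (rot_terminant k c (\<nu> * of_real (height x)))
    \<le> (norm c / norm \<nu>) ^ Suc k * (fact k / (m * Re c ^ Suc k)) * (1 / height x ^ Suc k)"
proof -
  have h: "0 < height x" using height_pos assms by simp
  have "norm (rot_terminant k c (\<nu> * of_real (height x)))
    \<le> (norm c / norm (\<nu> * of_real (height x))) ^ Suc k * (fact k / (m * Re c ^ Suc k))"
  proof (rule norm_rot_terminant_le[OF assms(1,2)])
    fix y :: real assume "0 \<le> y"
    then show "m \<le> norm (1 + (c * of_real y / (\<nu> * of_real (height x)))\<^sup>2)"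
      using assms(3)[of "y / height x"] h by (simp add: mult.commute)
  qed (use Re_divide_height assms in simp)
  also have "\<dots> = (norm c / norm \<nu>) ^ Suc k * (fact k / (m * Re c ^ Suc k)) * (1 / height x ^ Suc k)"
    using h by (simp add: norm_mult power_divide power_mult_distrib)
  finally show ?thesis .
qed

lemma rot_terminant_height_measurable:
  assumes "Re c > 0" "Re (c / \<nu>) > 0"
  shows "(\<lambda>x. rot_terminant k c (\<nu> * of_real (height x))) \<in> borel_measurable half_line"
proof (intro measurable_half_line_continuous)
  show "continuous_on {0..} (\<lambda>x. rot_terminant k c (\<nu> * of_real (height x)))"
  proof (rule continuous_on_compose2[OF holomorphic_on_imp_continuous_on[OF rot_terminant_holomorphic[OF assms(1)]]])
    show "continuous_on {0..} (\<lambda>x. \<nu> * of_real (height x))"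
      by (intro continuous_intros continuous_height)
    show "(\<lambda>x. \<nu> * of_real (height x)) ` {0..} \<subseteq> {w. 0 < Re (c / w)}"
      by (rule image_subsetI) (unfold mem_Collect_eq atLeast_iff, rule Re_divide_height[OF assms(2)])
  qed
qed

text \<open>The majorant factors into \<open>B \<nu>\<close> and an integrable function of
  \<open>x\<close>. As \<open>B\<close> is continuous, it is bounded on closed discs, which gives
  locally uniform domination.\<close>

lemma rot_remainder_holomorphic:
  assumes c: "Re c > 0"
  shows "rot_remainder N c holomorphic_on {\<nu>. 0 < Re (c / \<nu>)}"
proof -
  let ?S = "{\<nu>. 0 < Re (c / \<nu>)}"
  let ?k = "2 * N"
  define B where "B \<nu> = (norm c / norm \<nu>) ^ Suc ?k * (fact ?k / ((Re (c / \<nu>) / norm (c / \<nu>))\<^sup>2 * Re c ^ Suc ?k))" for \<nu>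
  have nz: "\<nu> \<noteq> 0" "c / \<nu> \<noteq> 0" "Re (c / \<nu>) \<noteq> 0" "c \<noteq> 0" if "\<nu> \<in> ?S" for \<nu>
  proof -
    show "Re (c / \<nu>) \<noteq> 0" using that by simp
    then show "c / \<nu> \<noteq> 0" by (metis zero_complex.sel(1))
    then show "\<nu> \<noteq> 0" "c \<noteq> 0" by auto
  qed
  have contB: "continuous_on ?S B"
    unfolding B_def [abs_def] using c
    by (intro continuous_intros) (auto dest: nz simp del: Re_divide)
  have le: "norm (rot_terminant ?k c (\<nu> * of_real (height x))) \<le> B \<nu> * (1 / height x ^ Suc ?k)"
    if "\<nu> \<in> ?S" "0 \<le> x" for \<nu> x
    unfolding B_def
  proof (rule norm_rot_terminant_height_le[OF c _ _ _ that(2)])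
    show "0 < (Re (c / \<nu>) / norm (c / \<nu>))\<^sup>2"
      using nz[OF that(1)] by (simp only: zero_less_power2 divide_eq_0_iff norm_eq_zero) simp
    show "(Re (c / \<nu>) / norm (c / \<nu>))\<^sup>2 \<le> norm (1 + (c * of_real y / \<nu>)\<^sup>2)" for y
      using norm_one_plus_square_ge[OF nz(2)[OF that(1)], of y] by simp
  qed (use that in simp)
  have "(\<lambda>\<nu>. \<integral>x. rot_terminant ?k c (\<nu> * of_real (height x)) \<partial>half_line) holomorphic_on ?S"
  proof (rule parametric_integral_holomorphic)
    show "(\<lambda>\<nu>. rot_terminant ?k c (\<nu> * of_real (height x))) holomorphic_on ?S" if "x \<in> space half_line" for x
    proof -
      have "(rot_terminant ?k c \<circ> (\<lambda>\<nu>. \<nu> * of_real (height x))) holomorphic_on ?S"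
      proof (rule holomorphic_on_compose_gen[OF _ rot_terminant_holomorphic[OF c]])
        show "(\<lambda>\<nu>. \<nu> * of_real (height x)) ` ?S \<subseteq> ?S"
        proof (rule image_subsetI)
          fix \<nu> assume "\<nu> \<in> ?S"
          then have "0 < Re (c / \<nu>)" "0 \<le> x" using that by simp_all
          then show "\<nu> * of_real (height x) \<in> ?S" unfolding mem_Collect_eq by (rule Re_divide_height)
        qed
      qed (intro holomorphic_intros)
      then show ?thesis unfolding o_def .
    qed
    show "(\<lambda>x. rot_terminant ?k c (\<nu> * of_real (height x))) \<in> borel_measurable half_line" if "\<nu> \<in> ?S" for \<nu>
      using that by (intro rot_terminant_height_measurable c) simp
    fix z assume "z \<in> ?S"
    then obtain r where r: "r > 0" "cball z r \<subseteq> ?S"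
      using open_sector[of c, unfolded open_contains_cball, THEN bspec] by blast
    have "\<exists>v\<in>cball z r. \<forall>w\<in>cball z r. B w \<le> B v"
    proof (rule continuous_attains_sup)
      show "cball z r \<noteq> {}" "compact (cball z r)" using r(1) by simp_all
      show "continuous_on (cball z r) B" by (rule continuous_on_subset[OF contB r(2)])
    qed
    then obtain v where v: "\<And>w. w \<in> cball z r \<Longrightarrow> B w \<le> B v" by blast
    show "\<exists>r>0. \<exists>g. cball z r \<subseteq> ?S \<and> integrable half_line g \<and>
       (\<forall>w\<in>cball z r. \<forall>x\<in>space half_line. norm (rot_terminant ?k c (w * of_real (height x))) \<le> g x)"
    proof (intro exI conjI ballI)
      show "integrable half_line (\<lambda>x. B v * (1 / height x ^ Suc ?k))"
        by (intro integrable_mult_right inverse_height_integrable)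
      fix w x assume w: "w \<in> cball z r" and x: "x \<in> space half_line"
      have "norm (rot_terminant ?k c (w * of_real (height x))) \<le> B w * (1 / height x ^ Suc ?k)"
        using x by (intro le subsetD[OF r(2) w]) simp
      also have "\<dots> \<le> B v * (1 / height x ^ Suc ?k)"
        using x height_pos[of x] by (intro mult_right_mono v[OF w]) simp
      finally show "norm (rot_terminant ?k c (w * of_real (height x))) \<le> B v * (1 / height x ^ Suc ?k)" .
    qed (rule r)+
  qed
  then show ?thesis unfolding rot_remainder_def [abs_def] by (intro holomorphic_on_mult holomorphic_on_const)
qed

text \<open>Positivity of the integrand fixes the sign of the coefficient; the moment is thus
  exactly a multiple of its absolute value.\<close>

lemma abs_moment_integral:
  "(\<integral>x. 1 / height x ^ (2 * N + 1) \<partial>half_line) = pi / 2 * \<bar>anger_coeff N \<beta>\<bar>"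
proof -
  have "0 \<le> (\<integral>x. 1 / height x ^ (2 * N + 1) \<partial>half_line)"
    by (intro Bochner_Integration.integral_nonneg divide_nonneg_nonneg zero_le_power less_imp_le[OF height_pos]) auto
  then have "(\<integral>x. 1 / height x ^ (2 * N + 1) \<partial>half_line) = \<bar>\<integral>x. 1 / height x ^ (2 * N + 1) \<partial>half_line\<bar>" by simp
  also have "\<dots> = pi / 2 * \<bar>anger_coeff N \<beta>\<bar>"
    unfolding moment_integral by (simp add: abs_mult power_abs)
  finally show ?thesis .
qed

text \<open>The last factor is the whole loss compared with the first omitted term of the expansion.
  The proofs of (a) and (c) choose \<open>c\<close> and \<open>m\<close> in it.\<close>

lemma norm_rot_remainder_le:
  assumes "Re c > 0" "norm c = 1" "m > 0" "\<And>y. y \<ge> 0 \<Longrightarrow> m \<le> norm (1 + (c * of_real y / \<nu>)\<^sup>2)" "Re (c / \<nu>) > 0"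
  shows "norm (rot_remainder N c \<nu>)
     \<le> 1 / pi * (fact (2 * N) * \<bar>anger_coeff N \<beta>\<bar> / norm \<nu> ^ (2 * N + 1)) * (1 / (m * Re c ^ (2 * N + 1)))"
proof -
  let ?C = "(norm c / norm \<nu>) ^ Suc (2 * N) * (fact (2 * N) / (m * Re c ^ Suc (2 * N)))"
  have le: "norm (rot_terminant (2 * N) c (\<nu> * of_real (height x))) \<le> ?C * (1 / height x ^ Suc (2 * N))"
    if "0 \<le> x" for x
    by (rule norm_rot_terminant_height_le[OF assms(1,3,4,5) that])
  have int: "integrable half_line (\<lambda>x. ?C * (1 / height x ^ Suc (2 * N)))"
    by (intro integrable_mult_right inverse_height_integrable)
  have "norm (\<integral>x. rot_terminant (2 * N) c (\<nu> * of_real (height x)) \<partial>half_line)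
      \<le> (\<integral>x. ?C * (1 / height x ^ Suc (2 * N)) \<partial>half_line)"
  proof (rule Bochner_Integration.integral_norm_bound_integral[OF _ int])
    show "integrable half_line (\<lambda>x. rot_terminant (2 * N) c (\<nu> * of_real (height x)))"
    proof (rule Bochner_Integration.integrable_bound[OF int rot_terminant_height_measurable[OF assms(1,5)] AE_I2])
      fix x assume "x \<in> space half_line"
      then show "norm (rot_terminant (2 * N) c (\<nu> * of_real (height x))) \<le> norm (?C * (1 / height x ^ Suc (2 * N)))"
        unfolding real_norm_def by (intro order_trans[OF le abs_ge_self]) simp
    qed
  qed (use le in simp)
  also have "\<dots> = ?C * (pi / 2 * \<bar>anger_coeff N \<beta>\<bar>)"
    using abs_moment_integral[of N] by (simp only: integral_mult_right_zero Suc_eq_plus1)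
  finally have "norm (rot_remainder N c \<nu>) \<le> 2 / pi\<^sup>2 * (?C * (pi / 2 * \<bar>anger_coeff N \<beta>\<bar>))"
    unfolding rot_remainder_def norm_mult norm_of_real by (intro mult_mono) (auto simp: abs_mult power_abs)
  also have "\<dots> = 1 / pi * (fact (2 * N) * \<bar>anger_coeff N \<beta>\<bar> / norm \<nu> ^ (2 * N + 1)) * (1 / (m * Re c ^ (2 * N + 1)))"
    by (simp add: assms(2) power2_eq_square power_divide)
  finally show ?thesis .
qed

lemma rot_remainder_eq:
  assumes "norm c = 1" "Re c > 0" "Re \<nu> > 0" "Re (c / \<nu>) > 0"
  shows "rot_remainder N c \<nu> = of_real (2 / pi\<^sup>2 * (-1) ^ N) * (\<integral>x. terminant (2 * N) (\<nu> * of_real (height x)) \<partial>half_line)"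
  unfolding rot_remainder_def
  by (intro arg_cong2[where f = "(*)"] refl Bochner_Integration.integral_cong rot_terminant_eq assms Re_divide_height)
    (use assms height_pos in auto)

text \<open>Needed to give content to the choice operator in \<open>anger_remainder\<close>. The
  direction \<open>cis (pi / 4)\<close> gives a function holomorphic for arguments between
  \<open>- pi / 4\<close> and \<open>3 * pi / 4\<close>, hence across the positive imaginary axis;
  its conjugate does the same below. Both agree with the unturned formula in the right
  half-plane.\<close>

lemma ex_anger_remainder: "\<exists>R. is_anger_remainder N \<beta> R"
proof -
  define c where "c = cis (pi / 4)"
  define R where "R \<nu> = (if 0 < Re \<nu> then rot_remainder N 1 \<nu> else if 0 < Im \<nu> then rot_remainder N c \<nu> else rot_remainder N (cnj c) \<nu>)" for \<nu>
  have c: "norm c = 1" "norm (cnj c) = 1" "0 < Re c" "0 < Re (cnj c)" "Im c = Re c"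
    by (auto simp: c_def cos_45 sin_45)
  have S1: "{\<nu>. 0 < Re (1 / \<nu>)} = {\<nu>. 0 < Re \<nu>}"
    by (auto simp: Re_divide zero_less_divide_iff cmod_power2[symmetric] simp flip: cmod_power2) 
  have eq: "rot_remainder N d \<nu> = rot_remainder N 1 \<nu>" if "norm d = 1" "0 < Re d" "0 < Re \<nu>" "0 < Re (d / \<nu>)" for d \<nu>
    
  proof -
    have "0 < Re (1 / \<nu>)" using that(3) S1 by blast
    then show ?thesis
      using rot_remainder_eq[of 1 \<nu>] that(3) unfolding rot_remainder_eq[OF that] by simp
  qed
  have "R analytic_on {\<nu>. \<nu> \<noteq> 0 \<and> \<bar>Arg \<nu>\<bar> \<le> pi / 2}"
    unfolding analytic_on_holomorphic
  proof (intro exI conjI)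
    let ?U0 = "{\<nu>. 0 < Re \<nu>}"
    \<comment> \<open>Cutting with the upper and the lower half-plane makes \<open>?U1\<close> and
      \<open>?U2\<close> disjoint, so each turned piece has to match only the unturned one.\<close>
    let ?U1 = "{\<nu>. 0 < Re (c / \<nu>)} \<inter> {\<nu>. 0 < Im \<nu>}"
    let ?U2 = "{\<nu>. 0 < Re (cnj c / \<nu>)} \<inter> {\<nu>. Im \<nu> < 0}"
    have op: "open ?U0" "open ?U1" "open ?U2"
      by (auto intro!: open_Int open_sector simp: open_halfspace_Re_gt open_halfspace_Im_gt open_halfspace_Im_lt)
    then show "open (?U0 \<union> (?U1 \<union> ?U2))" by blast
    have h0: "R holomorphic_on ?U0"
    proof (rule holomorphic_transform)
      show "rot_remainder N 1 holomorphic_on ?U0" using rot_remainder_holomorphic[of 1 N] unfolding S1 by simp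
    qed (auto simp: R_def)
    have h1: "R holomorphic_on ?U1"
      by (rule holomorphic_transform[OF holomorphic_on_subset[OF rot_remainder_holomorphic[OF c(3), of N]]])
        (use eq[OF c(1,3)] in \<open>auto simp: R_def\<close>)
    have h2: "R holomorphic_on ?U2"
      by (rule holomorphic_transform[OF holomorphic_on_subset[OF rot_remainder_holomorphic[OF c(4), of N]]])
        (use eq[OF c(2,4)] in \<open>auto simp: R_def\<close>)
    show "R holomorphic_on ?U0 \<union> (?U1 \<union> ?U2)"
      using op by (intro holomorphic_on_Un h0 h1 h2) auto
    show "{\<nu>. \<nu> \<noteq> 0 \<and> \<bar>Arg \<nu>\<bar> \<le> pi / 2} \<subseteq> ?U0 \<union> (?U1 \<union> ?U2)"
    proof
      fix \<nu> :: complex assume "\<nu> \<in> {\<nu>. \<nu> \<noteq> 0 \<and> \<bar>Arg \<nu>\<bar> \<le> pi / 2}"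
      then have \<nu>: "\<nu> \<noteq> 0" "0 \<le> Re \<nu>" using Arg_Re_nonneg[of \<nu>] by auto
      show "\<nu> \<in> ?U0 \<union> (?U1 \<union> ?U2)"
      proof (cases "0 < Re \<nu>")
        case False
        with \<nu> have r: "Re \<nu> = 0" "Im \<nu> \<noteq> 0" by (auto simp: complex_eq_iff)
        have "Re (c / \<nu>) = Im c / Im \<nu>" "Re (cnj c / \<nu>) = - Im c / Im \<nu>"
          using r by (simp_all add: Re_divide power2_eq_square)
        then show ?thesis using r c by (cases "0 < Im \<nu>") (auto simp: zero_less_divide_iff divide_less_0_iff)
      qed simp
    qed
  qed
  moreover have "anger_weber (- \<nu>) (\<nu> * of_real (sec \<beta>)) =
          - (1 / of_real pi) * (\<Sum>n<N. fact (2 * n) * of_real (anger_coeff n \<beta>) / \<nu> ^ (2 * n + 1)) + R \<nu>"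
    if "\<nu> \<noteq> 0 \<and> \<bar>Arg \<nu>\<bar> < pi / 2" for \<nu>
  proof -
    have \<nu>: "0 < Re \<nu>" using that Arg_Re_pos[of \<nu>] by blast
    moreover from this have "0 < Re (1 / \<nu>)" using S1 by auto
    ultimately show ?thesis
      using anger_weber_expansion[OF \<nu>, of N] rot_remainder_eq[of 1 \<nu> N] by (simp add: R_def)
  qed
  ultimately show ?thesis unfolding is_anger_remainder_def by blast
qed

lemma is_anger_remainder_anger_remainder: "is_anger_remainder N \<beta> (\<lambda>\<nu>. anger_remainder N \<nu> \<beta>)"
  unfolding anger_remainder_def by (rule someI_ex[OF ex_anger_remainder])

text \<open>In the open half-plane the defining equation leaves no freedom, so the chosen function
  must be the one from the expansion.\<close>

lemma anger_remainder_eq: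
  assumes "0 < Re \<nu>"
  shows "anger_remainder N \<nu> \<beta> = of_real (2 / pi\<^sup>2 * (-1) ^ N) * (\<integral>x. terminant (2 * N) (\<nu> * of_real (height x)) \<partial>half_line)"
proof -
  have "\<nu> \<noteq> 0 \<and> \<bar>Arg \<nu>\<bar> < pi / 2" using assms Arg_Re_pos[of \<nu>] by auto
  then show ?thesis
    using is_anger_remainder_anger_remainder[of N] anger_weber_expansion[OF assms, of N]
    unfolding is_anger_remainder_def by simp
qed

text \<open>Along the ray in direction \<open>cis \<phi>\<close> the denominator of the terminant
  has the form \<open>1 + \<rho> * cis (2 * (\<phi> - Arg \<nu>))\<close> with
  \<open>\<rho> \<ge> 0\<close>. The two conditions on \<open>\<phi>\<close> ensure decay of the
  exponential and that no pole is crossed between the two rays.\<close>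

lemma norm_anger_remainder_le:
  assumes \<nu>: "0 < Re \<nu>" and \<phi>: "\<bar>\<phi>\<bar> < pi / 2" "\<bar>\<phi> - Arg \<nu>\<bar> < pi / 2" and m: "0 < m"
    and le: "\<And>\<rho>. 0 \<le> \<rho> \<Longrightarrow> m \<le> norm (1 + of_real \<rho> * cis (2 * (\<phi> - Arg \<nu>)))"
  shows "norm (anger_remainder N \<nu> \<beta>)
    \<le> 1 / pi * (fact (2 * N) * \<bar>anger_coeff N \<beta>\<bar> / norm \<nu> ^ (2 * N + 1)) * (1 / (m * cos \<phi> ^ (2 * N + 1)))"
proof -
  have nz: "\<nu> \<noteq> 0" using \<nu> by auto
  have "cis \<phi> / \<nu> = of_real (1 / norm \<nu>) * cis (\<phi> - Arg \<nu>)"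
    using cis_divide_polar[OF nz, of \<phi> 1] by simp
  then have "Re (cis \<phi> / \<nu>) = cos (\<phi> - Arg \<nu>) / norm \<nu>" by simp
  moreover have "0 < cos (\<phi> - Arg \<nu>)" using \<phi>(2) by (intro cos_gt_zero_pi) linarith+
  ultimately have 1: "0 < Re (cis \<phi> / \<nu>)" using nz by simp
  have 2: "0 < Re (cis \<phi>)" using \<phi>(1) by (auto intro!: cos_gt_zero_pi)
  have "anger_remainder N \<nu> \<beta> = rot_remainder N (cis \<phi>) \<nu>"
    unfolding anger_remainder_eq[OF \<nu>] by (rule rot_remainder_eq[symmetric]) (use 1 2 \<nu> in auto)
  also have "norm \<dots> \<le> 1 / pi * (fact (2 * N) * \<bar>anger_coeff N \<beta>\<bar> / norm \<nu> ^ (2 * N + 1)) * (1 / (m * Re (cis \<phi>) ^ (2 * N + 1)))"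
    by (rule norm_rot_remainder_le[OF 2 _ m _ 1]) (simp_all only: norm_cis one_plus_square_polar[OF nz] le zero_le_power2)
  finally show ?thesis by simp
qed

text \<open>The unturned ray, \<open>\<phi> = 0\<close>. The two cases are the two estimates of
  \<open>norm_one_plus_cis_ge\<close> at the angle \<open>- 2 * Arg \<nu>\<close>, whose cosine is
  nonnegative exactly in the second case.\<close>

lemma norm_anger_remainder_le_csc:
  assumes \<nu>: "0 < Re \<nu>"
  shows "norm (anger_remainder N \<nu> \<beta>)
    \<le> 1 / pi * (fact (2 * N) * \<bar>anger_coeff N \<beta>\<bar> / norm \<nu> ^ (2 * N + 1))
        * (if pi / 4 < \<bar>Arg \<nu>\<bar> then \<bar>csc (2 * Arg \<nu>)\<bar> else 1)"
proof -
  have A: "\<bar>Arg \<nu>\<bar> < pi / 2" using \<nu> Arg_Re_pos[of \<nu>] by simp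
  show ?thesis
  proof (cases "pi / 4 < \<bar>Arg \<nu>\<bar>")
    case True
    have "0 < sin (2 * \<bar>Arg \<nu>\<bar>)" using A True by (intro sin_gt_zero) auto
    then have pos: "0 < \<bar>sin (2 * Arg \<nu>)\<bar>" by (auto simp: abs_if split: if_splits)
    have "norm (anger_remainder N \<nu> \<beta>)
      \<le> 1 / pi * (fact (2 * N) * \<bar>anger_coeff N \<beta>\<bar> / norm \<nu> ^ (2 * N + 1)) * (1 / (\<bar>sin (2 * Arg \<nu>)\<bar> * cos 0 ^ (2 * N + 1)))"
      using A norm_one_plus_cis_ge(1)[of _ "2 * (0 - Arg \<nu>)"]
      by (intro norm_anger_remainder_le[OF \<nu> _ _ pos]) auto
    then show ?thesis using True by (simp add: csc_def)
  next
    case False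
    then have "0 \<le> cos (2 * (0 - Arg \<nu>))" by (intro cos_ge_zero) auto
    then have "norm (anger_remainder N \<nu> \<beta>)
      \<le> 1 / pi * (fact (2 * N) * \<bar>anger_coeff N \<beta>\<bar> / norm \<nu> ^ (2 * N + 1)) * (1 / (1 * cos 0 ^ (2 * N + 1)))"
      using A norm_one_plus_cis_ge(2)[of _ "2 * (0 - Arg \<nu>)"]
      by (intro norm_anger_remainder_le[OF \<nu>]) auto
    then show ?thesis using False by simp
  qed
qed

text \<open>One angle works for all \<open>\<theta>\<close>: for \<open>c = cis (\<plusminus>\<phi>)\<close> the denominator stays above \<open>sin (2 \<phi>)\<close> in modulus
  whenever \<open>pi / 4 < \<bar>\<theta>\<bar> < pi / 2\<close>.\<close>

lemma norm_anger_remainder_le_sqrt: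
  assumes \<nu>: "0 < Re \<nu>" and A: "pi / 4 < \<bar>Arg \<nu>\<bar>"
  shows "norm (anger_remainder N \<nu> \<beta>)
    \<le> sqrt (exp 1 / 2 * (real N + 3 / 2)) * (1 / pi * (fact (2 * N) * \<bar>anger_coeff N \<beta>\<bar> / norm \<nu> ^ (2 * N + 1)))"
proof -
  define \<phi> where "\<phi> = arctan (1 / sqrt (2 * real N + 2))"
  have \<phi>: "0 < \<phi>" "\<phi> < pi / 4" and opt: "1 / (sin (2 * \<phi>) * cos \<phi> ^ (2 * N + 1)) \<le> sqrt (exp 1 / 2 * (real N + 3 / 2))"
    using optimal_angle_bound[of N] unfolding \<phi>_def by auto
  \<comment> \<open>The ray is turned to the same side as \<open>\<nu>\<close>; by symmetry only
    \<open>a = \<bar>Arg \<nu>\<bar>\<close> matters afterwards.\<close>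
  define s where "s = sgn (Arg \<nu>)"
  have s: "Arg \<nu> = s * \<bar>Arg \<nu>\<bar>" "s = 1 \<or> s = - 1" using A by (auto simp: s_def sgn_if)
  define a where "a = \<bar>Arg \<nu>\<bar>"
  have a: "pi / 4 < a" "a < pi / 2" using A \<nu> Arg_Re_pos[of \<nu>] by (simp_all add: a_def)
  have Arg: "Arg \<nu> = s * a" using s(1) by (simp add: a_def)
  have sin2: "0 < sin (2 * \<phi>)" using \<phi> by (intro sin_gt_zero) auto
  have psi: "cos (2 * (s * \<phi> - Arg \<nu>)) = cos (2 * (a - \<phi>))" "\<bar>sin (2 * (s * \<phi> - Arg \<nu>))\<bar> = \<bar>sin (2 * (a - \<phi>))\<bar>"
  proof -
    have "2 * (s * \<phi> - Arg \<nu>) = 2 * (a - \<phi>) \<or> 2 * (s * \<phi> - Arg \<nu>) = - (2 * (a - \<phi>))"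
      using s(2) by (auto simp: Arg)
    then show "cos (2 * (s * \<phi> - Arg \<nu>)) = cos (2 * (a - \<phi>))" "\<bar>sin (2 * (s * \<phi> - Arg \<nu>))\<bar> = \<bar>sin (2 * (a - \<phi>))\<bar>"
      by (metis cos_minus, metis sin_minus abs_minus_cancel)
  qed
  have "norm (anger_remainder N \<nu> \<beta>)
    \<le> 1 / pi * (fact (2 * N) * \<bar>anger_coeff N \<beta>\<bar> / norm \<nu> ^ (2 * N + 1)) * (1 / (sin (2 * \<phi>) * cos (s * \<phi>) ^ (2 * N + 1)))"
  proof (rule norm_anger_remainder_le[OF \<nu> _ _ sin2])
    show "\<bar>s * \<phi>\<bar> < pi / 2" "\<bar>s * \<phi> - Arg \<nu>\<bar> < pi / 2" using s(2) \<phi> a by (auto simp: Arg)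
    fix \<rho> :: real assume \<rho>: "0 \<le> \<rho>"
    show "sin (2 * \<phi>) \<le> norm (1 + of_real \<rho> * cis (2 * (s * \<phi> - Arg \<nu>)))"
    \<comment> \<open>In the first case the ray of the denominator points to the right and the bound
      is 1. In the second, \<open>2 * (a - \<phi>)\<close> lies between \<open>pi / 2\<close> and
      \<open>pi - 2 * \<phi>\<close>, where the sine decreases to
      \<open>sin (2 * \<phi>)\<close>.\<close>
    proof (cases "a - \<phi> \<le> pi / 4")
      case True
      then have "0 \<le> cos (2 * (a - \<phi>))" using \<phi> a by (intro cos_ge_zero) auto
      then have "1 \<le> norm (1 + of_real \<rho> * cis (2 * (s * \<phi> - Arg \<nu>)))"
        by (intro norm_one_plus_cis_ge(2)[OF \<rho>]) (simp only: psi)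
      then show ?thesis using sin_le_one[of "2 * \<phi>"] by linarith
    next
      case False
      have "sin (2 * \<phi>) = sin (pi - 2 * \<phi>)" by simp
      also have "\<dots> \<le> sin (2 * (a - \<phi>))"
        using cos_monotone_0_pi_le[of "2 * (a - \<phi>) - pi / 2" "pi / 2 - 2 * \<phi>"] False a \<phi>
        by (simp add: cos_diff)
      also have "\<dots> \<le> \<bar>sin (2 * (s * \<phi> - Arg \<nu>))\<bar>" unfolding psi by (rule abs_ge_self)
      also have "\<dots> \<le> norm (1 + of_real \<rho> * cis (2 * (s * \<phi> - Arg \<nu>)))" by (rule norm_one_plus_cis_ge(1)[OF \<rho>])
      finally show ?thesis .
    qed
  qed
  also have "cos (s * \<phi>) = cos \<phi>" using s(2) by auto
  also have "1 / pi * (fact (2 * N) * \<bar>anger_coeff N \<beta>\<bar> / norm \<nu> ^ (2 * N + 1)) * (1 / (sin (2 * \<phi>) * cos \<phi> ^ (2 * N + 1)))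
    \<le> 1 / pi * (fact (2 * N) * \<bar>anger_coeff N \<beta>\<bar> / norm \<nu> ^ (2 * N + 1)) * sqrt (exp 1 / 2 * (real N + 3 / 2))"
    by (intro mult_left_mono opt) auto
  finally show ?thesis by (simp only: mult.commute)
qed

lemma Arg_gt_pi_quarter: "pi / 4 < \<bar>Arg z\<bar>" if "0 < Re z" "Re z < \<bar>Im z\<bar>"
proof (rule ccontr)
  assume "\<not> pi / 4 < \<bar>Arg z\<bar>"
  then have a: "\<bar>Arg z\<bar> \<le> pi / 4" by simp
  have "sin \<bar>Arg z\<bar> \<le> sin (pi / 4)" using a by (intro sin_monotone_2pi_le) auto
  moreover have "cos (pi / 4) \<le> cos \<bar>Arg z\<bar>" using a by (intro cos_monotone_0_pi_le) auto
  ultimately have "sin \<bar>Arg z\<bar> \<le> cos \<bar>Arg z\<bar>" by (simp add: sin_45 cos_45)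
  moreover have "sin \<bar>Arg z\<bar> = \<bar>sin (Arg z)\<bar>"
    using a pi_gt_zero sin_ge_zero[of "\<bar>Arg z\<bar>"] by (auto simp: abs_if split: if_splits)
  ultimately have "norm z * \<bar>sin (Arg z)\<bar> \<le> norm z * cos (Arg z)" by (intro mult_left_mono) auto
  moreover have "Re z = norm z * cos (Arg z)" "Im z = norm z * sin (Arg z)"
    by (metis Re_rcis rcis_cmod_Arg, metis Im_rcis rcis_cmod_Arg)
  ultimately show False using that by (simp add: abs_mult)
qed

text \<open>Points of the imaginary axis are approached horizontally from the right. Once the real
  part is below \<open>\<bar>Im \<nu>\<bar>\<close>, the approximating points have argument beyond
  \<open>pi / 4\<close> in modulus, and the bound passes to the limit by continuity of the continued
  remainder.\<close>

lemma norm_anger_remainder_le_sqrt_closed: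
  assumes \<nu>: "\<nu> \<noteq> 0" "\<bar>Arg \<nu>\<bar> \<le> pi / 2" and A: "pi / 4 < \<bar>Arg \<nu>\<bar>"
  shows "norm (anger_remainder N \<nu> \<beta>)
    \<le> sqrt (exp 1 / 2 * (real N + 3 / 2)) * (1 / pi * (fact (2 * N) * \<bar>anger_coeff N \<beta>\<bar> / norm \<nu> ^ (2 * N + 1)))"
proof (cases "0 < Re \<nu>")
  case True
  then show ?thesis using A by (rule norm_anger_remainder_le_sqrt)
next
  case False
  then have r: "Re \<nu> = 0" "Im \<nu> \<noteq> 0" using \<nu> Arg_Re_nonneg[of \<nu>] by (auto simp: complex_eq_iff)
  define X where "X n = \<nu> + of_real (inverse (real (Suc n)))" for n
  have X: "X \<longlonglongrightarrow> \<nu>"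
  proof -
    have "X \<longlonglongrightarrow> \<nu> + of_real 0"
      unfolding X_def [abs_def] by (intro tendsto_add tendsto_const tendsto_of_real LIMSEQ_inverse_real_of_nat)
    then show ?thesis by simp
  qed
  have "(\<lambda>\<nu>. anger_remainder N \<nu> \<beta>) analytic_on {\<nu>}"
    using is_anger_remainder_anger_remainder[of N] \<nu> unfolding is_anger_remainder_def
    by (auto intro: analytic_on_subset)
  then have cont: "isCont (\<lambda>\<nu>. anger_remainder N \<nu> \<beta>) \<nu>" by (rule analytic_at_imp_isCont)
  have "(\<lambda>n. inverse (real (Suc n))) \<longlonglongrightarrow> 0" by (rule LIMSEQ_inverse_real_of_nat)
  then have "\<forall>\<^sub>F n in sequentially. inverse (real (Suc n)) < \<bar>Im \<nu>\<bar>"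
    by (rule order_tendstoD(2)) (use r in simp)
  then have ev: "\<forall>\<^sub>F n in sequentially. norm (anger_remainder N (X n) \<beta>)
    \<le> sqrt (exp 1 / 2 * (real N + 3 / 2)) * (1 / pi * (fact (2 * N) * \<bar>anger_coeff N \<beta>\<bar> / norm (X n) ^ (2 * N + 1)))"
  proof eventually_elim
    case (elim n)
    have X': "Re (X n) = inverse (real (Suc n))" "Im (X n) = Im \<nu>" by (simp_all only: X_def plus_complex.sel Re_complex_of_real Im_complex_of_real r add_0 add_0_right)
    have "0 < inverse (real (Suc n))" by simp
    then show ?case using elim unfolding X'[symmetric]
      by (intro norm_anger_remainder_le_sqrt Arg_gt_pi_quarter) (simp_all only: X')
  qed
  show ?thesis
  proof (rule tendsto_le[OF _ _ _ ev])
    show "(\<lambda>n. norm (anger_remainder N (X n) \<beta>)) \<longlonglongrightarrow> norm (anger_remainder N \<nu> \<beta>)"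
      by (intro tendsto_norm isCont_tendsto_compose[OF cont X])
    show "(\<lambda>n. sqrt (exp 1 / 2 * (real N + 3 / 2)) * (1 / pi * (fact (2 * N) * \<bar>anger_coeff N \<beta>\<bar> / norm (X n) ^ (2 * N + 1))))
      \<longlonglongrightarrow> sqrt (exp 1 / 2 * (real N + 3 / 2)) * (1 / pi * (fact (2 * N) * \<bar>anger_coeff N \<beta>\<bar> / norm \<nu> ^ (2 * N + 1)))"
      using \<nu> by (intro tendsto_intros X) auto
  qed simp
qed

text \<open>For positive \<open>\<nu>\<close> every terminant lies strictly between 0 and
  \<open>K / height x ^ (2 * N + 1)\<close>. Hence \<open>\<Theta>\<close> is the quotient of the
  integrated terminant by the integral of that bound.\<close>

lemma anger_remainder_positive:
  assumes \<nu>: "0 < \<nu>"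
  shows "\<exists>\<Theta>::real. 0 < \<Theta> \<and> \<Theta> < 1 \<and>
    anger_remainder N (of_real \<nu>) \<beta> = of_real (- (1 / pi) * (fact (2 * N) * anger_coeff N \<beta> / \<nu> ^ (2 * N + 1)) * \<Theta>)"
proof -
  define \<tau> where "\<tau> x = Re (terminant (2 * N) (of_real (\<nu> * height x)))" for x
  define K where "K = fact (2 * N) / \<nu> ^ (2 * N + 1)"
  have K: "0 < K" using \<nu> by (simp add: K_def)
  have \<tau>: "terminant (2 * N) (of_real (\<nu> * height x)) = of_real (\<tau> x)" "0 < \<tau> x" "\<tau> x < K * (1 / height x ^ (2 * N + 1))"
    if "0 \<le> x" for x
  proof -
    have "0 < \<nu> * height x" using \<nu> height_pos[OF that] by simp
    then obtain t where t: "terminant (2 * N) (of_real (\<nu> * height x)) = of_real t" "0 < t" "t < fact (2 * N) / (\<nu> * height x) ^ Suc (2 * N)"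
      by (rule terminant_of_real)
    then have "\<tau> x = t" by (simp add: \<tau>_def)
    with t show "terminant (2 * N) (of_real (\<nu> * height x)) = of_real (\<tau> x)" "0 < \<tau> x" "\<tau> x < K * (1 / height x ^ (2 * N + 1))"
      by (simp_all add: K_def power_mult_distrib mult_ac)
  qed
  have int: "integrable half_line (\<lambda>x. K * (1 / height x ^ (2 * N + 1)))"
    using inverse_height_integrable[of "2 * N"] by (intro integrable_mult_right) simp
  have \<tau>_int: "integrable half_line \<tau>"
  proof (rule Bochner_Integration.integrable_bound[OF int])
    have "continuous_on {0..} (\<lambda>x. terminant (2 * N) (of_real (\<nu> * height x)))"
      by (rule continuous_on_compose2[OF holomorphic_on_imp_continuous_on[OF terminant_holomorphic]])
        (use \<nu> height_pos in \<open>auto intro!: continuous_intros continuous_height\<close>)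
    then show "\<tau> \<in> borel_measurable half_line"
      unfolding \<tau>_def [abs_def] by (intro measurable_half_line_continuous continuous_intros)
    show "AE x in half_line. norm (\<tau> x) \<le> norm (K * (1 / height x ^ (2 * N + 1)))"
    proof (rule AE_I2)
      fix x assume "x \<in> space half_line"
      then show "norm (\<tau> x) \<le> norm (K * (1 / height x ^ (2 * N + 1)))"
        using \<tau>(2,3)[of x] unfolding real_norm_def space_half_line atLeast_iff by linarith
    qed
  qed
  define I where "I = (\<integral>x. \<tau> x \<partial>half_line)"
  define J where "J = (\<integral>x. 1 / height x ^ (2 * N + 1) \<partial>half_line)"
  have I: "0 < I" unfolding I_def using \<tau>(2) by (intro half_line_integral_pos \<tau>_int) simp
  have "0 < (\<integral>x. K * (1 / height x ^ (2 * N + 1)) - \<tau> x \<partial>half_line)"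
  proof (rule half_line_integral_pos)
    show "integrable half_line (\<lambda>x. K * (1 / height x ^ (2 * N + 1)) - \<tau> x)"
      by (intro Bochner_Integration.integrable_diff int \<tau>_int)
    show "0 < K * (1 / height x ^ (2 * N + 1)) - \<tau> x" if "0 < x" for x using \<tau>(3)[of x] that by simp
  qed
  then have IJ: "I < K * J"
    unfolding Bochner_Integration.integral_diff[OF int \<tau>_int] integral_mult_right_zero I_def J_def by simp
  show ?thesis
  proof (intro exI conjI)
    show "0 < I / (K * J)" "I / (K * J) < 1" using I IJ by (auto intro!: divide_pos_pos)
    have "(\<integral>x. terminant (2 * N) (of_real \<nu> * of_real (height x)) \<partial>half_line) = (\<integral>x. complex_of_real (\<tau> x) \<partial>half_line)"
      using \<tau>(1) by (intro Bochner_Integration.integral_cong) auto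
    also have "\<dots> = of_real I" unfolding I_def by (rule integral_complex_of_real)
    finally have "anger_remainder N (of_real \<nu>) \<beta> = of_real (2 / pi\<^sup>2 * (-1) ^ N * I)"
      using anger_remainder_eq[of "of_real \<nu>" N] \<nu> by simp
    also have "2 / pi\<^sup>2 * (-1) ^ N * I = 2 / pi\<^sup>2 * (-1) ^ N * (K * J) * (I / (K * J))"
    proof -
      have "K * J \<noteq> 0" using I IJ by linarith
      moreover have "a * I = a * q * (I / q)" if "q \<noteq> 0" for a q using that by simp
      ultimately show ?thesis by blast
    qed
    \<comment> \<open>The sign \<open>(-1) ^ N\<close> of the remainder formula cancels the one in
      \<open>moment_integral\<close>.\<close>
    also have "2 / pi\<^sup>2 * (-1) ^ N * (K * J) = - (1 / pi) * (fact (2 * N) * anger_coeff N \<beta> / \<nu> ^ (2 * N + 1))"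
    proof -
      have "((-1) ^ N :: real) * (-1) ^ N = 1" by (simp flip: power_mult_distrib)
      moreover have "2 / pi\<^sup>2 * s * (K * (s * (pi / 2) * (- anger_coeff N \<beta>))) = (s * s) * (- (1 / pi) * (K * anger_coeff N \<beta>))" for s
        by (simp add: power2_eq_square mult_ac)
      ultimately have "2 / pi\<^sup>2 * (-1) ^ N * (K * J) = - (1 / pi) * (K * anger_coeff N \<beta>)"
        unfolding J_def moment_integral by (simp only: mult_1)
      then show ?thesis by (simp add: K_def)
    qed
    finally show "anger_remainder N (of_real \<nu>) \<beta> = of_real (- (1 / pi) * (fact (2 * N) * anger_coeff N \<beta> / \<nu> ^ (2 * N + 1)) * (I / (K * J)))" .
  qed
qed

end

theorem mainTheorem5:
  fixes \<beta> :: real and N :: nat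
  assumes "0 < \<beta>" and "\<beta> < pi / 2"
  shows
    "(\<forall>\<nu>::complex. \<nu> \<noteq> 0 \<and> \<bar>Arg \<nu>\<bar> < pi / 2 \<longrightarrow>
        cmod (anger_remainder N \<nu> \<beta>)
          \<le> 1 / pi * (fact (2 * N) * \<bar>anger_coeff N \<beta>\<bar> / cmod \<nu> ^ (2 * N + 1))
              * (if pi / 4 < \<bar>Arg \<nu>\<bar> then \<bar>csc (2 * Arg \<nu>)\<bar> else 1))
     \<and>
     (\<forall>\<nu>::real. 0 < \<nu> \<longrightarrow>
        (\<exists>\<Theta>::real. 0 < \<Theta> \<and> \<Theta> < 1 \<and>
           anger_remainder N (of_real \<nu>) \<beta>
             = of_real (- (1 / pi) * (fact (2 * N) * anger_coeff N \<beta> / \<nu> ^ (2 * N + 1)) * \<Theta>)))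
     \<and>
     (\<forall>\<nu>::complex. \<nu> \<noteq> 0 \<and> \<bar>Arg \<nu>\<bar> \<le> pi / 2 \<and>
        (pi / 4 + arctan (((4 * real N + 5) / 2) powr (- 1 / 2)) < \<bar>Arg \<nu>\<bar>
          \<or> 1 \<le> N \<and> pi / 4 < \<bar>Arg \<nu>\<bar>) \<longrightarrow>
        cmod (anger_remainder N \<nu> \<beta>)
          \<le> sqrt (exp 1 / 2 * (real N + 3 / 2))
              * (1 / pi * (fact (2 * N) * \<bar>anger_coeff N \<beta>\<bar> / cmod \<nu> ^ (2 * N + 1))))"
proof -
  interpret anger_curve \<beta> using assms by unfold_locales
  have "0 < arctan (((4 * real N + 5) / 2) powr (- 1 / 2))"
    by (simp add: zero_less_arctan_iff)
  then have "pi / 4 < \<bar>Arg \<nu>\<bar>"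
    if "pi / 4 + arctan (((4 * real N + 5) / 2) powr (- 1 / 2)) < \<bar>Arg \<nu>\<bar> \<or> 1 \<le> N \<and> pi / 4 < \<bar>Arg \<nu>\<bar>" for \<nu>
    using that by linarith
  moreover have "0 < Re \<nu>" if "\<nu> \<noteq> 0 \<and> \<bar>Arg \<nu>\<bar> < pi / 2" for \<nu>
    using that Arg_Re_pos[of \<nu>] by blast
  ultimately show ?thesis
    by (intro conjI allI impI norm_anger_remainder_le_csc anger_remainder_positive norm_anger_remainder_le_sqrt_closed) blast+
qed

end
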